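(* Let $\varphi$ be a probability density on $\mathbb{R}^d$ with values in $[0,1]$, let $K:=\widehat\varphi:\mathbb{R}^d\to\mathbb{C}$, and let $\omega$ be the determinantal point process on $\mathbb{R}^d$ associated with the translation-invariant kernel $K(x,y):=K(x-y)$. Then, almost surely, the autocorrelation measure $\gamma$ and the diffraction measure $\widehat\gamma$ of $\omega$ exist and are given by \[ \gamma=\delta_0+(1-|K|^2)\,\lambda^d\qquad\text{and}\qquad\widehat\gamma=\delta_0+(1-\widehat{|K|^2})\,\lambda^d . \] Equivalently, \[ \gamma=\delta_0+(1-|\widehat\varphi|^2)\,\lambda^d\qquad\text{and}\qquad\widehat\gamma=\delta_0+\bigl(1-(\varphi\ast\varphi_-)\bigr)\,\lambda^d , \] where $\varphi_-(x):=\varphi(-x)$.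
   Context: A point process on $\mathbb{R}^d$ is a random variable $\omega$ with values in the space of locally finite $\mathbb{N}_0\cup\{\infty\}$-valued Borel measures on $\mathbb{R}^d$. Writing $\omega=\sum_{i\in I}\delta_{x_i}$, put $\omega^{\bullet k}:=\sum_{i_1,\dots,i_k\in I\ \text{distinct}}\delta_{(x_{i_1},\dots,x_{i_k})}$. If $\mathbb{E}(\omega(A)^k)<\infty$ for all bounded Borel $A$, the $k$th factorial moment measure is the expectation measure $\mathbb{E}(\omega^{\bullet k}(\cdot))$ on $(\mathbb{R}^d)^k$; if it is absolutely continuous, its density $\varrho_k$ is the $k$-point correlation function. $\omega$ is determinantal with kernel $K(x,y)$ if, for every $k\in\mathbb{N}$, $\varrho_k$ exists and $\varrho_k(x_1,\dots,x_k)=\det\bigl(K(x_i,x_j)\bigr)_{1\le i,j\le k}$. For kernels of the form considered here, a determinantal point process exists and is unique in distribution; this is "the associated" process. $\lambda^d$ is Lebesgue measure on $\mathbb{R}^d$, and $F\,\lambda^d$ is the (signed) measure with density $F$. Fourier transform of functions: $\widehat f(y)=\int_{\mathbb{R}^d}f(x)e^{-2\pi i xy}\,dx$ for $f\in L^1(\mathbb{R}^d)$. (Since $\varphi\in L^1\cap L^2$, one has $K\in L^2$ and $|K|^2\in L^1$.) For a locally finite measure $\omega$, with $\widetilde\omega(A):=\omega(-A)$ and $B_n$ the open ball of radius $n$ around $0$, the autocorrelation measure is the vague limit $\gamma:=\lim_{n\to\infty}\frac{\omega|_{B_n}\ast\widetilde{\omega|_{B_n}}}{\lambda^d(B_n)}$,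 if it exists. The diffraction measure is the Fourier transform $\widehat\gamma$ of $\gamma$, i.e. the unique translation-bounded measure with $\int f\,d\widehat\gamma=\int\widehat f\,d\gamma$ for all Schwartz functions $f$ (translation-bounded: $\sup_x\mu(x+B)<\infty$ for every bounded Borel $B$). For a point process these notions are applied to its realisations. *)

theory Defs
  imports "HOL-Probability.Probability" "Jordan_Normal_Form.Determinant"
begin

section \<open>Point processes\<close>

definition locally_finite_borel :: "'a::euclidean_space measure \<Rightarrow> bool" where
  "locally_finite_borel \<mu> \<longleftrightarrow>
     sets \<mu> = sets borel \<and> (\<forall>A\<in>sets borel. bounded A \<longrightarrow> emeasure \<mu> A < \<infinity>)"

definition counting_measures :: "'a::euclidean_space measure set" where
  "counting_measures =
     {N. locally_finite_borel N \<and> (\<forall>A\<in>sets borel. emeasure N A \<in> range of_nat \<union> {\<infinity>})}"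

text \<open>The \<open>\<sigma>\<close>-algebra is generated by the evaluations \<open>N \<mapsto> N A\<close>; it coincides with the
  Borel \<open>\<sigma>\<close>-algebra of the vague topology. Compare \<^const>\<open>subprob_algebra\<close>.\<close>

definition counting_measure_space :: "'a::euclidean_space measure measure" where
  "counting_measure_space =
     (SUP A\<in>sets borel. vimage_algebra counting_measures (\<lambda>N. emeasure N A) borel)"

definition point_process :: "'w measure \<Rightarrow> ('w \<Rightarrow> 'a::euclidean_space measure) \<Rightarrow> bool" where
  "point_process M \<omega> \<longleftrightarrow> prob_space M \<and> \<omega> \<in> measurable M counting_measure_space"


section \<open>Correlation functions\<close>

text \<open>The canonical index set \<open>I\<close> of a representation \<open>N = (\<Sum>i\<in>I. \<delta>\<^bsub>x i\<^esub>)\<close>: an atom \<open>p\<close> of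
  multiplicity \<open>m\<close> contributes the indices \<open>(p, 0), \<dots>, (p, m - 1)\<close>, and \<open>x = fst\<close>.\<close>

definition point_indices :: "'a::euclidean_space measure \<Rightarrow> ('a \<times> nat) set" where
  "point_indices N = {(p, j). of_nat j < emeasure N {p}}"

text \<open>The measure \<open>N\<^bsup>\<bullet>k\<^esup>\<close>, that is, the sum of the Dirac measures at \<open>(x i\<^sub>1, \<dots>, x i\<^sub>k)\<close> over
  all \<open>k\<close>-tuples of distinct indices. The space \<open>(\<real>\<^sup>d)\<^sup>k\<close> is rendered as the product
  \<open>\<Pi>\<^sub>M i\<in>{..<k}. borel\<close>.\<close>

definition factorial_power ::
  "nat \<Rightarrow> 'a::euclidean_space measure \<Rightarrow> (nat \<Rightarrow> 'a) measure" where
  "factorial_power k N =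
     distr (count_space {i \<in> {..<k} \<rightarrow>\<^sub>E point_indices N. inj_on i {..<k}})
       (\<Pi>\<^sub>M l\<in>{..<k}. borel) (\<lambda>i. \<lambda>l\<in>{..<k}. fst (i l))"

definition factorial_moment ::
  "'w measure \<Rightarrow> ('w \<Rightarrow> 'a::euclidean_space measure) \<Rightarrow> nat \<Rightarrow> (nat \<Rightarrow> 'a) set \<Rightarrow> ennreal" where
  "factorial_moment M \<omega> k C = (\<integral>\<^sup>+w. emeasure (factorial_power k (\<omega> w)) C \<partial>M)"

definition correlation_function ::
  "'w measure \<Rightarrow> ('w \<Rightarrow> 'a::euclidean_space measure) \<Rightarrow> nat \<Rightarrow> ((nat \<Rightarrow> 'a) \<Rightarrow> real) \<Rightarrow> bool" where
  "correlation_function M \<omega> k \<rho> \<longleftrightarrow>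
     (\<forall>A\<in>sets borel. bounded A \<longrightarrow> (\<integral>\<^sup>+w. emeasure (\<omega> w) A ^ k \<partial>M) < \<infinity>) \<and>
     \<rho> \<in> borel_measurable (\<Pi>\<^sub>M i\<in>{..<k}. lborel) \<and> (\<forall>x. 0 \<le> \<rho> x) \<and>
     (\<forall>C\<in>sets (\<Pi>\<^sub>M i\<in>{..<k}. borel).
        factorial_moment M \<omega> k C
          = emeasure (density (\<Pi>\<^sub>M i\<in>{..<k}. lborel) (\<lambda>x. ennreal (\<rho> x))) C)"

text \<open>Correlation functions are densities, hence the identity with the determinant is
  required up to Lebesgue null sets.\<close>

definition determinantal ::
  "'w measure \<Rightarrow> ('w \<Rightarrow> 'a::euclidean_space measure) \<Rightarrow> ('a \<Rightarrow> 'a \<Rightarrow> complex) \<Rightarrow> bool" where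
  "determinantal M \<omega> K \<longleftrightarrow> point_process M \<omega> \<and>
     (\<forall>k\<ge>1. \<exists>\<rho>. correlation_function M \<omega> k \<rho> \<and>
        (AE x in (\<Pi>\<^sub>M i\<in>{..<k}. lborel).
           complex_of_real (\<rho> x) = Determinant.det (Matrix.mat k k (\<lambda>(i, j). K (x i) (x j)))))"


section \<open>Autocorrelation and diffraction\<close>

definition fourier :: "('a::euclidean_space \<Rightarrow> complex) \<Rightarrow> 'a \<Rightarrow> complex" where
  "fourier f y = (LINT x|lborel. f x * exp (- 2 * complex_of_real pi * \<i> * complex_of_real (inner x y)))"

definition fun_convolution ::
  "('a::euclidean_space \<Rightarrow> real) \<Rightarrow> ('a \<Rightarrow> real) \<Rightarrow> 'a \<Rightarrow> real" where
  "fun_convolution f g x = (LINT y|lborel. f y * g (x - y))"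

definition vague_limit ::
  "(nat \<Rightarrow> 'a::euclidean_space measure) \<Rightarrow> 'a measure \<Rightarrow> bool" where
  "vague_limit \<mu> \<nu> \<longleftrightarrow> locally_finite_borel \<nu> \<and>
     (\<forall>f::'a \<Rightarrow> real. continuous_on UNIV f \<longrightarrow> compact (closure {x. f x \<noteq> 0}) \<longrightarrow>
        (\<lambda>n. LINT x|\<mu> n. f x) \<longlonglongrightarrow> (LINT x|\<nu>. f x))"

definition restrict_to :: "'a::euclidean_space measure \<Rightarrow> 'a set \<Rightarrow> 'a measure" where
  "restrict_to N B = density N (indicator B)"

definition reflect :: "'a::euclidean_space measure \<Rightarrow> 'a measure" where
  "reflect N = distr N borel uminus"

text \<open>The library constant \<^const>\<open>convolution\<close>, which is restricted to class
  \<^class>\<open>ordered_euclidean_space\<close>.\<close>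

definition measure_convolution ::
  "'a::euclidean_space measure \<Rightarrow> 'a measure \<Rightarrow> 'a measure" where
  "measure_convolution M N = distr (M \<Otimes>\<^sub>M N) borel (\<lambda>(x, y). x + y)"

definition is_autocorrelation ::
  "'a::euclidean_space measure \<Rightarrow> 'a measure \<Rightarrow> bool" where
  "is_autocorrelation N \<gamma> \<longleftrightarrow>
     vague_limit
       (\<lambda>n. scale_measure (inverse (emeasure lborel (ball (0::'a) (real n))))
          (measure_convolution (restrict_to N (ball 0 (real n))) (reflect (restrict_to N (ball 0 (real n))))))
       \<gamma>"

definition translation_bounded :: "'a::euclidean_space measure \<Rightarrow> bool" where
  "translation_bounded \<mu> \<longleftrightarrow> sets \<mu> = sets borel \<and>
     (\<forall>B\<in>sets borel. bounded B \<longrightarrow> (SUP x. emeasure \<mu> ((+) x ` B)) < \<infinity>)"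

primrec iterated_partial ::
  "'a::euclidean_space list \<Rightarrow> ('a \<Rightarrow> complex) \<Rightarrow> 'a \<Rightarrow> complex" where
  "iterated_partial [] f = f"
| "iterated_partial (b # bs) f = iterated_partial bs (\<lambda>x. frechet_derivative f (at x) b)"

text \<open>Differentiability of all iterated partial derivatives amounts to smoothness.\<close>

definition schwartz :: "('a::euclidean_space \<Rightarrow> complex) \<Rightarrow> bool" where
  "schwartz f \<longleftrightarrow>
     (\<forall>bs. set bs \<subseteq> Basis \<longrightarrow>
        (\<forall>x. iterated_partial bs f differentiable (at x)) \<and>
        (\<forall>n. bounded (range (\<lambda>x. norm x ^ n *\<^sub>R iterated_partial bs f x))))"

text \<open>The Fourier transform \<open>\<mu>\<close> of \<open>\<gamma>\<close>, which is unique if it exists. Integrability is stated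
  explicitly since \<^const>\<open>lebesgue_integral\<close> is \<open>0\<close> for non-integrable functions.\<close>

definition is_fourier_transform ::
  "'a::euclidean_space measure \<Rightarrow> 'a measure \<Rightarrow> bool" where
  "is_fourier_transform \<gamma> \<mu> \<longleftrightarrow> translation_bounded \<mu> \<and>
     (\<forall>f. schwartz f \<longrightarrow>
        integrable \<mu> f \<and> integrable \<gamma> (fourier f) \<and>
        (LINT x|\<mu>. f x) = (LINT x|\<gamma>. fourier f x))"

definition is_diffraction :: "'a::euclidean_space measure \<Rightarrow> 'a measure \<Rightarrow> bool" where
  "is_diffraction N \<mu> \<longleftrightarrow> (\<exists>\<gamma>. is_autocorrelation N \<gamma> \<and> is_fourier_transform \<gamma> \<mu>)"

text \<open>The identity \<open>\<mu> = \<delta>\<^sub>0 + F \<lambda>\<^sup>d\<close>, where \<open>F \<lambda>\<^sup>d\<close> is a priori only a complex measure, finite on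
  bounded sets. It is read on bounded Borel sets, so that neither the sign nor the imaginary part
  of \<open>F\<close> is truncated.\<close>

definition eq_dirac_plus_density ::
  "'a::euclidean_space measure \<Rightarrow> ('a \<Rightarrow> complex) \<Rightarrow> bool" where
  "eq_dirac_plus_density \<mu> F \<longleftrightarrow> locally_finite_borel \<mu> \<and>
     (\<forall>A\<in>sets borel. bounded A \<longrightarrow>
        set_integrable lborel A F \<and>
        complex_of_real (measure \<mu> A)
          = complex_of_real (measure (return borel 0) A) + (LINT x:A|lborel. F x))"

end

theory Submission
  imports Defs "HOL-Library.Discrete_Functions" "HOL-Real_Asymp.Real_Asymp"
begin

text \<open>
  The proof is a second-moment argument and uses no ergodic theorem. For a bounded Borel set \<open>A\<close> let
  \<open>X n\<close> be the number of pairs of distinct points in the ball of radius \<open>n\<close> whose difference lies in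
  \<open>A\<close>. Since \<open>\<rho>\<^sub>2(x, y) = 1 - |K(x - y)|\<^sup>2\<close>, the mean of \<open>X n\<close> is asymptotic to the volume of the ball
  times \<open>\<integral>\<^sub>A (1 - |K|\<^sup>2)\<close>. In the Leibniz expansion of \<open>\<rho>\<^sub>4\<close> a permutation that mixes the two pairs
  contributes at least two factors \<open>K\<close> linking them, so \<open>|\<rho>\<^sub>4 - \<rho>\<^sub>2 \<otimes> \<rho>\<^sub>2|\<close> is bounded by a sum of values
  of \<open>|K|\<^sup>2\<close>; as \<open>K\<close> is square integrable, the variance of \<open>X n\<close> is of the order of the volume. Hence the
  normalised counts converge almost surely along the squares, and along all \<open>n\<close> because \<open>X n\<close> is
  monotone. Applied to the countably many cells of the grids of mesh \<open>1/(m + 1)\<close> this gives the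
  autocorrelation.

  Both the square integrability of \<open>K\<close> and the identity \<open>\<phi> * \<phi>\<^sub>-\<close> for the transform of \<open>|K|\<^sup>2\<close> come from
  Gaussian summation of the inverse transform of \<open>|K|\<^sup>2\<close>, which is the transform of \<open>\<phi> * \<phi>\<^sub>-\<close>; the
  diffraction then follows from Fourier inversion at \<open>0\<close> for Schwartz functions.
\<close>

section \<open>Counting measures\<close>

text \<open>Multiple points are allowed and correlation functions are fixed only up to null sets, so
  everything is counted over \<open>point_indices\<close>, where copies of one point are distinct.
  The restricted autocorrelation then counts ordered pairs of indices with difference in
  \<open>A\<close>, diagonal included. The diagonal pairs sit at 0 and produce \<delta>_0, through a
  separate law of large numbers for the number of points, whose intensity is \<open>K 0 = 1\<close>.
  The square of \<open>X n\<close> also contains pairs that share a point. These involve at most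
  three points at bounded distance, so a crude bound on the determinant makes them of the order of
  the volume. The squared relative deviation at n = k^2 is then O(k^(-2d)), summable in every
  dimension. Keeping both points in the ball makes \<open>X n\<close> monotone but loses pairs near
  the boundary; the loss amounts to changing the radius by a constant. For the diffraction,
  \<delta>_0 and Lebesgue measure exchange roles under the Fourier transform, so only |K|^2 has to
  be transformed.\<close>

lemma space_counting_measure_space:
  "space counting_measure_space = (counting_measures :: 'a::euclidean_space measure set)"
  by (auto simp add: counting_measure_space_def space_Sup_eq_UN)

lemma measurable_emeasure_counting_measure_space:
  assumes "\<omega> \<in> measurable M counting_measure_space" "A \<in> sets borel"
  shows "(\<lambda>w. emeasure (\<omega> w) A) \<in> borel_measurable M"
proof -
  have "(\<lambda>N. emeasure N A) \<in> borel_measurable counting_measure_space"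
    using assms(2) by (auto intro!: measurable_Sup1 measurable_vimage_algebra1
        simp: counting_measure_space_def)
  from measurable_compose[OF assms(1) this] show ?thesis .
qed

lemma sets_counting_measure: "N \<in> counting_measures \<Longrightarrow> sets N = sets borel"
  by (auto simp: counting_measures_def locally_finite_borel_def)

lemma emeasure_counting_measure_finite:
  "N \<in> counting_measures \<Longrightarrow> bounded A \<Longrightarrow> A \<in> sets borel \<Longrightarrow> emeasure N A < \<infinity>"
  by (auto simp: counting_measures_def locally_finite_borel_def)

lemma emeasure_counting_measure_nat:
  assumes "N \<in> counting_measures" "bounded A" "A \<in> sets borel"
  obtains m where "emeasure N A = of_nat m"
  using emeasure_counting_measure_finite[OF assms] assms(1,3)
  by (auto simp: counting_measures_def)

text \<open>Masses are integers. On balls shrinking to \<open>p\<close> they decrease to the mass of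
  \<open>C \<inter> {p}\<close>, which is 0, so some ball meets \<open>C\<close> in mass below 1,
  hence 0; compactness of \<open>closure C\<close> leaves finitely many such balls.\<close>

lemma counting_measure_null_if_no_atoms:
  fixes N :: "'a::euclidean_space measure"
  assumes N: "N \<in> counting_measures" and C: "bounded C" "C \<in> sets borel"
    and no: "\<And>p. p \<in> C \<Longrightarrow> emeasure N {p} = 0"
  shows "emeasure N C = 0"
proof -
  have sN: "sets N = sets borel" by (rule sets_counting_measure[OF N])
  have "\<exists>r>0. emeasure N (C \<inter> ball p r) = 0" for p
  proof -
    define D where "D n = C \<inter> ball p (1 / real (Suc n))" for n
    have D: "D n \<in> sets N" "bounded (D n)" for n
      unfolding D_def sN using C by (auto intro: bounded_Int)
    have "(\<lambda>n. emeasure N (D n)) \<longlonglongrightarrow> emeasure N (\<Inter>n. D n)"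
    proof (rule Lim_emeasure_decseq)
      show "range D \<subseteq> sets N" using D by auto
      show "decseq D" unfolding D_def decseq_def
      proof (intro allI impI Int_mono order_refl subset_ball)
        fix m n :: nat assume "m \<le> n"
        then show "1 / real (Suc n) \<le> 1 / real (Suc m)" by (simp add: frac_le)
      qed
      show "emeasure N (D n) \<noteq> \<infinity>" for n
        using emeasure_counting_measure_finite[OF N, of "D n"] D sN by auto
    qed
    moreover have "(\<Inter>n. D n) \<subseteq> C \<inter> {p}"
    proof
      fix x assume x: "x \<in> (\<Inter>n. D n)"
      then have "dist p x < 1 / real (Suc n)" for n by (auto simp: D_def)
      then have "\<not> 0 < dist p x" by (metis not_less_iff_gr_or_eq reals_Archimedean inverse_eq_divide)
      then show "x \<in> C \<inter> {p}" using x by (auto simp: D_def)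
    qed
    moreover have "emeasure N (C \<inter> {p}) = 0"
      using no[of p] by (cases "p \<in> C") auto
    moreover have "C \<inter> {p} \<in> sets N" using C sN by auto
    ultimately have "(\<lambda>n. emeasure N (D n)) \<longlonglongrightarrow> 0"
      by (metis emeasure_mono le_zero_eq)
    then have "eventually (\<lambda>n. emeasure N (D n) < 1) sequentially"
      by (rule order_tendstoD) simp
    then obtain n where n: "emeasure N (D n) < 1" by (auto simp: eventually_sequentially)
    obtain m where m: "emeasure N (D n) = of_nat m"
      using emeasure_counting_measure_nat[OF N, of "D n"] D sN by auto
    have "m = 0" using n m by (metis ennreal_of_nat_eq_real_of_nat ennreal_less_one_iff less_one of_nat_less_1_iff)
    then have "emeasure N (D n) = 0" using m by simp
    then show ?thesis unfolding D_def by (intro exI[of _ "1 / real (Suc n)"]) auto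
  qed
  then obtain r where r: "\<And>p. r p > 0" "\<And>p. emeasure N (C \<inter> ball p (r p)) = 0" by metis
  have "compact (closure C)" using C by simp
  then obtain F where F: "F \<subseteq> closure C" "finite F" "closure C \<subseteq> (\<Union>p\<in>F. ball p (r p))"
    using compactE_image[of "closure C" "closure C" "\<lambda>p. ball p (r p)"] r
    by (metis (no_types, lifting) UN_iff centre_in_ball open_ball subsetI)
  have S: "C \<inter> ball p (r p) \<in> sets N" for p using C by (simp add: sN)
  have "C \<subseteq> (\<Union>p\<in>F. C \<inter> ball p (r p))" using F closure_subset[of C] by auto
  then have "emeasure N C \<le> emeasure N (\<Union>p\<in>F. C \<inter> ball p (r p))"
    by (rule emeasure_mono) (intro sets.finite_UN F S)
  also have "\<dots> \<le> (\<Sum>p\<in>F. emeasure N (C \<inter> ball p (r p)))"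
    by (rule emeasure_subadditive_finite) (use F S in blast)+
  also have "\<dots> = 0" using r by simp
  finally show ?thesis by simp
qed

lemma emeasure_distr_point_indices:
  fixes N :: "'a::euclidean_space measure"
  assumes "A \<in> sets borel"
  shows "emeasure (distr (count_space (point_indices N)) borel fst) A =
    emeasure (count_space (point_indices N)) {i \<in> point_indices N. fst i \<in> A}"
  using assms by (subst emeasure_distr) (auto intro!: arg_cong2[where f=emeasure])

text \<open>A bounded set of mass m contains at most m atoms, each of mass at least 1. Off these
  finitely many atoms both measures vanish, \<open>N\<close> by
  \<open>counting_measure_null_if_no_atoms\<close>, and on finite sets they agree by the choice of
  multiplicities. The push-forward of counting measure is the sum of Dirac measures over the
  indices, so integrals against \<open>N\<close> become sums.\<close>

lemma counting_measure_eq_distr: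
  fixes N :: "'a::euclidean_space measure"
  assumes N: "N \<in> counting_measures"
  shows "N = distr (count_space (point_indices N)) borel fst" (is "N = ?T")
proof (rule measure_eqI)
  have sN: "sets N = sets borel" by (rule sets_counting_measure[OF N])
  show "sets N = sets ?T" using sN by simp
  have single: "emeasure ?T {p} = emeasure N {p}" for p
  proof -
    obtain m where m: "emeasure N {p} = of_nat m"
      using emeasure_counting_measure_nat[OF N, of "{p}"] by auto
    have "{i \<in> point_indices N. fst i \<in> {p}} = Pair p ` {..<m}"
      by (auto simp: point_indices_def m image_iff)
    moreover have "Pair p ` {..<m} \<subseteq> point_indices N"
      by (auto simp: point_indices_def m)
    ultimately show ?thesis
      by (subst emeasure_distr_point_indices)
        (simp_all add: m emeasure_count_space card_image inj_on_def)
  qed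
  have fin: "emeasure ?T P = emeasure N P" if "finite P" for P
    using that
  proof induction
    case (insert p P)
    have "P \<in> sets borel" using insert by (simp add: finite_imp_closed borel_closed)
    then show ?case using insert(2,3) single[of p]
      by (subst (1 2) emeasure_insert) (simp_all add: sN)
  qed simp
  have bdd: "emeasure N A = emeasure ?T A" if A: "A \<in> sets borel" "bounded A" for A
  proof -
    define P where "P = {p\<in>A. emeasure N {p} \<noteq> 0}"
    obtain m where m: "emeasure N A = of_nat m"
      using emeasure_counting_measure_nat[OF N, of A] A by auto
    have ge1: "1 \<le> emeasure N {p}" if "p \<in> P" for p
    proof -
      obtain j where j: "emeasure N {p} = of_nat j"
        using emeasure_counting_measure_nat[OF N, of "{p}"] by auto
      then have "1 \<le> j" using that by (cases j) (auto simp: P_def)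
      then have "of_nat 1 \<le> (of_nat j :: ennreal)" by (rule of_nat_mono)
      then show ?thesis by (simp add: j)
    qed
    have card: "card F \<le> m" if "finite F" "F \<subseteq> P" for F
    proof -
      have "(of_nat (card F) :: ennreal) = (\<Sum>p\<in>F. 1)" by simp
      also have "\<dots> \<le> (\<Sum>p\<in>F. emeasure N {p})"
        by (intro sum_mono ge1) (use that in auto)
      also have "\<dots> = emeasure N F"
        using that by (intro emeasure_eq_sum_singleton[symmetric]) (auto simp: sN)
      also have "\<dots> \<le> emeasure N A"
        by (rule emeasure_mono) (use that A sN in \<open>auto simp: P_def\<close>)
      finally show ?thesis by (simp add: m)
    qed
    have "finite P"
    proof (rule ccontr)
      assume "infinite P"
      then obtain F where "finite F" "card F = Suc m" "F \<subseteq> P"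
        by (meson infinite_arbitrarily_large)
      then show False using card[of F] by simp
    qed
    then have Pb: "P \<in> sets borel" by (simp add: finite_imp_closed borel_closed)
    have PA: "P \<subseteq> A" by (auto simp: P_def)
    have N0: "emeasure N (A - P) = 0"
      by (rule counting_measure_null_if_no_atoms[OF N])
        (use A Pb in \<open>auto simp: P_def intro: bounded_subset\<close>)
    have no: "{i \<in> point_indices N. fst i \<in> A - P} = {}"
      by (auto simp: point_indices_def P_def)
    have T0: "emeasure ?T (A - P) = 0"
      by (subst emeasure_distr_point_indices) (rule sets.Diff[OF A(1) Pb], simp only: no emeasure_empty)
    have "emeasure N A = emeasure N P + emeasure N (A - P)"
      using PA A Pb sN by (subst plus_emeasure) (auto simp: Un_absorb1)
    moreover have "emeasure ?T A = emeasure ?T P + emeasure ?T (A - P)"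
      using PA A Pb by (subst plus_emeasure) (auto simp: Un_absorb1)
    ultimately show ?thesis using N0 T0 fin[OF \<open>finite P\<close>] by simp
  qed
  fix A assume "A \<in> sets N"
  then have A: "A \<in> sets borel" using sN by simp
  have U: "(\<Union>n. A \<inter> ball 0 (real n)) = A"
    by (auto simp: reals_Archimedean2)
  have inc: "incseq (\<lambda>n. A \<inter> ball 0 (real n))" by (auto simp: incseq_def)
  have "emeasure N A = (SUP n. emeasure N (A \<inter> ball 0 (real n)))"
    by (subst SUP_emeasure_incseq[OF _ inc]) (use A in \<open>simp_all only: U sN image_subset_iff, simp\<close>)
  also have "\<dots> = (SUP n. emeasure ?T (A \<inter> ball 0 (real n)))"
    using A by (intro SUP_cong bdd) (auto intro: bounded_Int)
  also have "\<dots> = emeasure ?T A"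
    by (subst SUP_emeasure_incseq[OF _ inc]) (use A in \<open>simp_all only: U sets_distr image_subset_iff, simp\<close>)
  finally show "emeasure N A = emeasure ?T A" .
qed

lemma nn_integral_counting_measure:
  fixes N :: "'a::euclidean_space measure"
  assumes N: "N \<in> counting_measures" and [measurable]: "f \<in> borel_measurable borel"
  shows "(\<integral>\<^sup>+x. f x \<partial>N) = (\<integral>\<^sup>+i. f (fst i) \<partial>count_space (point_indices N))"
  by (subst counting_measure_eq_distr[OF N]) (simp add: nn_integral_distr)

lemma emeasure_counting_measure:
  fixes N :: "'a::euclidean_space measure"
  assumes N: "N \<in> counting_measures" and A: "A \<in> sets borel"
  shows "emeasure N A = emeasure (count_space (point_indices N)) {i \<in> point_indices N. fst i \<in> A}"
  by (subst counting_measure_eq_distr[OF N]) (rule emeasure_distr_point_indices[OF A])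

lemma finite_point_indices:
  fixes N :: "'a::euclidean_space measure"
  assumes N: "N \<in> counting_measures" and A: "A \<in> sets borel" "bounded A"
  shows "finite {i \<in> point_indices N. fst i \<in> A}"
  using emeasure_counting_measure_finite[OF N A(2,1)] emeasure_counting_measure[OF N A(1)]
  by (simp add: emeasure_count_space split: if_splits)

lemma finite_point_indices_bounded:
  fixes N :: "'a::euclidean_space measure"
  assumes N: "N \<in> counting_measures" and A: "bounded A"
  shows "finite {i \<in> point_indices N. fst i \<in> A}"
proof -
  have "closure A \<in> sets borel" "bounded (closure A)" using A by auto
  from finite_point_indices[OF N this] show ?thesis
    by (rule rev_finite_subset) (use closure_subset[of A] in auto)
qed

lemma measure_counting_measure:
  fixes N :: "'a::euclidean_space measure"
  assumes N: "N \<in> counting_measures" and A: "A \<in> sets borel" "bounded A"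
  shows "measure N A = card {i \<in> point_indices N. fst i \<in> A}"
  using emeasure_counting_measure[OF N A(1)] finite_point_indices[OF N A]
  by (simp add: measure_def emeasure_count_space)

section \<open>Factorial powers\<close>

text \<open>Injectivity concerns indices, not positions: a point of multiplicity two forms a pair
  with itself.\<close>

definition index_tuples :: "nat \<Rightarrow> 'a::euclidean_space measure \<Rightarrow> (nat \<Rightarrow> 'a \<times> nat) set" where
  "index_tuples k N = {i \<in> {..<k} \<rightarrow>\<^sub>E point_indices N. inj_on i {..<k}}"

definition positions :: "nat \<Rightarrow> (nat \<Rightarrow> 'a \<times> nat) \<Rightarrow> nat \<Rightarrow> 'a" where
  "positions k t = (\<lambda>l\<in>{..<k}. fst (t l))"

lemma emeasure_factorial_power:
  fixes N :: "'a::euclidean_space measure"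
  assumes "C \<in> sets (\<Pi>\<^sub>M l\<in>{..<k}. borel)"
  shows "emeasure (factorial_power k N) C =
    emeasure (count_space (index_tuples k N)) {t \<in> index_tuples k N. positions k t \<in> C}"
  using assms unfolding factorial_power_def index_tuples_def[symmetric] positions_def[symmetric]
  by (subst emeasure_distr)
    (auto intro!: arg_cong2[where f=emeasure] simp: positions_def space_PiM)

lemma finite_index_tuples:
  fixes N :: "'a::euclidean_space measure"
  assumes N: "N \<in> counting_measures" and B: "\<And>l. l < k \<Longrightarrow> bounded (A l)"
  shows "finite {t \<in> index_tuples k N. \<forall>l<k. fst (t l) \<in> A l}"
proof (rule finite_subset)
  show "finite (\<Pi>\<^sub>E l\<in>{..<k}. {i \<in> point_indices N. fst i \<in> A l})"
    using finite_point_indices_bounded[OF N B] by (intro finite_PiE) auto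
qed (force simp: index_tuples_def PiE_iff extensional_def)

lemma emeasure_factorial_power_card:
  fixes N :: "'a::euclidean_space measure"
  assumes "N \<in> counting_measures" "C \<in> sets (\<Pi>\<^sub>M l\<in>{..<k}. borel)" "bounded A"
    and "\<And>x l. x \<in> C \<Longrightarrow> l < k \<Longrightarrow> x l \<in> A"
  shows "finite {t \<in> index_tuples k N. positions k t \<in> C}"
    and "emeasure (factorial_power k N) C = card {t \<in> index_tuples k N. positions k t \<in> C}"
proof -
  show *: "finite {t \<in> index_tuples k N. positions k t \<in> C}"
  proof (rule finite_subset)
    show "finite {t \<in> index_tuples k N. \<forall>l<k. fst (t l) \<in> A}"
      by (rule finite_index_tuples) (use assms in auto)
    show "{t \<in> index_tuples k N. positions k t \<in> C} \<subseteq> {t \<in> index_tuples k N. \<forall>l<k. fst (t l) \<in> A}"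
      using assms(4) by (force simp: positions_def)
  qed
  then show "emeasure (factorial_power k N) C = card {t \<in> index_tuples k N. positions k t \<in> C}"
    using assms(2) by (subst emeasure_factorial_power) (auto simp: emeasure_count_space ennreal_of_nat_eq_real_of_nat)
qed

lemma card_index_tuples_Suc:
  fixes N :: "'a::euclidean_space measure"
  assumes N: "N \<in> counting_measures" and A: "\<And>l. l \<le> k \<Longrightarrow> bounded (A l)"
  shows "real (card {t \<in> index_tuples (Suc k) N. \<forall>l<Suc k. fst (t l) \<in> A l}) =
     real (card {t \<in> index_tuples k N. \<forall>l<k. fst (t l) \<in> A l}) * card {i \<in> point_indices N. fst i \<in> A k}
     - (\<Sum>m<k. real (card {t \<in> index_tuples k N. \<forall>l<k. fst (t l) \<in> (A(m := A m \<inter> A k)) l}))"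
proof -
  define Q where "Q = {t \<in> index_tuples k N. \<forall>l<k. fst (t l) \<in> A l}"
  define J where "J = {i \<in> point_indices N. fst i \<in> A k}"
  have fQ: "finite Q" unfolding Q_def by (rule finite_index_tuples[OF N]) (use A in auto)
  have fJ: "finite J" unfolding J_def by (rule finite_point_indices_bounded[OF N]) (use A in auto)
  \<comment> \<open>A tuple is its first k entries together with a last index outside their
    image.\<close>
  have "{t \<in> index_tuples (Suc k) N. \<forall>l<Suc k. fst (t l) \<in> A l} =
      (\<lambda>(t, j). t(k := j)) ` (SIGMA t:Q. J - t ` {..<k})" (is "?L = ?R")
  proof
    show "?L \<subseteq> ?R"
    proof
      fix t assume t: "t \<in> ?L"
      then have tE: "t \<in> {..<Suc k} \<rightarrow>\<^sub>E point_indices N" and inj: "inj_on t {..<Suc k}"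
        by (auto simp: index_tuples_def)
      have "restrict t {..<k} \<in> Q"
        using t by (auto simp: Q_def index_tuples_def PiE_iff inj_on_def)
      moreover have "t k \<in> J" using t by (auto simp: J_def index_tuples_def PiE_iff)
      moreover have "t k \<notin> restrict t {..<k} ` {..<k}"
        using inj by (force simp: inj_on_def)
      moreover have "t = (restrict t {..<k})(k := t k)"
        using tE by (auto simp: fun_eq_iff PiE_iff extensional_def restrict_def)
      ultimately show "t \<in> ?R" by (intro image_eqI[of _ _ "(restrict t {..<k}, t k)"]) auto
    qed
    show "?R \<subseteq> ?L"
      by (auto simp: Q_def J_def index_tuples_def PiE_iff inj_on_def extensional_def less_Suc_eq image_iff)
        (metis lessThan_iff)
  qed
  moreover have "inj_on (\<lambda>(t, j). t(k := j)) (SIGMA t:Q. J - t ` {..<k})"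
  proof (rule inj_onI, clarify)
    fix t j t' j' assume "t \<in> Q" "t' \<in> Q" and eq: "t(k := j) = t'(k := j')"
    then have "t \<in> extensional {..<k}" "t' \<in> extensional {..<k}"
      by (auto simp: Q_def index_tuples_def PiE_iff)
    then have "t k = t' k" by (simp add: extensional_def)
    then show "t = t' \<and> j = j'"
      using eq by (metis fun_upd_same fun_upd_triv fun_upd_upd)
  qed
  ultimately have "card ?L = (\<Sum>t\<in>Q. card (J - t ` {..<k}))"
    by (simp add: card_image card_SigmaI fQ fJ)
  then have "real (card ?L) = (\<Sum>t\<in>Q. real (card (J - t ` {..<k})))" by simp
  also have "\<dots> = (\<Sum>t\<in>Q. real (card J) - (\<Sum>m<k. if t m \<in> J then 1 else 0))"
  proof (rule sum.cong[OF refl])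
    fix t assume "t \<in> Q"
    then have inj: "inj_on t {..<k}" by (auto simp: Q_def index_tuples_def)
    have "card (J \<inter> t ` {..<k}) = card (t ` {m\<in>{..<k}. t m \<in> J})"
      by (rule arg_cong[where f=card]) auto
    also have "\<dots> = card {m\<in>{..<k}. t m \<in> J}"
      by (rule card_image) (use inj in \<open>auto simp: inj_on_def\<close>)
    finally have c: "card (J \<inter> t ` {..<k}) = card {m\<in>{..<k}. t m \<in> J}" .
    have "real (card (J - t ` {..<k})) = real (card J) - card (J \<inter> t ` {..<k})"
      using fJ by (subst card_Diff_subset_Int) (auto simp: of_nat_diff card_mono)
    also have "\<dots> = real (card J) - (\<Sum>m<k. if t m \<in> J then 1 else 0)"
      unfolding c by (subst sum.inter_filter[symmetric]) auto
    finally show "real (card (J - t ` {..<k})) = real (card J) - (\<Sum>m<k. if t m \<in> J then 1 else 0)" .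
  qed
  also have "\<dots> = real (card Q) * card J - (\<Sum>m<k. \<Sum>t\<in>Q. if t m \<in> J then 1 else 0)"
    by (simp add: sum_subtractf) (rule sum.swap)
  also have "(\<Sum>m<k. \<Sum>t\<in>Q. if t m \<in> J then 1 else 0 :: real) =
     (\<Sum>m<k. real (card {t \<in> index_tuples k N. \<forall>l<k. fst (t l) \<in> (A(m := A m \<inter> A k)) l}))"
  proof (rule sum.cong[OF refl])
    fix m assume m: "m \<in> {..<k}"
    have "{t\<in>Q. t m \<in> J} = {t \<in> index_tuples k N. \<forall>l<k. fst (t l) \<in> (A(m := A m \<inter> A k)) l}"
      using m by (auto simp: Q_def J_def index_tuples_def PiE_iff)
    then show "(\<Sum>t\<in>Q. if t m \<in> J then 1 else 0 :: real) =
      real (card {t \<in> index_tuples k N. \<forall>l<k. fst (t l) \<in> (A(m := A m \<inter> A k)) l})"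
      using fQ by (subst sum.inter_filter[symmetric]) auto
  qed
  finally show ?thesis by (simp add: Q_def J_def)
qed

text \<open>Induction along \<open>card_index_tuples_Suc\<close>, over all families \<open>A\<close>
  because the recursion alters them; it rests on the measurability of
  \<open>measure (\<omega> w) (A k)\<close>.\<close>

lemma measurable_card_index_tuples:
  fixes \<omega> :: "'w \<Rightarrow> 'a::euclidean_space measure"
  assumes \<omega>: "\<omega> \<in> measurable M counting_measure_space"
    and "\<And>l. l < k \<Longrightarrow> A l \<in> sets borel" "\<And>l. l < k \<Longrightarrow> bounded (A l)"
  shows "(\<lambda>w. real (card {t \<in> index_tuples k (\<omega> w). \<forall>l<k. fst (t l) \<in> A l})) \<in> borel_measurable M"
  using assms(2,3)
proof (induction k arbitrary: A)
  case 0
  then show ?case by (simp add: index_tuples_def)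
next
  case (Suc k)
  have N: "\<omega> w \<in> counting_measures" if "w \<in> space M" for w
    using measurable_space[OF \<omega> that] by (simp add: space_counting_measure_space)
  have "(\<lambda>w. emeasure (\<omega> w) (A k)) \<in> borel_measurable M"
    by (rule measurable_emeasure_counting_measure_space[OF \<omega>]) (use Suc.prems in auto)
  then have "(\<lambda>w. measure (\<omega> w) (A k)) \<in> borel_measurable M" unfolding measure_def by simp
  then have m1: "(\<lambda>w. real (card {i \<in> point_indices (\<omega> w). fst i \<in> A k})) \<in> borel_measurable M"
    by (subst measurable_cong[OF measure_counting_measure[OF N, symmetric]]) (use Suc.prems in auto)
  have m2: "(\<lambda>w. real (card {t \<in> index_tuples k (\<omega> w). \<forall>l<k. fst (t l) \<in> A l})) \<in> borel_measurable M"
    by (rule Suc.IH) (use Suc.prems in auto)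
  have m3: "(\<lambda>w. real (card {t \<in> index_tuples k (\<omega> w). \<forall>l<k. fst (t l) \<in> (A(m := A m \<inter> A k)) l})) \<in> borel_measurable M"
    if "m \<in> {..<k}" for m
    by (rule Suc.IH) (use Suc.prems that in \<open>auto intro: bounded_Int\<close>)
  have "(\<lambda>w. real (card {t \<in> index_tuples k (\<omega> w). \<forall>l<k. fst (t l) \<in> A l})
      * card {i \<in> point_indices (\<omega> w). fst i \<in> A k}
     - (\<Sum>m<k. real (card {t \<in> index_tuples k (\<omega> w). \<forall>l<k. fst (t l) \<in> (A(m := A m \<inter> A k)) l})))
    \<in> borel_measurable M"
    by (intro borel_measurable_diff borel_measurable_times borel_measurable_sum m1 m2 m3)
  then show ?case
    by (subst measurable_cong[OF card_index_tuples_Suc[OF N]]) (use Suc.prems in simp_all)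
qed

text \<open>A Dynkin argument starting from rectangles. The cut-off \<open>D n\<close> makes all
  masses finite, so that the complement step can subtract; a monotone limit removes it at the
  end.\<close>

lemma measurable_emeasure_factorial_power:
  fixes \<omega> :: "'w \<Rightarrow> 'a::euclidean_space measure"
  assumes \<omega>: "\<omega> \<in> measurable M counting_measure_space"
    and C: "C \<in> sets (\<Pi>\<^sub>M l\<in>{..<k}. borel)"
  shows "(\<lambda>w. emeasure (factorial_power k (\<omega> w)) C) \<in> borel_measurable M"
proof -
  let ?P = "\<Pi>\<^sub>M l\<in>{..<k}. (borel :: 'a measure)"
  have N: "\<omega> w \<in> counting_measures" if "w \<in> space M" for w
    using measurable_space[OF \<omega> that] by (simp add: space_counting_measure_space)
  define D where "D n = (\<Pi>\<^sub>E l\<in>{..<k}. ball (0::'a) (real n))" for n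
  have D[measurable]: "D n \<in> sets ?P" for n unfolding D_def by (intro sets_PiM_I_finite) auto
  have sfp: "sets (factorial_power k N) = sets ?P" for N :: "'a measure"
    by (simp add: factorial_power_def)
  have rect: "(\<lambda>w. emeasure (factorial_power k (\<omega> w)) ((\<Pi>\<^sub>E l\<in>{..<k}. A l) \<inter> D n)) \<in> borel_measurable M"
    if A: "\<And>l. l < k \<Longrightarrow> A l \<in> sets borel" for A n
  proof -
    have eq: "emeasure (factorial_power k (\<omega> w)) ((\<Pi>\<^sub>E l\<in>{..<k}. A l) \<inter> D n) =
      ennreal (card {t \<in> index_tuples k (\<omega> w). \<forall>l<k. fst (t l) \<in> A l \<inter> ball 0 (real n)})"
      if w: "w \<in> space M" for w
    proof (subst emeasure_factorial_power_card(2)[OF N[OF w], where A = "ball 0 (real n)"])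
      show "Pi\<^sub>E {..<k} A \<inter> D n \<in> sets ?P"
        using A by (auto intro!: sets.Int D sets_PiM_I_finite)
      have "{t \<in> index_tuples k (\<omega> w). positions k t \<in> Pi\<^sub>E {..<k} A \<inter> D n} =
        {t \<in> index_tuples k (\<omega> w). \<forall>l<k. fst (t l) \<in> A l \<inter> ball 0 (real n)}"
        by (auto simp: positions_def D_def)
      then show "of_nat (card {t \<in> index_tuples k (\<omega> w). positions k t \<in> Pi\<^sub>E {..<k} A \<inter> D n}) =
        ennreal (card {t \<in> index_tuples k (\<omega> w). \<forall>l<k. fst (t l) \<in> A l \<inter> ball 0 (real n)})"
        by (simp add: ennreal_of_nat_eq_real_of_nat)
    qed (auto simp: D_def PiE_iff)
    have "(\<lambda>w. real (card {t \<in> index_tuples k (\<omega> w). \<forall>l<k. fst (t l) \<in> A l \<inter> ball 0 (real n)}))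
        \<in> borel_measurable M"
      by (rule measurable_card_index_tuples[OF \<omega>]) (use A in \<open>simp_all add: bounded_Int\<close>)
    then have "(\<lambda>w. ennreal (card {t \<in> index_tuples k (\<omega> w). \<forall>l<k. fst (t l) \<in> A l \<inter> ball 0 (real n)}))
        \<in> borel_measurable M" by (rule measurable_compose) simp
    then show ?thesis
      by (subst measurable_cong[OF eq])
  qed
  have sp: "space ?P = (\<Pi>\<^sub>E l\<in>{..<k}. UNIV)" by (simp add: space_PiM)
  have gen: "sets ?P = sigma_sets (\<Pi>\<^sub>E l\<in>{..<k}. UNIV) (prod_algebra {..<k} (\<lambda>_. borel :: 'a measure))"
    by (simp add: sets_PiM)
  have Dfin: "emeasure (factorial_power k (\<omega> w)) (E \<inter> D n) < \<infinity>"
    if w: "w \<in> space M" and E: "E \<in> sets ?P" for w n E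
  proof -
    have "emeasure (factorial_power k (\<omega> w)) (E \<inter> D n) =
        of_nat (card {t \<in> index_tuples k (\<omega> w). positions k t \<in> E \<inter> D n})"
      by (rule emeasure_factorial_power_card(2)[OF N[OF w] _ bounded_ball[of 0 "real n"]])
        (rule sets.Int[OF E D], simp add: D_def PiE_iff)
    then show ?thesis by (simp add: of_nat_less_top)
  qed
  have IS: "Int_stable (prod_algebra {..<k} (\<lambda>_. borel :: 'a measure))"
    by (rule Int_stable_prod_algebra)
  have sub: "prod_algebra {..<k} (\<lambda>_. borel :: 'a measure) \<subseteq> Pow (\<Pi>\<^sub>E l\<in>{..<k}. UNIV)"
    using prod_algebra_sets_into_space[of "{..<k}" "\<lambda>_. borel :: 'a measure"] by simp
  have "(\<lambda>w. emeasure (factorial_power k (\<omega> w)) (C \<inter> D n)) \<in> borel_measurable M" for n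
    using IS sub C[unfolded gen]
  proof (induction rule: sigma_sets_induct_disjoint)
    case (basic A)
    then show ?case
    proof (rule prod_algebraE_all)
      fix E :: "nat \<Rightarrow> 'a set" assume "A = Pi\<^sub>E {..<k} E" "E \<in> (\<Pi> i\<in>{..<k}. sets borel)"
      then show "(\<lambda>w. emeasure (factorial_power k (\<omega> w)) (A \<inter> D n)) \<in> borel_measurable M"
        using rect[of E n] by auto
    qed
  next
    case empty
    then show ?case by simp
  next
    case (compl A)
    then have A: "A \<in> sets ?P" by (simp add: gen)
    have UD: "(\<lambda>w. emeasure (factorial_power k (\<omega> w)) (D n)) \<in> borel_measurable M"
      using rect[of "\<lambda>_. UNIV" n] by (simp add: D_def PiE_Int)
    have "emeasure (factorial_power k (\<omega> w)) ((Pi\<^sub>E {..<k} (\<lambda>l. UNIV) - A) \<inter> D n) =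
      emeasure (factorial_power k (\<omega> w)) (D n) - emeasure (factorial_power k (\<omega> w)) (A \<inter> D n)"
      if w: "w \<in> space M" for w
    proof -
      have "(Pi\<^sub>E {..<k} (\<lambda>l. UNIV) - A) \<inter> D n = D n - (A \<inter> D n)"
        by (auto simp: D_def PiE_iff)
      then show ?thesis
        using Dfin[OF w A, of n] A by (simp add: emeasure_Diff sfp)
    qed
    then show ?case
      by (subst measurable_cong, assumption) (rule borel_measurable_minus_ennreal[OF UD compl.IH])
  next
    case (union A)
    then have A: "\<And>i. A i \<in> sets ?P" by (auto simp: gen)
    have "emeasure (factorial_power k (\<omega> w)) (\<Union> (range A) \<inter> D n) =
      (\<Sum>i. emeasure (factorial_power k (\<omega> w)) (A i \<inter> D n))" for w
    proof -
      have "(\<Union>i. A i \<inter> D n) = \<Union> (range A) \<inter> D n" by auto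
      moreover have "disjoint_family (\<lambda>i. A i \<inter> D n)"
        using union(1) by (auto simp: disjoint_family_on_def)
      ultimately show ?thesis
        using A by (subst suminf_emeasure) (auto simp: sfp)
    qed
    then show ?case using union(3) by simp
  qed
  then have [measurable]: "(\<lambda>w. SUP n. emeasure (factorial_power k (\<omega> w)) (C \<inter> D n)) \<in> borel_measurable M"
    by measurable
  have "emeasure (factorial_power k (\<omega> w)) C = (SUP n. emeasure (factorial_power k (\<omega> w)) (C \<inter> D n))" for w
  proof -
    have "(\<Union>n. C \<inter> D n) = C"
    proof
      show "C \<subseteq> (\<Union>n. C \<inter> D n)"
      proof
        fix x assume x: "x \<in> C"
        then have xE: "x \<in> extensional {..<k}" using sets.sets_into_space[OF C] by (auto simp: sp PiE_iff)
        obtain n where "\<forall>l\<in>{..<k}. norm (x l) < real n"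
          using reals_Archimedean2[of "Max (insert 0 ((\<lambda>l. norm (x l)) ` {..<k}))"]
          by (auto simp: Max_less_iff)
        then show "x \<in> (\<Union>n. C \<inter> D n)" using x xE by (auto simp: D_def PiE_iff)
      qed
    qed auto
    moreover have inc: "incseq (\<lambda>n. C \<inter> D n)"
      unfolding D_def incseq_def by (intro allI impI Int_mono order_refl PiE_mono subset_ball) simp
    moreover have "range (\<lambda>n. C \<inter> D n) \<subseteq> sets (factorial_power k (\<omega> w))"
      using C D by (simp only: sfp image_subset_iff) (blast intro: sets.Int)
    ultimately show ?thesis by (subst SUP_emeasure_incseq) simp_all
  qed
  then show ?thesis by simp
qed

section \<open>A law of large numbers\<close>

text \<open>With s = \<open>floor_sqrt n\<close>, monotonicity traps \<open>x n / v n\<close>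
  between the ratios at s^2 and (s + 1)^2, up to the factor (s / (s + 1))^(2d) or its inverse, which
  tend to 1.\<close>

lemma LIMSEQ_from_squares:
  fixes x v :: "nat \<Rightarrow> real"
  assumes nn: "\<And>n. 0 \<le> x n" and mono: "\<And>m n. m \<le> n \<Longrightarrow> x m \<le> x n"
    and v: "\<And>n. v n = \<kappa> * real n ^ d" and \<kappa>: "\<kappa> > 0"
    and lim: "(\<lambda>k. x (k\<^sup>2) / v (k\<^sup>2)) \<longlonglongrightarrow> m"
  shows "(\<lambda>n. x n / v n) \<longlonglongrightarrow> m"
proof -
  define r where "r k = x (k\<^sup>2) / v (k\<^sup>2)" for k
  have r: "r \<longlonglongrightarrow> m" using lim by (simp add: r_def[abs_def])
  have r1: "(\<lambda>k. r (Suc k)) \<longlonglongrightarrow> m" using r by (rule LIMSEQ_Suc)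
  have q: "(\<lambda>k. (real k / real (Suc k)) ^ (2*d)) \<longlonglongrightarrow> 1 ^ (2*d)"
    by (intro tendsto_power LIMSEQ_n_over_Suc_n)
  have q': "(\<lambda>k. (real (Suc k) / real k) ^ (2*d)) \<longlonglongrightarrow> 1 ^ (2*d)"
    by (intro tendsto_power LIMSEQ_Suc_n_over_n)
  have lo: "(\<lambda>k. r k * (real k / real (Suc k)) ^ (2*d)) \<longlonglongrightarrow> m"
    using tendsto_mult[OF r q] by simp
  have hi: "(\<lambda>k. r (Suc k) * (real (Suc k) / real k) ^ (2*d)) \<longlonglongrightarrow> m"
    using tendsto_mult[OF r1 q'] by simp
  have s: "filterlim floor_sqrt at_top sequentially"
    unfolding filterlim_at_top
  proof
    fix Z :: nat
    show "eventually (\<lambda>n. Z \<le> floor_sqrt n) sequentially"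
      using eventually_ge_at_top[of "Z\<^sup>2"]
      by eventually_elim (metis floor_sqrt_inverse_power2 monoD mono_floor_sqrt')
  qed
  have vpos: "0 < v n" if "n > 0" for n using that \<kappa> by (simp add: v)
  have vmono: "v m \<le> v n" if "m \<le> n" for m n
    using that \<kappa> by (simp add: v power_mono)
  have pos: "eventually (\<lambda>n. 1 \<le> n) sequentially" by (rule eventually_ge_at_top)
  show ?thesis
  proof (rule tendsto_sandwich[OF _ _ filterlim_compose[OF lo s] filterlim_compose[OF hi s]])
    show "eventually (\<lambda>n. r (floor_sqrt n) * (real (floor_sqrt n) / real (Suc (floor_sqrt n))) ^ (2*d) \<le> x n / v n) sequentially"
      using pos
    proof eventually_elim
      fix n :: nat assume n: "1 \<le> n"
      let ?s = "floor_sqrt n"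
      have s: "1 \<le> ?s" "?s\<^sup>2 \<le> n" "n \<le> (Suc ?s)\<^sup>2"
        using n Suc_floor_sqrt_power2_gt[of n] by (auto simp: Suc_le_eq floor_sqrt_power2_le)
      have "r ?s * (real ?s / real (Suc ?s)) ^ (2*d) = x (?s\<^sup>2) / v ((Suc ?s)\<^sup>2)"
        using s(1) \<kappa> by (simp add: r_def v power_divide power_mult)
      also have "\<dots> \<le> x n / v n"
        by (rule frac_le) (use s n nn mono[OF s(2)] vpos vmono[OF s(3)] in auto)
      finally show "r ?s * (real ?s / real (Suc ?s)) ^ (2*d) \<le> x n / v n" .
    qed
    show "eventually (\<lambda>n. x n / v n \<le> r (Suc (floor_sqrt n)) * (real (Suc (floor_sqrt n)) / real (floor_sqrt n)) ^ (2*d)) sequentially"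
      using pos
    proof eventually_elim
      fix n :: nat assume n: "1 \<le> n"
      let ?s = "floor_sqrt n"
      have s: "1 \<le> ?s" "?s\<^sup>2 \<le> n" "n \<le> (Suc ?s)\<^sup>2"
        using n Suc_floor_sqrt_power2_gt[of n] by (auto simp: Suc_le_eq floor_sqrt_power2_le)
      have "x n / v n \<le> x ((Suc ?s)\<^sup>2) / v (?s\<^sup>2)"
        by (rule frac_le) (use s n nn mono[OF s(3)] vpos vmono[OF s(2)] in auto)
      also have "\<dots> = r (Suc ?s) * (real (Suc ?s) / real ?s) ^ (2*d)"
        using s(1) \<kappa> by (simp add: r_def v power_divide power_mult)
      finally show "x n / v n \<le> r (Suc ?s) * (real (Suc ?s) / real ?s) ^ (2*d)" .
    qed
  qed
qed

text \<open>The squared relative deviations at n = k^2 have expectations at most c / (\<kappa>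
  k^(2d)), a convergent series as d > 0. Their sum has finite expectation, is therefore finite
  almost surely, and its terms tend to 0; \<open>LIMSEQ_from_squares\<close> fills the gaps.\<close>

lemma (in prob_space) LLN_monotone:
  fixes X :: "nat \<Rightarrow> 'a \<Rightarrow> real"
  assumes meas[measurable]: "\<And>n. X n \<in> borel_measurable M"
    and nn: "\<And>n w. w \<in> space M \<Longrightarrow> 0 \<le> X n w"
    and mono: "\<And>m n w. w \<in> space M \<Longrightarrow> m \<le> n \<Longrightarrow> X m w \<le> X n w"
    and E1: "\<And>n. (\<integral>\<^sup>+w. X n w \<partial>M) = ennreal (\<mu> n)" and \<mu>: "\<And>n. 0 \<le> \<mu> n"
    and E2: "\<And>n. (\<integral>\<^sup>+w. (X n w)\<^sup>2 \<partial>M) \<le> ennreal ((\<mu> n)\<^sup>2 + c * v n)" and c: "0 \<le> c"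
    and v: "\<And>n. v n = \<kappa> * real n ^ d" and \<kappa>: "\<kappa> > 0" and d: "d > 0"
    and lim: "(\<lambda>n. \<mu> n / v n) \<longlonglongrightarrow> m"
  shows "AE w in M. (\<lambda>n. X n w / v n) \<longlonglongrightarrow> m"
proof -
  have AEnn: "AE w in M. 0 \<le> X n w" for n using nn by auto
  have hb: "has_bochner_integral M (X n) (\<mu> n)" for n
    by (rule has_bochner_integral_nn_integral) (use AEnn E1 \<mu> in auto)
  have iX: "integrable M (X n)" and EX: "expectation (X n) = \<mu> n" for n
    using hb by (auto simp: has_bochner_integral_iff)
  have iX2: "integrable M (\<lambda>w. (X n w)\<^sup>2)" for n
    by (rule integrableI_nonneg) (use E2[of n] in \<open>auto intro: le_less_trans\<close>)
  have EX2: "expectation (\<lambda>w. (X n w)\<^sup>2) \<le> (\<mu> n)\<^sup>2 + c * v n" for n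
  proof -
    have "ennreal (expectation (\<lambda>w. (X n w)\<^sup>2)) \<le> ennreal ((\<mu> n)\<^sup>2 + c * v n)"
      using E2[of n] by (subst nn_integral_eq_integral[symmetric]) (auto intro: iX2)
    moreover have "0 \<le> (\<mu> n)\<^sup>2 + c * v n" using c \<kappa> by (auto simp: v)
    ultimately show ?thesis by (simp add: ennreal_le_iff)
  qed
  define Z where "Z k w = ((X (k\<^sup>2) w - \<mu> (k\<^sup>2)) / v (k\<^sup>2))\<^sup>2" for k w
  have [measurable]: "Z k \<in> borel_measurable M" for k unfolding Z_def[abs_def] by measurable
  \<comment> \<open>The shift to \<open>Suc k\<close> avoids dividing by
    \<open>v 0 = 0\<close>.\<close>
  have EZ: "(\<integral>\<^sup>+w. Z (Suc k) w \<partial>M) \<le> ennreal (c / \<kappa> * (1 / (real (Suc k))\<^sup>2))" for k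
  proof -
    define n where "n = (Suc k)\<^sup>2"
    have vn: "v n > 0" using \<kappa> by (simp add: v n_def)
    have Zn: "Z (Suc k) = (\<lambda>w. (X n w - \<mu> n)\<^sup>2 / (v n)\<^sup>2)"
      by (simp add: Z_def[abs_def] n_def power_divide)
    have iV: "integrable M (\<lambda>w. (X n w - \<mu> n)\<^sup>2)"
      by (simp add: power2_diff iX iX2)
    have "(\<integral>\<^sup>+w. Z (Suc k) w \<partial>M) = expectation (Z (Suc k))"
      unfolding Zn by (rule nn_integral_eq_integral) (simp_all add: iV)
    also have "expectation (Z (Suc k)) = (expectation (\<lambda>w. (X n w)\<^sup>2) - (\<mu> n)\<^sup>2) / (v n)\<^sup>2"
      unfolding Zn using variance_eq[OF iX iX2, of n] by (simp add: EX)
    also have "\<dots> \<le> (c * v n) / (v n)\<^sup>2"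
      using EX2[of n] by (intro divide_right_mono) auto
    also have "\<dots> = c / \<kappa> * (1 / (real (Suc k)) ^ (2 * d))"
      using vn \<kappa> unfolding power2_eq_square[of "v n"] by (simp add: v n_def power_mult)
    also have "\<dots> \<le> c / \<kappa> * (1 / (real (Suc k))\<^sup>2)"
      using c \<kappa> d by (intro mult_left_mono divide_left_mono power_increasing) auto
    finally show ?thesis by (simp add: ennreal_leI)
  qed
  have "(\<integral>\<^sup>+w. (\<Sum>k. ennreal (Z (Suc k) w)) \<partial>M) = (\<Sum>k. \<integral>\<^sup>+w. Z (Suc k) w \<partial>M)"
    by (rule nn_integral_suminf) simp
  also have "\<dots> \<le> (\<Sum>k. ennreal (c / \<kappa> * (1 / (real (Suc k))\<^sup>2)))"
    by (rule suminf_le) (use EZ in auto)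
  also have "\<dots> < \<infinity>"
  proof -
    have "summable (\<lambda>k. 1 / (real (Suc k))\<^sup>2)"
      using inverse_power_summable[of 2, where 'a=real]
      by (subst summable_Suc_iff) (simp add: inverse_eq_divide)
    then have "summable (\<lambda>k. c / \<kappa> * (1 / (real (Suc k))\<^sup>2))" by (rule summable_mult)
    then show ?thesis using c \<kappa> by (subst suminf_ennreal2) auto
  qed
  finally have "AE w in M. (\<Sum>k. ennreal (Z (Suc k) w)) \<noteq> \<infinity>"
    by (intro nn_integral_PInf_AE) auto
  then show ?thesis
  proof (rule AE_mp[OF _ AE_I2], intro impI)
    fix w assume w: "w \<in> space M" and "(\<Sum>k. ennreal (Z (Suc k) w)) \<noteq> \<infinity>"
    then have "summable (\<lambda>k. Z (Suc k) w)"
      by (intro summable_suminf_not_top) (auto simp: Z_def)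
    then have "(\<lambda>k. Z (Suc k) w) \<longlonglongrightarrow> 0" by (rule summable_LIMSEQ_zero)
    then have "(\<lambda>k. Z k w) \<longlonglongrightarrow> 0" by (rule LIMSEQ_imp_Suc)
    then have "(\<lambda>k. sqrt (Z k w)) \<longlonglongrightarrow> sqrt 0" by (rule tendsto_real_sqrt)
    then have "(\<lambda>k. (X (k\<^sup>2) w - \<mu> (k\<^sup>2)) / v (k\<^sup>2)) \<longlonglongrightarrow> 0"
      unfolding Z_def real_sqrt_abs using tendsto_rabs_zero_iff by fastforce
    moreover have "(\<lambda>k. \<mu> (k\<^sup>2) / v (k\<^sup>2)) \<longlonglongrightarrow> m"
      by (rule filterlim_compose[OF lim]) (simp add: filterlim_at_top_mono[OF filterlim_ident] power2_nat_le_imp_le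
          eventually_sequentially power2_eq_square)
    ultimately have "(\<lambda>k. (X (k\<^sup>2) w - \<mu> (k\<^sup>2)) / v (k\<^sup>2) + \<mu> (k\<^sup>2) / v (k\<^sup>2)) \<longlonglongrightarrow> 0 + m"
      by (rule tendsto_add)
    then have "(\<lambda>k. X (k\<^sup>2) w / v (k\<^sup>2)) \<longlonglongrightarrow> m" by (simp add: diff_divide_distrib)
    from LIMSEQ_from_squares[OF nn mono v \<kappa> this, OF w w]
    show "(\<lambda>n. X n w / v n) \<longlonglongrightarrow> m" .
  qed
qed

section \<open>Vague convergence tested on grid cells\<close>

text \<open>Cells are encoded as the fibres of \<open>grid m\<close>: half-open cubes of side 1/(m +
  1) that partition the space, each represented by its lower corner.\<close>

definition grid :: "nat \<Rightarrow> 'a::euclidean_space \<Rightarrow> 'a" where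
  "grid m x = (\<Sum>b\<in>Basis. (of_int \<lfloor>real (Suc m) * (x \<bullet> b)\<rfloor> / real (Suc m)) *\<^sub>R b)"

lemma inner_grid:
  "b \<in> Basis \<Longrightarrow> grid m x \<bullet> b = of_int \<lfloor>real (Suc m) * (x \<bullet> b)\<rfloor> / real (Suc m)"
  by (simp add: grid_def)

lemma norm_diff_grid: "norm (x - grid m x) \<le> DIM('a) / real (Suc m)" for x :: "'a::euclidean_space"
proof -
  have "norm (x - grid m x) \<le> (\<Sum>b\<in>Basis. \<bar>(x - grid m x) \<bullet> b\<bar>)" by (rule norm_le_l1)
  also have "\<dots> \<le> (\<Sum>b\<in>(Basis :: 'a set). 1 / real (Suc m))"
  proof (rule sum_mono)
    fix b :: 'a assume b: "b \<in> Basis"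
    let ?y = "real (Suc m) * (x \<bullet> b)"
    have "(x - grid m x) \<bullet> b = (?y - of_int \<lfloor>?y\<rfloor>) / real (Suc m)"
      using b by (simp add: inner_diff_left inner_grid diff_divide_distrib del: of_nat_Suc)
    moreover have "\<bar>?y - of_int \<lfloor>?y\<rfloor>\<bar> \<le> 1" by linarith
    ultimately show "\<bar>(x - grid m x) \<bullet> b\<bar> \<le> 1 / real (Suc m)"
      by (simp add: divide_right_mono del: of_nat_Suc)
  qed
  finally show ?thesis by simp
qed

lemma norm_diff_grid_le_DIM: "norm (x - grid m x) \<le> DIM('a)" for x :: "'a::euclidean_space"
  by (rule order_trans[OF norm_diff_grid]) (simp add: divide_le_eq)

lemma borel_measurable_grid[measurable]:
  "grid m \<in> borel_measurable (borel :: 'a::euclidean_space measure)"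
  unfolding grid_def[abs_def] by measurable

text \<open>The corners have integer coordinates after scaling, and these are bounded on a bounded
  set.\<close>

lemma finite_grid_image:
  fixes S :: "'a::euclidean_space set"
  assumes "bounded S" shows "finite (grid m ` S)"
proof -
  obtain R where R: "\<And>x. x \<in> S \<Longrightarrow> norm x \<le> R" using assms by (auto simp: bounded_iff)
  define c where "c = \<lceil>real (Suc m) * \<bar>R\<bar>\<rceil> + 1"
  let ?h = "\<lambda>z. \<Sum>b\<in>(Basis :: 'a set). (of_int (z b) / real (Suc m)) *\<^sub>R b"
  have "grid m ` S \<subseteq> ?h ` (\<Pi>\<^sub>E b\<in>Basis. {- c..c})"
  proof
    fix y assume "y \<in> grid m ` S"
    then obtain x where x: "x \<in> S" "y = grid m x" by auto
    have "\<lfloor>real (Suc m) * (x \<bullet> b)\<rfloor> \<in> {- c..c}" if b: "b \<in> Basis" for b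
    proof -
      have "\<bar>x \<bullet> b\<bar> \<le> \<bar>R\<bar>" using Basis_le_norm[OF b, of x] R[OF x(1)] by linarith
      then have "\<bar>real (Suc m) * (x \<bullet> b)\<bar> \<le> real (Suc m) * \<bar>R\<bar>"
        by (simp add: abs_mult mult_left_mono del: of_nat_Suc)
      then show ?thesis unfolding c_def by (simp del: of_nat_Suc) linarith
    qed
    then show "y \<in> ?h ` (\<Pi>\<^sub>E b\<in>Basis. {- c..c})"
      by (intro image_eqI[where x="\<lambda>b\<in>Basis. \<lfloor>real (Suc m) * (x \<bullet> b)\<rfloor>"])
        (auto simp: x grid_def)
  qed
  then show ?thesis by (rule finite_subset) (intro finite_imageI finite_PiE, auto)
qed

lemma bounded_grid_vimage:
  fixes S :: "'a::euclidean_space set"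
  assumes "bounded S" shows "bounded (grid m -` S)"
proof -
  obtain R where R: "\<And>x. x \<in> S \<Longrightarrow> norm x \<le> R" using assms by (auto simp: bounded_iff)
  have "norm x \<le> R + DIM('a)" if "x \<in> grid m -` S" for x
    using norm_diff_grid_le_DIM[of x m] R[of "grid m x"] that norm_triangle_sub[of x "grid m x"] by auto
  then show ?thesis unfolding bounded_iff by blast
qed

lemma borel_grid_cell: "grid m -` {z} \<in> sets (borel :: 'a::euclidean_space measure)"
  using measurable_sets[OF borel_measurable_grid[of m], of "{z}"] by simp

text \<open>Integrability of \<open>f\<close> is part of the proof: \<open>f\<close> is the step
  function plus an error dominated by a multiple of \<open>indicator W\<close>. The measure is
  arbitrary because the same step function serves for every \<open>\<mu> n\<close> and for
  \<open>\<nu>\<close>.\<close>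

lemma integral_near_step_function:
  fixes f :: "'a::euclidean_space \<Rightarrow> real" and c :: "'b \<Rightarrow> real"
  assumes \<rho>: "locally_finite_borel \<rho>" and f: "f \<in> borel_measurable borel"
    and W: "W \<in> sets borel" "bounded W" and Z: "finite Z"
    and A: "\<And>z. z \<in> Z \<Longrightarrow> A z \<in> sets borel" "\<And>z. z \<in> Z \<Longrightarrow> bounded (A z)"
    and near: "\<And>x. \<bar>f x - (\<Sum>z\<in>Z. c z * indicator (A z) x)\<bar> \<le> \<epsilon> * indicator W x"
  shows "\<bar>(LINT x|\<rho>. f x) - (\<Sum>z\<in>Z. c z * measure \<rho> (A z))\<bar> \<le> \<epsilon> * measure \<rho> W"
proof -
  let ?g = "\<lambda>x. \<Sum>z\<in>Z. c z * indicator (A z) x"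
  have s: "sets \<rho> = sets borel" using \<rho> by (simp add: locally_finite_borel_def)
  have f': "f \<in> borel_measurable \<rho>" using f measurable_cong_sets[OF s refl] by blast
  have ind: "integrable \<rho> (indicator B :: 'a \<Rightarrow> real)" if "B \<in> sets borel" "bounded B" for B
    using \<rho> that by (intro integrable_real_indicator) (auto simp: s locally_finite_borel_def)
  have g: "integrable \<rho> ?g"
    by (intro Bochner_Integration.integrable_sum integrable_mult_right ind A)
  have w: "integrable \<rho> (\<lambda>x. \<epsilon> * indicator W x)" by (intro integrable_mult_right ind W)
  have d: "integrable \<rho> (\<lambda>x. f x - ?g x)"
  proof (rule Bochner_Integration.integrable_bound[OF w])
    show "(\<lambda>x. f x - ?g x) \<in> borel_measurable \<rho>"
      by (intro borel_measurable_diff f' borel_measurable_integrable g)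
  qed (use near in \<open>auto intro: order_trans[OF _ abs_ge_self]\<close>)
  have fi: "integrable \<rho> f" using Bochner_Integration.integrable_add[OF d g] by simp
  have G: "(LINT x|\<rho>. ?g x) = (\<Sum>z\<in>Z. c z * measure \<rho> (A z))"
  proof (subst Bochner_Integration.integral_sum)
    have "A z \<inter> space \<rho> = A z" for z using sets_eq_imp_space_eq[OF s] by simp
    then show "(\<Sum>z\<in>Z. LINT x|\<rho>. c z * indicator (A z) x) = (\<Sum>z\<in>Z. c z * measure \<rho> (A z))"
      by simp
  qed (intro integrable_mult_right ind A)
  have "\<bar>(LINT x|\<rho>. f x) - (LINT x|\<rho>. ?g x)\<bar> = \<bar>LINT x|\<rho>. f x - ?g x\<bar>"
    by (simp add: fi g)
  also have "\<dots> \<le> (LINT x|\<rho>. \<bar>f x - ?g x\<bar>)" by (rule integral_abs_bound)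
  also have "\<dots> \<le> (LINT x|\<rho>. \<epsilon> * indicator W x)"
    by (rule integral_mono) (use d w near in auto)
  also have "\<dots> = \<epsilon> * measure \<rho> W"
    using sets_eq_imp_space_eq[OF s] by simp
  finally show ?thesis by (simp only: G)
qed

text \<open>A test function is uniformly close to its value at the corner of each small cell, so its
  integral is a finite sum of cell masses up to \<epsilon> times the mass of a fixed window
  \<open>W\<close>. The window is a union of cells of mesh 1, so its masses converge too and stay
  bounded.\<close>

lemma vague_limit_gridI:
  fixes \<mu> :: "nat \<Rightarrow> 'a::euclidean_space measure"
  assumes \<mu>: "eventually (\<lambda>n. locally_finite_borel (\<mu> n)) sequentially" and \<nu>: "locally_finite_borel \<nu>"
    and conv: "\<And>m z. z \<in> range (grid m) \<Longrightarrow>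
      (\<lambda>n. measure (\<mu> n) (grid m -` {z})) \<longlonglongrightarrow> measure \<nu> (grid m -` {z})"
  shows "vague_limit \<mu> \<nu>"
  unfolding vague_limit_def
proof (intro conjI \<nu> allI impI)
  fix f :: "'a \<Rightarrow> real"
  assume cf: "continuous_on UNIV f" and supp: "compact (closure {x. f x \<noteq> 0})"
  have fm: "f \<in> borel_measurable borel" using cf by (rule borel_measurable_continuous_onI)
  have "bounded {x. f x \<noteq> 0}"
    using supp compact_imp_bounded bounded_subset closure_subset by metis
  then obtain R where R: "\<And>x. f x \<noteq> 0 \<Longrightarrow> norm x \<le> R" by (auto simp: bounded_iff)
  let ?D = "real DIM('a)"
  \<comment> \<open>A point and its corner differ by at most \<open>DIM('a)\<close> for every m, so
    outside the enlarged ball both \<open>f x\<close> and \<open>f (grid m x)\<close>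
    vanish.\<close>
  define Z where "Z m = grid m ` cball (0::'a) (R + ?D)" for m
  have fZ: "finite (Z m)" for m unfolding Z_def by (rule finite_grid_image) simp
  define W where "W = grid 0 -` Z 0"
  have W: "W = (\<Union>z\<in>Z 0. grid 0 -` {z})" by (auto simp: W_def)
  have bW: "bounded W" unfolding W_def by (rule bounded_grid_vimage) (simp add: fZ finite_imp_bounded)
  have sW: "W \<in> sets borel" unfolding W by (intro sets.finite_UN fZ borel_grid_cell)
  have cW: "cball 0 (R + ?D) \<subseteq> W" by (auto simp: W_def Z_def)
  have bcell: "bounded (grid m -` {z :: 'a})" for m z by (rule bounded_grid_vimage) simp
  have lim: "(\<lambda>n. \<Sum>z\<in>Z m. c z * measure (\<mu> n) (grid m -` {z})) \<longlonglongrightarrow>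
      (\<Sum>z\<in>Z m. c z * measure \<nu> (grid m -` {z}))" for m c
    by (intro tendsto_sum tendsto_mult tendsto_const conv) (auto simp: Z_def)
  have mW: "measure \<rho> W = (\<Sum>z\<in>Z 0. 1 * measure \<rho> (grid 0 -` {z}))" if \<rho>: "locally_finite_borel \<rho>" for \<rho>
  proof -
    have "emeasure \<rho> (grid 0 -` {z}) \<noteq> \<infinity>" for z
      using \<rho> bcell[of 0 z] borel_grid_cell[of 0 z] by (auto simp: locally_finite_borel_def)
    moreover have "sets \<rho> = sets borel" using \<rho> by (simp add: locally_finite_borel_def)
    ultimately show ?thesis unfolding W using fZ[of 0] borel_grid_cell[of 0]
      by (subst measure_finite_Union) (auto simp: disjoint_family_on_def)
  qed
  show "(\<lambda>n. LINT x|\<mu> n. f x) \<longlonglongrightarrow> (LINT x|\<nu>. f x)"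
  proof (rule tendstoI)
    fix e :: real assume e: "e > 0"
    define B where "B = measure \<nu> W + 1"
    have B: "B \<ge> 1" by (simp add: B_def)
    \<comment> \<open>Of the total error e, the two step approximations take e / 4 each and the cell
      masses e / 2; \<open>B\<close> bounds the mass of \<open>W\<close> under \<open>\<nu>\<close>
      and eventually under \<open>\<mu> n\<close>.\<close>
    define \<epsilon> where "\<epsilon> = e / (4 * B)"
    have \<epsilon>: "\<epsilon> > 0" using e B by (simp add: \<epsilon>_def)
    \<comment> \<open>The corner of a point in the ball of radius \<open>R + ?D\<close> may lie
      outside it, by at most another \<open>?D\<close>.\<close>
    have "uniformly_continuous_on (cball 0 (R + 2 * ?D)) f"
      by (rule compact_uniformly_continuous) (auto intro: continuous_on_subset[OF cf])
    then obtain \<delta> where \<delta>: "\<delta> > 0"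
      "\<And>x y. x \<in> cball 0 (R + 2 * ?D) \<Longrightarrow> y \<in> cball 0 (R + 2 * ?D) \<Longrightarrow> dist y x < \<delta> \<Longrightarrow> dist (f y) (f x) < \<epsilon>"
      unfolding uniformly_continuous_on_def using \<epsilon> by metis
    obtain m where "?D / \<delta> < real m" using reals_Archimedean2 by blast
    then have "?D < real (Suc m) * \<delta>" using \<delta>(1) by (simp add: divide_less_eq algebra_simps)
    then have m: "?D / real (Suc m) < \<delta>" by (simp add: divide_less_eq mult.commute del: of_nat_Suc)
    have step: "(\<Sum>z\<in>Z m. f z * indicator (grid m -` {z}) x) = f (grid m x)" for x
    proof (cases "grid m x \<in> Z m")
      case True
      have "(\<Sum>z\<in>Z m. f z * indicator (grid m -` {z}) x) = (\<Sum>z\<in>Z m. if z = grid m x then f z else 0)"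
        by (intro sum.cong refl) (auto simp: indicator_def)
      then show ?thesis using True fZ by (simp add: sum.delta)
    next
      case False
      then have "x \<notin> cball 0 (R + ?D)" by (auto simp: Z_def)
      then have "norm (grid m x) > R"
        using norm_diff_grid_le_DIM[of x m] norm_triangle_sub[of x "grid m x"] by auto
      then have "f (grid m x) = 0" using R by force
      moreover have "(\<Sum>z\<in>Z m. f z * indicator (grid m -` {z}) x) = 0"
        by (rule sum.neutral) (use False in \<open>auto simp: indicator_def\<close>)
      ultimately show ?thesis by simp
    qed
    have near: "\<bar>f x - (\<Sum>z\<in>Z m. f z * indicator (grid m -` {z}) x)\<bar> \<le> \<epsilon> * indicator W x" for x
    proof (cases "x \<in> cball 0 (R + ?D)")
      case True
      have "norm (x - grid m x) < \<delta>" using norm_diff_grid[of x m] m by linarith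
      moreover have "grid m x \<in> cball 0 (R + 2 * ?D)"
        using True norm_diff_grid_le_DIM[of x m] norm_triangle_sub[of "grid m x" x]
        by (auto simp: norm_minus_commute)
      moreover have "x \<in> cball 0 (R + 2 * ?D)" using True by auto
      ultimately have "dist (f x) (f (grid m x)) < \<epsilon>" using \<delta>(2) by (auto simp: dist_norm)
      then show ?thesis unfolding step using True cW by (auto simp: indicator_def dist_real_def)
    next
      case False
      then have "norm (grid m x) > R" "norm x > R"
        using norm_diff_grid_le_DIM[of x m] norm_triangle_sub[of x "grid m x"] by auto
      then have "f (grid m x) = 0" "f x = 0" using R by force+
      then show ?thesis unfolding step using \<epsilon> by (simp add: indicator_def)
    qed
    note approx = integral_near_step_function[OF _ fm sW bW fZ borel_grid_cell bcell near]
    let ?S = "\<lambda>\<rho>. \<Sum>z\<in>Z m. f z * measure \<rho> (grid m -` {z})"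
    have "eventually (\<lambda>n. dist (?S (\<mu> n)) (?S \<nu>) < e / 2) sequentially"
      by (rule tendstoD[OF lim]) (use e in simp)
    moreover have "eventually (\<lambda>n. (\<Sum>z\<in>Z 0. 1 * measure (\<mu> n) (grid 0 -` {z})) < B) sequentially"
      by (rule order_tendstoD(2)[OF lim[of _ 0]]) (simp add: B_def mW[OF \<nu>])
    ultimately show "eventually (\<lambda>n. dist (LINT x|\<mu> n. f x) (LINT x|\<nu>. f x) < e) sequentially"
      using \<mu>
    proof eventually_elim
      fix n assume 1: "dist (?S (\<mu> n)) (?S \<nu>) < e / 2" and n: "locally_finite_borel (\<mu> n)"
        and "(\<Sum>z\<in>Z 0. 1 * measure (\<mu> n) (grid 0 -` {z})) < B"
      then have "measure (\<mu> n) W \<le> B" by (simp add: mW)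
      then have "\<epsilon> * measure (\<mu> n) W \<le> \<epsilon> * B" using \<epsilon> by simp
      also have "\<epsilon> * B = e / 4" using B by (simp add: \<epsilon>_def)
      finally have 2: "\<bar>(LINT x|\<mu> n. f x) - ?S (\<mu> n)\<bar> \<le> e / 4"
        using approx[OF n] by linarith
      have "\<epsilon> * measure \<nu> W < \<epsilon> * B" using \<epsilon> by (simp add: B_def)
      also have "\<epsilon> * B = e / 4" using B by (simp add: \<epsilon>_def)
      finally have 3: "\<bar>(LINT x|\<nu>. f x) - ?S \<nu>\<bar> < e / 4"
        using approx[OF \<nu>] by linarith
      show "dist (LINT x|\<mu> n. f x) (LINT x|\<nu>. f x) < e"
        using 1 2 3 unfolding dist_real_def by linarith
    qed
  qed
qed

no_notation Matrix.scalar_prod (infix "\<bullet>" 70)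

section \<open>Fourier transforms\<close>

lemma nn_integral_lborel_affine:
  fixes f :: "'a::euclidean_space \<Rightarrow> ennreal"
  assumes [measurable]: "f \<in> borel_measurable borel" and c: "c \<noteq> 0"
  shows "(\<integral>\<^sup>+x. f x \<partial>lborel) = ennreal (\<bar>c\<bar> ^ DIM('a)) * (\<integral>\<^sup>+x. f (t + c *\<^sub>R x) \<partial>lborel)"
  by (subst lborel_affine[OF c, of t])
    (simp add: nn_integral_density nn_integral_distr nn_integral_cmult)

lemma nn_integral_lborel_translate:
  fixes f :: "'a::euclidean_space \<Rightarrow> ennreal"
  assumes "f \<in> borel_measurable borel"
  shows "(\<integral>\<^sup>+x. f (t + x) \<partial>lborel) = (\<integral>\<^sup>+x. f x \<partial>lborel)"
  using nn_integral_lborel_affine[OF assms, of 1 t] by simp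

lemma nn_integral_lborel_reflect:
  fixes f :: "'a::euclidean_space \<Rightarrow> ennreal"
  assumes "f \<in> borel_measurable borel"
  shows "(\<integral>\<^sup>+x. f (t - x) \<partial>lborel) = (\<integral>\<^sup>+x. f x \<partial>lborel)"
  using nn_integral_lborel_affine[OF assms, of "-1" t] by simp

lemma integrable_lborel_affine:
  fixes f :: "'a::euclidean_space \<Rightarrow> 'b::{banach, second_countable_topology}"
  assumes f: "integrable lborel f" and c: "c \<noteq> 0"
  shows "integrable lborel (\<lambda>x. f (t + c *\<^sub>R x))"
proof -
  have [measurable]: "f \<in> borel_measurable borel" using f by auto
  have "(\<integral>\<^sup>+x. ennreal (norm (f x)) \<partial>lborel) < \<infinity>" using f by (simp add: integrable_iff_bounded)
  then have "(\<integral>\<^sup>+x. ennreal (norm (f (t + c *\<^sub>R x))) \<partial>lborel) < \<infinity>"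
    using c by (subst (asm) nn_integral_lborel_affine[where c=c and t=t])
      (auto simp: ennreal_mult_less_top)
  then show ?thesis by (intro integrableI_bounded) auto
qed

lemma integral_lborel_affine:
  fixes f :: "'a::euclidean_space \<Rightarrow> 'b::{banach, second_countable_topology}"
  assumes [measurable]: "f \<in> borel_measurable borel" and c: "c \<noteq> 0"
  shows "(LINT x|lborel. f x) = (\<bar>c\<bar> ^ DIM('a)) *\<^sub>R (LINT x|lborel. f (t + c *\<^sub>R x))"
  by (subst lborel_affine[OF c, of t])
    (simp add: integral_density integral_distr)

lemma integral_lborel_translate:
  fixes f :: "'a::euclidean_space \<Rightarrow> 'b::{banach, second_countable_topology}"
  assumes "f \<in> borel_measurable borel"
  shows "(LINT x|lborel. f (t + x)) = (LINT x|lborel. f x)"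
  using integral_lborel_affine[OF assms, of 1 t] by simp

lemma integral_lborel_reflect:
  fixes f :: "'a::euclidean_space \<Rightarrow> 'b::{banach, second_countable_topology}"
  assumes "f \<in> borel_measurable borel"
  shows "(LINT x|lborel. f (t - x)) = (LINT x|lborel. f x)"
  using integral_lborel_affine[OF assms, of "-1" t] by simp

lemma integral_lborel_prod:
  fixes f :: "'a::euclidean_space \<Rightarrow> real \<Rightarrow> 'b::{real_normed_field, banach, second_countable_topology}"
  assumes f: "\<And>b. b \<in> Basis \<Longrightarrow> integrable lborel (f b)"
  shows "(LINT x|lborel. (\<Prod>b\<in>Basis. f b (x \<bullet> b))) = (\<Prod>b\<in>Basis. LINT y|lborel. f b y)"
proof -
  interpret product_sigma_finite "\<lambda>b::'a. lborel :: real measure" by standard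
  have [measurable]: "f b \<in> borel_measurable borel" if "b \<in> Basis" for b using f[OF that] by auto
  have "(LINT x|lborel. (\<Prod>b\<in>Basis. f b (x \<bullet> b))) =
      (LINT x|(\<Pi>\<^sub>M b\<in>Basis. lborel). (\<Prod>b\<in>Basis. f b (x b)))"
    by (subst lborel_eq) (simp add: integral_distr)
  also have "\<dots> = (\<Prod>b\<in>Basis. LINT y|lborel. f b y)"
    by (rule product_integral_prod) (use f in auto)
  finally show ?thesis .
qed

section \<open>The Fourier transform and Fubini's theorem\<close>

lemma fourier_cis: "fourier f y = (LINT x|lborel. f x * cis (- 2 * pi * (x \<bullet> y)))"
  unfolding fourier_def cis_conv_exp by (simp add: algebra_simps)

lemma borel_measurable_fourier[measurable]:
  assumes [measurable]: "f \<in> borel_measurable borel"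
  shows "fourier f \<in> borel_measurable borel"
proof -
  have "(\<lambda>y. LINT x|lborel. f x * cis (- 2 * pi * (x \<bullet> y))) \<in> borel_measurable borel"
    unfolding cis_conv_exp by measurable
  then show ?thesis by (simp add: fourier_cis[abs_def])
qed

lemma norm_fourier_le:
  shows "norm (fourier f y) \<le> (LINT x|lborel. norm (f x))"
  unfolding fourier_cis by (rule order_trans[OF integral_norm_bound]) (simp add: norm_mult)

lemma integrable_cis_mult:
  fixes f :: "'a::euclidean_space \<Rightarrow> complex"
  assumes "integrable lborel f" "k \<in> borel_measurable borel"
  shows "integrable lborel (\<lambda>x. f x * cis (k x))"
proof (rule Bochner_Integration.integrable_bound[OF assms(1)])
  have [measurable]: "f \<in> borel_measurable borel" "k \<in> borel_measurable borel" using assms by auto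
  show "(\<lambda>x. f x * cis (k x)) \<in> borel_measurable lborel" unfolding cis_conv_exp by measurable
qed (simp add: norm_mult)

lemma integrable_lborel_pair_mult:
  fixes f :: "'a::euclidean_space \<Rightarrow> complex" and h :: "'b::euclidean_space \<Rightarrow> complex"
  assumes f: "integrable lborel f" and h: "integrable lborel h"
    and k: "k \<in> borel_measurable (borel \<Otimes>\<^sub>M borel)"
  shows "integrable (lborel \<Otimes>\<^sub>M lborel) (\<lambda>(x, y). f x * h y * cis (k (x, y)))"
proof (rule lborel_pair.Fubini_integrable)
  have [measurable]: "f \<in> borel_measurable borel" "h \<in> borel_measurable borel" using f h by auto
  have [measurable]: "k \<in> borel_measurable (borel \<Otimes>\<^sub>M borel)" by (rule k)
  show "(\<lambda>(x, y). f x * h y * cis (k (x, y))) \<in> borel_measurable (lborel \<Otimes>\<^sub>M lborel)"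
    unfolding cis_conv_exp by measurable
  show "integrable lborel (\<lambda>x. LINT y|lborel. norm (case (x, y) of (x, y) \<Rightarrow> f x * h y * cis (k (x, y))))"
    using f by (simp add: norm_mult)
  have "integrable lborel (\<lambda>y. f x * (h y * cis (k (x, y))))" for x
    by (intro integrable_mult_right integrable_cis_mult h) measurable
  then show "AE x in lborel. integrable lborel (\<lambda>y. case (x, y) of (x, y) \<Rightarrow> f x * h y * cis (k (x, y)))"
    by (simp add: mult.assoc)
qed

lemma Fubini_cis:
  fixes f :: "'a::euclidean_space \<Rightarrow> complex" and h :: "'b::euclidean_space \<Rightarrow> complex"
  assumes "integrable lborel f" "integrable lborel h" "k \<in> borel_measurable (borel \<Otimes>\<^sub>M borel)"
  shows "(LINT y|lborel. LINT x|lborel. f x * h y * cis (k (x, y))) =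
    (LINT x|lborel. LINT y|lborel. f x * h y * cis (k (x, y)))"
  using lborel_pair.Fubini_integral[OF integrable_lborel_pair_mult[OF assms]] by simp

text \<open>The phase is symmetric in x and y, so both sides are the same double integral.\<close>

lemma fourier_multiplication:
  fixes f h :: "'a::euclidean_space \<Rightarrow> complex"
  assumes f: "integrable lborel f" and h: "integrable lborel h"
  shows "(LINT y|lborel. fourier f y * h y) = (LINT x|lborel. f x * fourier h x)"
proof -
  have "(LINT y|lborel. fourier f y * h y) =
      (LINT y|lborel. LINT x|lborel. f x * h y * cis (- 2 * pi * (x \<bullet> y)))"
    unfolding fourier_cis
    by (intro Bochner_Integration.integral_cong refl)
      (simp add: mult.assoc mult.left_commute[of _ "h _"] mult.commute[of _ "h _"])
  also have "\<dots> = (LINT x|lborel. LINT y|lborel. f x * h y * cis (- 2 * pi * (x \<bullet> y)))"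
    using Fubini_cis[OF f h, of "\<lambda>(x, y). - 2 * pi * (x \<bullet> y)"] by simp
  also have "\<dots> = (LINT x|lborel. f x * fourier h x)"
    unfolding fourier_cis by (simp add: mult.assoc inner_commute)
  finally show ?thesis .
qed

section \<open>Gaussian summation\<close>

definition gauss :: "'a::euclidean_space \<Rightarrow> real" where
  "gauss x = (\<Prod>b\<in>Basis. std_normal_density (x \<bullet> b))"

lemma borel_measurable_gauss[measurable]: "gauss \<in> borel_measurable (borel :: 'a::euclidean_space measure)"
  unfolding gauss_def[abs_def] by measurable

lemma gauss_nonneg: "0 \<le> gauss x"
  by (simp add: gauss_def prod_nonneg)

lemma gauss_eq: "gauss x = (1 / sqrt (2 * pi)) ^ DIM('a) * exp (- (norm x)\<^sup>2 / 2)" for x :: "'a::euclidean_space"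
proof -
  have "(norm x)\<^sup>2 = (\<Sum>b\<in>Basis. (x \<bullet> b)\<^sup>2)"
    by (subst power2_norm_eq_inner, subst euclidean_inner) (simp add: power2_eq_square)
  then show ?thesis
    by (simp add: gauss_def std_normal_density_def prod.distrib exp_sum[symmetric] sum_negf sum_divide_distrib
        power_divide prod_dividef)
qed

lemma nn_integral_gauss: "(\<integral>\<^sup>+x. ennreal (gauss x) \<partial>(lborel :: 'a::euclidean_space measure)) = 1"
proof -
  have "(\<integral>\<^sup>+x. ennreal (gauss x) \<partial>(lborel :: 'a measure)) =
      (\<integral>\<^sup>+x. (\<Prod>b\<in>Basis. ennreal (std_normal_density (x \<bullet> b))) \<partial>(lborel :: 'a measure))"
    by (simp add: gauss_def prod_ennreal)
  also have "\<dots> = (\<Prod>b\<in>(Basis :: 'a set). \<integral>\<^sup>+y. ennreal (std_normal_density y) \<partial>lborel)"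
    by (rule nn_integral_lborel_prod) auto
  also have "(\<integral>\<^sup>+y. ennreal (std_normal_density y) \<partial>lborel) = 1"
    using nn_integral_eq_integral[OF integrable_normal_density[of 1 0]] by (simp add: integral_normal_density)
  finally show ?thesis by simp
qed

lemma integrable_gauss: "integrable lborel (gauss :: 'a::euclidean_space \<Rightarrow> real)"
  by (rule integrableI_nonneg) (simp_all add: gauss_nonneg nn_integral_gauss)

lemma integral_gauss: "(LINT x|lborel. gauss (x :: 'a::euclidean_space)) = 1"
  using nn_integral_gauss[where 'a='a] integrable_gauss[where 'a='a]
  by (subst integral_eq_nn_integral) (auto simp: gauss_nonneg)

lemma integral_std_normal_cis:
  "(LINT y|lborel. of_real (std_normal_density y) * cis (s * y)) = of_real (exp (- s\<^sup>2 / 2))"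
proof -
  have "of_real (exp (- s\<^sup>2 / 2)) = (LINT y|std_normal_distribution. cis (s * y))"
    using fun_cong[OF char_std_normal_distribution, of s]
    unfolding char_def by (simp add: cis_conv_exp)
  also have "\<dots> = (LINT y|lborel. std_normal_density y *\<^sub>R cis (s * y))"
    by (rule integral_density) (auto simp: cis_conv_exp)
  finally show ?thesis by (simp add: scaleR_conv_of_real)
qed

text \<open>\<open>gauss\<close> is the standard normal density written as a product over the basis,
  so the integral factors into characteristic functions of the one-dimensional normal
  distribution.\<close>

lemma integral_gauss_cis:
  "(LINT x|lborel. of_real (gauss x) * cis (s \<bullet> x)) = of_real (exp (- (norm s)\<^sup>2 / 2))"
  for s :: "'a::euclidean_space"
proof -
  have "(LINT x|lborel. of_real (gauss x) * cis (s \<bullet> x)) =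
      (LINT x|lborel. (\<Prod>b\<in>Basis. of_real (std_normal_density (x \<bullet> b)) * cis ((s \<bullet> b) * (x \<bullet> b))))"
  proof (rule Bochner_Integration.integral_cong[OF refl])
    fix x :: 'a
    have "cis (s \<bullet> x) = (\<Prod>b\<in>Basis. cis ((s \<bullet> b) * (x \<bullet> b)))"
      unfolding cis_conv_exp by (subst euclidean_inner) (simp add: exp_sum[symmetric] sum_distrib_left)
    then show "of_real (gauss x) * cis (s \<bullet> x) =
        (\<Prod>b\<in>Basis. of_real (std_normal_density (x \<bullet> b)) * cis ((s \<bullet> b) * (x \<bullet> b)))"
      by (simp add: gauss_def prod.distrib)
  qed
  also have "\<dots> = (\<Prod>b\<in>(Basis :: 'a set). LINT y|lborel. of_real (std_normal_density y) * cis ((s \<bullet> b) * y))"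
  proof (rule integral_lborel_prod)
    fix b :: 'a
    have "integrable lborel (\<lambda>y. of_real (std_normal_density y) :: complex)"
      using integrable_normal_density[of 1 0] by (intro integrable_of_real) simp
    then show "integrable lborel (\<lambda>y. of_real (std_normal_density y) * cis ((s \<bullet> b) * y))"
      by (rule integrable_cis_mult) simp
  qed
  also have "\<dots> = of_real (exp (- (norm s)\<^sup>2 / 2))"
  proof -
    have "(norm s)\<^sup>2 = (\<Sum>b\<in>Basis. (s \<bullet> b)\<^sup>2)"
      by (subst power2_norm_eq_inner, subst euclidean_inner) (simp add: power2_eq_square)
    then show ?thesis
      unfolding integral_std_normal_cis
      by (simp add: exp_sum[symmetric] sum_negf sum_divide_distrib flip: of_real_prod)
  qed
  finally show ?thesis .
qed

lemma integrable_gaussian_weight: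
  fixes \<epsilon> :: real assumes "\<epsilon> > 0"
  shows "integrable lborel (\<lambda>x :: 'a::euclidean_space. exp (- (norm (\<epsilon> *\<^sub>R x))\<^sup>2 / 2))"
proof -
  have "integrable lborel (\<lambda>x :: 'a. sqrt (2 * pi) ^ DIM('a) * gauss (0 + \<epsilon> *\<^sub>R x))"
    using assms by (intro integrable_mult_right integrable_lborel_affine integrable_gauss) auto
  then show ?thesis by (simp add: gauss_eq power_divide)
qed

text \<open>Substituting v = \<epsilon> y gives the factor \<epsilon>^(-d). The constant (2 pi)^d is
  c^2: one c comes from writing the weight as a multiple of \<open>gauss\<close>, the other from
  doing so with its transform. The result is an approximate identity at \<open>x\<close> of width
  \<epsilon> / (2 pi).\<close>

lemma fourier_gaussian_weight:
  fixes x t :: "'a::euclidean_space"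
  assumes \<epsilon>: "\<epsilon> > 0"
  shows "fourier (\<lambda>y. of_real (exp (- (norm (\<epsilon> *\<^sub>R y))\<^sup>2 / 2)) * cis (2 * pi * (x \<bullet> y))) t =
    of_real ((2 * pi / \<epsilon>) ^ DIM('a) * gauss ((2 * pi / \<epsilon>) *\<^sub>R (t - x)))"
proof -
  define c where "c = sqrt (2 * pi) ^ DIM('a)"
  have c0: "c > 0" by (simp add: c_def)
  let ?s = "- (2 * pi / \<epsilon>) *\<^sub>R (t - x)"
  let ?f = "\<lambda>v. of_real (gauss v) * cis (?s \<bullet> v)"
  have w: "exp (- (norm (\<epsilon> *\<^sub>R y))\<^sup>2 / 2) = c * gauss (0 + \<epsilon> *\<^sub>R y)" for y :: 'a
    by (simp add: gauss_eq c_def power_divide)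
  have arg: "2 * pi * (x \<bullet> y) + - 2 * pi * (y \<bullet> t) = ?s \<bullet> (0 + \<epsilon> *\<^sub>R y)" for y
  proof -
    have "?s \<bullet> (0 + \<epsilon> *\<^sub>R y) = - (2 * pi * ((t - x) \<bullet> y))" using \<epsilon> by simp
    then show ?thesis by (simp add: inner_diff_left right_diff_distrib inner_commute[of y t])
  qed
  have "fourier (\<lambda>y. of_real (exp (- (norm (\<epsilon> *\<^sub>R y))\<^sup>2 / 2)) * cis (2 * pi * (x \<bullet> y))) t =
      (LINT y|lborel. of_real c * ?f (0 + \<epsilon> *\<^sub>R y))"
    unfolding fourier_cis
  proof (rule Bochner_Integration.integral_cong[OF refl])
    fix y
    have "W * cis (2 * pi * (x \<bullet> y)) * cis (- 2 * pi * (y \<bullet> t)) = W * cis (?s \<bullet> (0 + \<epsilon> *\<^sub>R y))" for W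
      by (simp only: arg[symmetric] mult.assoc[of W] cis_mult)
    then show "of_real (exp (- (norm (\<epsilon> *\<^sub>R y))\<^sup>2 / 2)) * cis (2 * pi * (x \<bullet> y)) * cis (- 2 * pi * (y \<bullet> t)) =
        of_real c * ?f (0 + \<epsilon> *\<^sub>R y)"
      by (simp only: w of_real_mult mult.assoc)
  qed
  also have "\<dots> = of_real c * (LINT y|lborel. ?f (0 + \<epsilon> *\<^sub>R y))" by simp
  also have "(LINT y|lborel. ?f (0 + \<epsilon> *\<^sub>R y)) = (LINT v|lborel. ?f v) / of_real (\<epsilon> ^ DIM('a))"
    using \<epsilon> by (subst (2) integral_lborel_affine[where c=\<epsilon> and t=0]) (auto simp: cis_conv_exp scaleR_conv_of_real)
  also have "(LINT v|lborel. ?f v) = of_real (exp (- (norm ?s)\<^sup>2 / 2))"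
    by (rule integral_gauss_cis)
  also have "exp (- (norm ?s)\<^sup>2 / 2) = c * gauss ((2 * pi / \<epsilon>) *\<^sub>R (t - x))"
    by (simp add: gauss_eq c_def power_divide)
  also have "of_real c * (of_real (c * gauss ((2 * pi / \<epsilon>) *\<^sub>R (t - x))) / of_real (\<epsilon> ^ DIM('a))) =
    (of_real ((c * c / \<epsilon> ^ DIM('a)) * gauss ((2 * pi / \<epsilon>) *\<^sub>R (t - x))) :: complex)" by simp
  also have "c * c = (2 * pi) ^ DIM('a)" unfolding c_def power_mult_distrib[symmetric] by simp
  finally show ?thesis by (simp add: power_divide)
qed

text \<open>\<open>fourier_multiplication\<close> with the damped character of frequency
  \<open>x\<close>; the Gaussian factor makes the integral converge for every integrable
  \<open>f\<close>. The substitution t = x + (\<epsilon> / (2 pi)) u turns the approximate identity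
  into an average against \<open>gauss\<close>.\<close>

lemma fourier_inversion_smoothed:
  fixes f :: "'a::euclidean_space \<Rightarrow> complex"
  assumes f: "integrable lborel f" and \<epsilon>: "\<epsilon> > 0"
  shows "(LINT y|lborel. fourier f y * cis (2 * pi * (x \<bullet> y)) * of_real (exp (- (norm (\<epsilon> *\<^sub>R y))\<^sup>2 / 2))) =
    (LINT u|lborel. f (x + (\<epsilon> / (2 * pi)) *\<^sub>R u) * of_real (gauss u))"
proof -
  have [measurable]: "f \<in> borel_measurable borel" using f by auto
  let ?h = "\<lambda>y. of_real (exp (- (norm (\<epsilon> *\<^sub>R y))\<^sup>2 / 2)) * cis (2 * pi * (x \<bullet> y))"
  have h: "integrable lborel ?h"
    by (intro integrable_cis_mult integrable_of_real integrable_gaussian_weight \<epsilon>) measurable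
  have "(LINT y|lborel. fourier f y * cis (2 * pi * (x \<bullet> y)) * of_real (exp (- (norm (\<epsilon> *\<^sub>R y))\<^sup>2 / 2))) =
      (LINT y|lborel. fourier f y * ?h y)" by (simp add: mult_ac)
  also have "\<dots> = (LINT t|lborel. f t * fourier ?h t)" by (rule fourier_multiplication[OF f h])
  also have "\<dots> = (LINT t|lborel. of_real ((2 * pi / \<epsilon>) ^ DIM('a)) * (f t * of_real (gauss ((2 * pi / \<epsilon>) *\<^sub>R (t - x)))))"
    unfolding fourier_gaussian_weight[OF \<epsilon>] by (simp add: mult_ac)
  also have "\<dots> = of_real ((2 * pi / \<epsilon>) ^ DIM('a)) * (LINT t|lborel. f t * of_real (gauss ((2 * pi / \<epsilon>) *\<^sub>R (t - x))))"
    by simp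
  also have "(LINT t|lborel. f t * of_real (gauss ((2 * pi / \<epsilon>) *\<^sub>R (t - x)))) =
      of_real ((\<epsilon> / (2 * pi)) ^ DIM('a)) * (LINT u|lborel. f (x + (\<epsilon> / (2 * pi)) *\<^sub>R u) * of_real (gauss u))"
    using \<epsilon> by (subst integral_lborel_affine[where c="\<epsilon> / (2 * pi)" and t=x]) (auto simp: scaleR_conv_of_real)
  also have "of_real ((2 * pi / \<epsilon>) ^ DIM('a)) * (of_real ((\<epsilon> / (2 * pi)) ^ DIM('a)) * z) = z" for z :: complex
    using \<epsilon> by (simp add: power_divide)
  finally show ?thesis .
qed

text \<open>Signed densities are avoided by adding the bound: \<open>f x + C\<close> and
  \<open>C\<close> are nonnegative densities of measures that agree on boxes, an intersection-stable
  generator, and a density with respect to Lebesgue measure is unique almost everywhere.\<close>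

lemma AE_zero_if_box_integrals_zero:
  fixes f :: "'a::euclidean_space \<Rightarrow> real"
  assumes [measurable]: "f \<in> borel_measurable borel" and C: "\<And>x. \<bar>f x\<bar> \<le> C"
    and z: "\<And>a b. (LINT x|lborel. indicator (box a b) x * f x) = 0"
  shows "AE x in lborel. f x = 0"
proof -
  have C0: "0 \<le> C" using C[of 0] by simp
  have fC: "0 \<le> f x + C" for x using C[of x] by linarith
  have "density lborel (\<lambda>x. ennreal (f x + C)) = density lborel (\<lambda>_. ennreal C)" (is "?M1 = ?M2")
  proof (rule measure_eqI_generator_eq)
    let ?E = "range (\<lambda>(a, b). box a b :: 'a set)"
    show "Int_stable ?E" by (auto simp: Int_stable_def box_Int_box)
    show "?E \<subseteq> Pow UNIV" "sets ?M1 = sigma_sets UNIV ?E" "sets ?M2 = sigma_sets UNIV ?E"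
      by (simp_all add: borel_eq_box)
    let ?A = "\<lambda>n::nat. box (- (real n *\<^sub>R One)) (real n *\<^sub>R One) :: 'a set"
    show "range ?A \<subseteq> ?E" "(\<Union>i. ?A i) = UNIV" unfolding UN_box_eq_UNIV by auto
    have eq: "emeasure ?M1 (box a b) = emeasure ?M2 (box a b)" for a b
    proof -
      have ib: "integrable lborel (indicator (box a b) :: 'a \<Rightarrow> real)"
        by (rule integrable_real_indicator[OF _ emeasure_lborel_box_finite]) simp
      have i1: "integrable lborel (\<lambda>x. indicator (box a b) x * f x)"
        by (rule Bochner_Integration.integrable_bound[OF integrable_mult_right[OF ib, of C]])
          (use C C0 in \<open>auto simp: indicator_def\<close>)
      have i2: "integrable lborel (\<lambda>x. indicator (box a b) x * C)"
        by (rule integrable_mult_left[OF ib])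
      have "emeasure ?M1 (box a b) = (\<integral>\<^sup>+x. ennreal (indicator (box a b) x * f x + indicator (box a b) x * C) \<partial>lborel)"
        by (subst emeasure_density) (auto intro!: nn_integral_cong simp: indicator_def)
      also have "\<dots> = ennreal (LINT x|lborel. indicator (box a b) x * f x + indicator (box a b) x * C)"
        by (rule nn_integral_eq_integral) (use i1 i2 fC in \<open>auto simp: indicator_def\<close>)
      also have "\<dots> = ennreal (LINT x|lborel. indicator (box a b) x * C)"
        by (subst Bochner_Integration.integral_add[OF i1 i2]) (simp only: z add_0)
      also have "\<dots> = (\<integral>\<^sup>+x. ennreal (indicator (box a b) x * C) \<partial>lborel)"
        by (rule nn_integral_eq_integral[symmetric]) (use i2 C0 in auto)
      also have "\<dots> = emeasure ?M2 (box a b)"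
        by (subst emeasure_density) (auto intro!: nn_integral_cong simp: indicator_def)
      finally show ?thesis .
    qed
    show "emeasure ?M1 X = emeasure ?M2 X" if "X \<in> ?E" for X using that eq by auto
    show "emeasure ?M1 (?A i) \<noteq> \<infinity>" for i
      unfolding eq by (simp add: emeasure_density_const ennreal_mult_eq_top_iff emeasure_lborel_box_finite[THEN less_imp_neq])
  qed
  then have "AE x in lborel. ennreal (f x + C) = ennreal C"
    by (subst (asm) sigma_finite_measure.density_unique_iff[OF sigma_finite_lborel]) auto
  then show ?thesis
    by eventually_elim (use fC C0 in simp)
qed

section \<open>The kernel, its square integrability and the transform of |K|^2\<close>

locale bounded_density =
  fixes \<phi> :: "'a::euclidean_space \<Rightarrow> real"
  assumes int: "integrable lborel \<phi>" and total: "(LINT x|lborel. \<phi> x) = 1"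
    and nonneg: "\<And>x. 0 \<le> \<phi> x" and le1: "\<And>x. \<phi> x \<le> 1"
begin

definition K :: "'a \<Rightarrow> complex" where "K = fourier (\<lambda>x. of_real (\<phi> x))"

definition g :: "'a \<Rightarrow> real" where "g = fun_convolution \<phi> (\<lambda>x. \<phi> (- x))"

lemma measurable_\<phi>[measurable]: "\<phi> \<in> borel_measurable borel"
  using int by auto

lemma g_eq: "g x = (LINT y|lborel. \<phi> y * \<phi> (y - x))"
  by (simp add: g_def fun_convolution_def)

lemma measurable_g[measurable]: "g \<in> borel_measurable borel"
  unfolding g_eq[abs_def] by measurable

lemma g_nonneg: "0 \<le> g x"
  unfolding g_eq by (rule Bochner_Integration.integral_nonneg) (simp add: nonneg)

text \<open>This is how \<open>\<phi> \<le> 1\<close> enters: one factor is bounded by 1, the other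
  integrates to 1. It makes \<open>1 - g\<close> a nonnegative density and bounds the Gaussian
  averages of \<open>g\<close>.\<close>

lemma g_le1: "g x \<le> 1"
proof -
  have "g x \<le> (LINT y|lborel. \<phi> y)"
    unfolding g_eq
  proof (rule integral_mono)
    show "integrable lborel (\<lambda>y. \<phi> y * \<phi> (y - x))"
      by (rule Bochner_Integration.integrable_bound[OF int])
        (auto simp: abs_mult nonneg le1 mult_left_le)
  qed (auto simp: int nonneg le1 mult_left_le)
  then show ?thesis by (simp add: total)
qed

lemma measurable_K[measurable]: "K \<in> borel_measurable borel"
  unfolding K_def by measurable

lemma norm_K_le1: "norm (K x) \<le> 1"
  using norm_fourier_le[of "\<lambda>x. of_real (\<phi> x)" x] by (simp add: K_def nonneg total)

lemma K_uminus: "K (- x) = cnj (K x)"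
proof -
  have "cnj (K x) = (LINT t|lborel. cnj (of_real (\<phi> t) * cis (- 2 * pi * (t \<bullet> x))))"
    unfolding K_def fourier_cis by (rule Bochner_Integration.integral_cnj[symmetric])
  then show ?thesis by (simp add: K_def fourier_cis cis_cnj)
qed

lemma K_0: "K 0 = 1"
  by (simp add: K_def fourier_cis total)

text \<open>With the integral over x taken first, reflection turns the inner integral into the total
  mass 1 of \<open>\<phi>\<close>.\<close>

lemma integrable_convolution_integrand:
  "integrable (lborel \<Otimes>\<^sub>M lborel) (\<lambda>(x, y). \<phi> y * \<phi> (y - x))"
proof (rule integrableI_bounded)
  have "(\<integral>\<^sup>+z. ennreal (norm (case z of (x, y) \<Rightarrow> \<phi> y * \<phi> (y - x))) \<partial>(lborel \<Otimes>\<^sub>M lborel)) =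
      (\<integral>\<^sup>+y. \<integral>\<^sup>+x. ennreal (norm (case (x, y) of (x, y) \<Rightarrow> \<phi> y * \<phi> (y - x))) \<partial>lborel \<partial>lborel)"
    by (rule lborel_pair.nn_integral_snd[symmetric]) measurable
  also have "\<dots> = (\<integral>\<^sup>+y. ennreal (\<phi> y) * (\<integral>\<^sup>+x. ennreal (\<phi> (y - x)) \<partial>lborel) \<partial>lborel)"
    by (simp add: abs_mult nonneg ennreal_mult nn_integral_cmult)
  also have "(\<lambda>y. (\<integral>\<^sup>+x. ennreal (\<phi> (y - x)) \<partial>lborel)) = (\<lambda>y. 1)"
    using nn_integral_lborel_reflect[of "\<lambda>x. ennreal (\<phi> x)"]
    by (simp add: nn_integral_eq_integral[OF int] nonneg total)
  also have "(\<integral>\<^sup>+y. ennreal (\<phi> y) * 1 \<partial>lborel) < \<infinity>"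
    by (simp add: nn_integral_eq_integral[OF int] nonneg total)
  finally show "(\<integral>\<^sup>+z. ennreal (norm (case z of (x, y) \<Rightarrow> \<phi> y * \<phi> (y - x))) \<partial>(lborel \<Otimes>\<^sub>M lborel)) < \<infinity>" .
qed measurable

lemma integrable_g: "integrable lborel g"
  using lborel_pair.integrable_fst'[OF integrable_convolution_integrand] by (simp add: g_eq[abs_def])

text \<open>The convolution theorem: with z = y - x the phase at x splits into phases at y and at
  -z, and the two factors integrate to \<open>K \<xi>\<close> and its conjugate.\<close>

lemma fourier_g: "fourier (\<lambda>x. of_real (g x)) \<xi> = of_real ((cmod (K \<xi>))\<^sup>2)"
proof -
  let ?F = "\<lambda>x y. of_real (\<phi> y * \<phi> (y - x)) * cis (- 2 * pi * (x \<bullet> \<xi>))"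
  have "integrable (lborel \<Otimes>\<^sub>M lborel) (\<lambda>z. complex_of_real (case z of (x, y) \<Rightarrow> \<phi> y * \<phi> (y - x)))"
    by (rule integrable_of_real[OF integrable_convolution_integrand])
  then have iF: "integrable (lborel \<Otimes>\<^sub>M lborel) (\<lambda>(x, y). ?F x y)"
    by (rule Bochner_Integration.integrable_bound) (auto simp: norm_mult cis_conv_exp)
  have "fourier (\<lambda>x. of_real (g x)) \<xi> = (LINT x|lborel. LINT y|lborel. ?F x y)"
    unfolding fourier_cis g_eq by (simp del: of_real_mult)
  also have "\<dots> = (LINT y|lborel. LINT x|lborel. ?F x y)"
    by (rule lborel_pair.Fubini_integral[OF iF, symmetric])
  also have "\<dots> = (LINT y|lborel. of_real (\<phi> y) * cis (- 2 * pi * (y \<bullet> \<xi>)) * cnj (K \<xi>))"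
  proof (rule Bochner_Integration.integral_cong[OF refl])
    fix y
    let ?h = "\<lambda>z. of_real (\<phi> y) * cis (- 2 * pi * (y \<bullet> \<xi>)) * (of_real (\<phi> z) * cis (2 * pi * (z \<bullet> \<xi>)))"
    have "?F x y = ?h (y - x)" for x
    proof -
      have "cis (- 2 * pi * (x \<bullet> \<xi>)) = cis (- 2 * pi * (y \<bullet> \<xi>)) * cis (2 * pi * ((y - x) \<bullet> \<xi>))"
        unfolding cis_mult by (rule arg_cong[where f=cis]) (simp add: inner_diff_left algebra_simps)
      then show ?thesis by (simp add: mult_ac)
    qed
    then have "(LINT x|lborel. ?F x y) = (LINT x|lborel. ?h (y - x))" by (simp only:)
    also have "\<dots> = (LINT z|lborel. ?h z)"
      by (rule integral_lborel_reflect) (unfold cis_conv_exp, measurable)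
    also have "\<dots> = of_real (\<phi> y) * cis (- 2 * pi * (y \<bullet> \<xi>)) * cnj (K \<xi>)"
      using K_uminus[of \<xi>] by (simp add: K_def fourier_cis)
    finally show "(LINT x|lborel. ?F x y) = of_real (\<phi> y) * cis (- 2 * pi * (y \<bullet> \<xi>)) * cnj (K \<xi>)" .
  qed
  also have "\<dots> = K \<xi> * cnj (K \<xi>)"
    by (simp add: K_def fourier_cis)
  finally show ?thesis by (simp only: complex_norm_square)
qed

lemma smoothed_inversion_g:
  assumes "\<epsilon> > 0"
  shows "(LINT y|lborel. of_real ((cmod (K y))\<^sup>2) * cis (2 * pi * (x \<bullet> y)) * of_real (exp (- (norm (\<epsilon> *\<^sub>R y))\<^sup>2 / 2))) =
    (LINT u|lborel. complex_of_real (g (x + (\<epsilon> / (2 * pi)) *\<^sub>R u)) * of_real (gauss u))"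
  using fourier_inversion_smoothed[OF integrable_of_real[OF integrable_g] assms, of x] by (simp only: fourier_g)

text \<open>Smoothed inversion at 0 expresses the damped integral as a Gaussian average of
  \<open>g\<close>, which is at most 1; Fatou's lemma removes the damping. This plays the part of
  Plancherel's theorem for \<open>\<phi>\<close>.\<close>

lemma nn_integral_K2_le1: "(\<integral>\<^sup>+x. ennreal ((cmod (K x))\<^sup>2) \<partial>lborel) \<le> 1"
proof -
  define w where "w n y = exp (- (norm ((1 / real (Suc n)) *\<^sub>R y))\<^sup>2 / 2)" for n and y :: 'a
  have [measurable]: "w n \<in> borel_measurable borel" for n unfolding w_def[abs_def] by measurable
  have w_nn: "0 \<le> w n y" for n y by (simp add: w_def)
  have w_lim: "(\<lambda>n. w n y) \<longlonglongrightarrow> 1" for y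
  proof -
    have "(\<lambda>n. w n y) \<longlonglongrightarrow> exp (- (norm ((0::real) *\<^sub>R y))\<^sup>2 / 2)"
      unfolding w_def by (intro tendsto_intros LIMSEQ_Suc[OF lim_1_over_n]) simp
    then show ?thesis by simp
  qed
  have le: "(\<integral>\<^sup>+y. ennreal ((cmod (K y))\<^sup>2 * w n y) \<partial>lborel) \<le> 1" for n
  proof -
    have iw: "integrable lborel (w n)" unfolding w_def by (rule integrable_gaussian_weight) simp
    have K2: "(cmod (K y))\<^sup>2 \<le> 1" for y using norm_K_le1 by (simp add: power_le_one)
    have i: "integrable lborel (\<lambda>y. (cmod (K y))\<^sup>2 * w n y)"
      by (rule Bochner_Integration.integrable_bound[OF iw]) (auto simp: abs_mult w_nn K2 mult_left_le_one_le)
    have ig: "integrable lborel (\<lambda>u. g (0 + (1 / real (Suc n) / (2 * pi)) *\<^sub>R u) * gauss u)"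
      by (rule Bochner_Integration.integrable_bound[OF integrable_gauss])
        (auto simp: abs_mult gauss_nonneg g_nonneg g_le1 mult_left_le_one_le)
    have "complex_of_real (LINT y|lborel. (cmod (K y))\<^sup>2 * w n y) =
        (LINT y|lborel. of_real ((cmod (K y))\<^sup>2) * cis (2 * pi * (0 \<bullet> y)) * of_real (w n y))"
      unfolding integral_complex_of_real[symmetric] by (intro Bochner_Integration.integral_cong) auto
    also have "\<dots> = (LINT u|lborel. complex_of_real (g (0 + (1 / real (Suc n) / (2 * pi)) *\<^sub>R u)) * of_real (gauss u))"
      unfolding w_def by (rule smoothed_inversion_g) simp
    also have "\<dots> = of_real (LINT u|lborel. g (0 + (1 / real (Suc n) / (2 * pi)) *\<^sub>R u) * gauss u)"
      unfolding integral_complex_of_real[symmetric] by (intro Bochner_Integration.integral_cong) auto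
    finally have "(LINT y|lborel. (cmod (K y))\<^sup>2 * w n y) = (LINT u|lborel. g (0 + (1 / real (Suc n) / (2 * pi)) *\<^sub>R u) * gauss u)"
      by (simp only: of_real_eq_iff)
    also have "\<dots> \<le> (LINT u|lborel. gauss (u :: 'a))"
      by (rule integral_mono[OF ig integrable_gauss]) (auto simp: gauss_nonneg g_nonneg g_le1 mult_left_le_one_le)
    finally have "(LINT y|lborel. (cmod (K y))\<^sup>2 * w n y) \<le> 1" by (simp add: integral_gauss)
    then show ?thesis
      using nn_integral_eq_integral[OF i] w_nn by (simp add: ennreal_le_1)
  qed
  have "(\<integral>\<^sup>+x. ennreal ((cmod (K x))\<^sup>2) \<partial>lborel) =
      (\<integral>\<^sup>+x. liminf (\<lambda>n. ennreal ((cmod (K x))\<^sup>2 * w n x)) \<partial>lborel)"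
  proof (rule nn_integral_cong)
    fix x
    have "(\<lambda>n. ennreal ((cmod (K x))\<^sup>2 * w n x)) \<longlonglongrightarrow> ennreal ((cmod (K x))\<^sup>2 * 1)"
      by (intro tendsto_ennrealI tendsto_intros w_lim)
    then show "ennreal ((cmod (K x))\<^sup>2) = liminf (\<lambda>n. ennreal ((cmod (K x))\<^sup>2 * w n x))"
      by (simp add: lim_imp_Liminf)
  qed
  also have "\<dots> \<le> liminf (\<lambda>n. \<integral>\<^sup>+x. ennreal ((cmod (K x))\<^sup>2 * w n x) \<partial>lborel)"
    by (rule nn_integral_liminf) measurable
  also have "\<dots> \<le> 1"
    using le by (intro order_trans[OF Liminf_le_Limsup] Limsup_bounded) auto
  finally show ?thesis .
qed

lemma integrable_K2: "integrable lborel (\<lambda>x. (cmod (K x))\<^sup>2)"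
  by (rule integrableI_nonneg) (use nn_integral_K2_le1 in \<open>auto intro: le_less_trans\<close>)

definition K2hat :: "'a \<Rightarrow> complex" where "K2hat = fourier (\<lambda>x. of_real ((cmod (K x))\<^sup>2))"

lemma measurable_K2hat[measurable]: "K2hat \<in> borel_measurable borel"
  unfolding K2hat_def by measurable

lemma norm_K2hat_le: "norm (K2hat x) \<le> (LINT y|lborel. (cmod (K y))\<^sup>2)"
  unfolding K2hat_def using norm_fourier_le[of "\<lambda>x. of_real ((cmod (K x))\<^sup>2)" x] by (simp add: norm_power)

text \<open>|K|^2 is even by \<open>K_uminus\<close>, so its transform is also its inverse
  transform, the form in which smoothed inversion produces it.\<close>

lemma K2hat_inverse: "K2hat x = (LINT y|lborel. of_real ((cmod (K y))\<^sup>2) * cis (2 * pi * (x \<bullet> y)))"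
proof -
  have "K2hat x = (LINT y|lborel. of_real ((cmod (K (0 - y)))\<^sup>2) * cis (2 * pi * (x \<bullet> (0 - y))))"
    unfolding K2hat_def fourier_cis by (simp add: K_uminus inner_commute)
  also have "\<dots> = (LINT y|lborel. of_real ((cmod (K y))\<^sup>2) * cis (2 * pi * (x \<bullet> y)))"
    by (rule integral_lborel_reflect) (unfold cis_conv_exp, measurable)
  finally show ?thesis .
qed

text \<open>The smoothed function \<open>\<Phi> n\<close> has two descriptions. As a damped integral
  it tends pointwise to \<open>K2hat\<close>. As a Gaussian average of \<open>g\<close> it yields,
  after integration over the box, averages of \<open>G\<close> on the scale
  \<open>\<delta> n\<close>, which tend to \<open>G 0\<close> because \<open>G\<close> is continuous
  at 0.\<close>

lemma box_integral_K2hat: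
  "(LINT x|lborel. indicator (box a b) x * K2hat x) = (LINT x|lborel. indicator (box a b) x * complex_of_real (g x))"
proof -
  define \<epsilon> where "\<epsilon> n = 1 / real (Suc n)" for n
  define \<delta> where "\<delta> n = \<epsilon> n / (2 * pi)" for n
  have \<epsilon>0: "\<epsilon> n > 0" for n by (simp add: \<epsilon>_def)
  have \<epsilon>_lim: "\<epsilon> \<longlonglongrightarrow> 0" unfolding \<epsilon>_def[abs_def] by (rule LIMSEQ_Suc[OF lim_1_over_n])
  have \<delta>_lim: "\<delta> \<longlonglongrightarrow> 0" unfolding \<delta>_def[abs_def] using tendsto_divide[OF \<epsilon>_lim tendsto_const, of "2 * pi"] by simp
  let ?B = "indicator (box a b) :: 'a \<Rightarrow> complex"
  have iB: "integrable lborel ?B"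
  proof -
    have "integrable lborel (indicator (box a b) :: 'a \<Rightarrow> real)"
      by (rule integrable_real_indicator[OF _ emeasure_lborel_box_finite]) simp
    from integrable_of_real[OF this, where 'a=complex] show ?thesis by (simp add: of_real_indicator)
  qed
  define \<Phi> where "\<Phi> n x = (LINT u|lborel. complex_of_real (g (x + \<delta> n *\<^sub>R u)) * of_real (gauss u))" for n x
  define G where "G s = (LINT x|lborel. ?B x * complex_of_real (g (x + s)))" for s
  have [measurable]: "\<Phi> n \<in> borel_measurable borel" for n unfolding \<Phi>_def[abs_def] by measurable
  have [measurable]: "G \<in> borel_measurable borel" unfolding G_def[abs_def] by measurable
  have \<Phi>_eq: "\<Phi> n x = (LINT y|lborel. of_real ((cmod (K y))\<^sup>2) * cis (2 * pi * (x \<bullet> y)) * of_real (exp (- (norm (\<epsilon> n *\<^sub>R y))\<^sup>2 / 2)))" for n x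
    unfolding \<Phi>_def \<delta>_def by (rule smoothed_inversion_g[symmetric, OF \<epsilon>0])
  have \<Phi>_lim: "(\<lambda>n. \<Phi> n x) \<longlonglongrightarrow> K2hat x" for x
    unfolding \<Phi>_eq K2hat_inverse
  proof (rule integral_dominated_convergence[where w="\<lambda>y. (cmod (K y))\<^sup>2"])
    show "AE y in lborel. (\<lambda>n. of_real ((cmod (K y))\<^sup>2) * cis (2 * pi * (x \<bullet> y)) * of_real (exp (- (norm (\<epsilon> n *\<^sub>R y))\<^sup>2 / 2)))
        \<longlonglongrightarrow> of_real ((cmod (K y))\<^sup>2) * cis (2 * pi * (x \<bullet> y))"
    proof (rule AE_I2)
      fix y
      have "(\<lambda>n. of_real ((cmod (K y))\<^sup>2) * cis (2 * pi * (x \<bullet> y)) * of_real (exp (- (norm (\<epsilon> n *\<^sub>R y))\<^sup>2 / 2)))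
        \<longlonglongrightarrow> of_real ((cmod (K y))\<^sup>2) * cis (2 * pi * (x \<bullet> y)) * of_real (exp (- (norm ((0::real) *\<^sub>R y))\<^sup>2 / 2))"
        by (intro tendsto_intros \<epsilon>_lim) simp
      then show "(\<lambda>n. of_real ((cmod (K y))\<^sup>2) * cis (2 * pi * (x \<bullet> y)) * of_real (exp (- (norm (\<epsilon> n *\<^sub>R y))\<^sup>2 / 2)))
        \<longlonglongrightarrow> of_real ((cmod (K y))\<^sup>2) * cis (2 * pi * (x \<bullet> y))" by simp
    qed
  qed (auto simp: integrable_K2 norm_mult norm_power cis_conv_exp mult_left_le)
  have \<Phi>_bd: "norm (\<Phi> n x) \<le> 1" for n x
  proof -
    have "norm (\<Phi> n x) \<le> (LINT u|lborel. norm (complex_of_real (g (x + \<delta> n *\<^sub>R u)) * of_real (gauss u)))"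
      unfolding \<Phi>_def by (rule integral_norm_bound)
    also have "\<dots> \<le> (LINT u|lborel. gauss (u :: 'a))"
      by (rule integral_mono_AE'[OF integrable_gauss])
        (auto simp: norm_mult gauss_nonneg g_nonneg g_le1 mult_left_le_one_le)
    finally show ?thesis by (simp add: integral_gauss)
  qed
  have lim1: "(\<lambda>n. LINT x|lborel. ?B x * \<Phi> n x) \<longlonglongrightarrow> (LINT x|lborel. ?B x * K2hat x)"
    by (rule integral_dominated_convergence[where w="\<lambda>x. norm (?B x)"])
      (auto intro!: tendsto_intros \<Phi>_lim integrable_norm iB simp: norm_mult \<Phi>_bd mult_left_le)
  have swap: "(LINT x|lborel. ?B x * \<Phi> n x) = (LINT u|lborel. G (\<delta> n *\<^sub>R u) * of_real (gauss u))" for n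
  proof -
    let ?F = "\<lambda>x u. ?B x * (complex_of_real (g (x + \<delta> n *\<^sub>R u)) * of_real (gauss u))"
    have "integrable (lborel \<Otimes>\<^sub>M lborel) (\<lambda>(x, u). ?B x * complex_of_real (gauss (u :: 'a)) * cis ((\<lambda>_. 0) (x, u)))"
      by (intro integrable_lborel_pair_mult iB integrable_of_real integrable_gauss) measurable
    then have iF: "integrable (lborel \<Otimes>\<^sub>M lborel) (\<lambda>(x, u). ?F x u)"
      by (rule Bochner_Integration.integrable_bound)
        (auto simp: norm_mult gauss_nonneg g_nonneg g_le1 indicator_def mult_left_le_one_le)
    have "(LINT x|lborel. ?B x * \<Phi> n x) = (LINT x|lborel. LINT u|lborel. ?F x u)"
      unfolding \<Phi>_def by simp
    also have "\<dots> = (LINT u|lborel. LINT x|lborel. ?F x u)"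
      by (rule lborel_pair.Fubini_integral[OF iF, symmetric])
    also have "\<dots> = (LINT u|lborel. G (\<delta> n *\<^sub>R u) * of_real (gauss u))"
      unfolding G_def by (simp flip: mult.assoc)
    finally show ?thesis .
  qed
  \<comment> \<open>The translation moves from \<open>g\<close> to the box, so that continuity of
    \<open>G\<close> at 0 becomes a matter of shifting a box.\<close>
  have G_alt: "G s = (LINT t|lborel. indicator (box a b) (t - s) * complex_of_real (g t))" for s
  proof -
    have "(LINT t|lborel. indicator (box a b) (t - s) * complex_of_real (g t)) =
        (LINT x|lborel. indicator (box a b) ((s + x) - s) * complex_of_real (g (s + x)))"
      by (rule integral_lborel_translate[symmetric]) measurable
    then show ?thesis by (simp add: G_def add.commute)
  qed
  have G_bd: "norm (G s) \<le> (LINT t|lborel. g t)" for s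
    unfolding G_alt
    by (rule order_trans[OF integral_norm_bound integral_mono_AE'[OF integrable_g]])
      (auto simp: norm_mult indicator_def g_nonneg)
  have G_lim: "(\<lambda>n. G (s n)) \<longlonglongrightarrow> G 0" if s: "s \<longlonglongrightarrow> 0" for s
    unfolding G_alt
  proof (rule integral_dominated_convergence[where w=g])
    \<comment> \<open>Off the boundary of the box, a null set, membership of \<open>t - s n\<close>
      is eventually that of \<open>t\<close>.\<close>
    have "AE t in lborel. t \<notin> cbox a b - box a b"
      using null_sets_cbox_Diff_box[of a b] by (intro AE_not_in)
    then show "AE t in lborel. (\<lambda>n. indicator (box a b) (t - s n) * complex_of_real (g t)) \<longlonglongrightarrow>
        indicator (box a b) (t - 0) * complex_of_real (g t)"
    proof eventually_elim
      case (elim t)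
      have ts: "(\<lambda>n. t - s n) \<longlonglongrightarrow> t" using tendsto_diff[OF tendsto_const s, of t] by simp
      have "eventually (\<lambda>n. (t - s n \<in> box a b) = (t \<in> box a b)) sequentially"
      proof (cases "t \<in> box a b")
        case True
        then show ?thesis using topological_tendstoD[OF ts open_box True] by (auto elim: eventually_mono)
      next
        case False
        then have "t \<in> - cbox a b" using elim by auto
        from topological_tendstoD[OF ts _ this] have "eventually (\<lambda>n. t - s n \<in> - cbox a b) sequentially"
          by (simp add: closed_cbox open_Compl)
        then show ?thesis using False box_subset_cbox[of a b] by (auto elim: eventually_mono)
      qed
      then have "eventually (\<lambda>n. indicator (box a b) (t - s n) * complex_of_real (g t) =
          indicator (box a b) (t - 0) * complex_of_real (g t)) sequentially"
        by eventually_elim (auto simp: indicator_def)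
      then show ?case by (rule tendsto_eventually)
    qed
  qed (auto simp: integrable_g norm_mult indicator_def g_nonneg)
  have lim2: "(\<lambda>n. LINT u|lborel. G (\<delta> n *\<^sub>R u) * of_real (gauss u)) \<longlonglongrightarrow> (LINT u|lborel. G 0 * of_real (gauss (u :: 'a)))"
  proof (rule integral_dominated_convergence[where w="\<lambda>u. (LINT t|lborel. g t) * gauss u"])
    have "(\<lambda>n. G (\<delta> n *\<^sub>R u) * complex_of_real (gauss u)) \<longlonglongrightarrow> G 0 * complex_of_real (gauss u)" for u :: 'a
    proof (intro tendsto_intros G_lim)
      show "(\<lambda>n. \<delta> n *\<^sub>R u) \<longlonglongrightarrow> 0" using tendsto_scaleR[OF \<delta>_lim tendsto_const, of u] by simp
    qed
    then show "AE u in lborel. (\<lambda>n. G (\<delta> n *\<^sub>R u) * complex_of_real (gauss u)) \<longlonglongrightarrow> G 0 * complex_of_real (gauss u)"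
      by simp
  qed (auto simp: integrable_gauss norm_mult gauss_nonneg G_bd mult_right_mono)
  have "(LINT u|lborel. G 0 * of_real (gauss (u :: 'a))) = G 0" by (simp add: integral_gauss)
  then have "(LINT x|lborel. ?B x * K2hat x) = G 0"
    using LIMSEQ_unique[OF lim1] lim2 unfolding swap by simp
  then show ?thesis by (simp add: G_def)
qed

text \<open>Both functions are bounded, so the real and imaginary parts of their difference fall
  under \<open>AE_zero_if_box_integrals_zero\<close>. Equality almost everywhere is all that a
  density requires.\<close>

lemma K2hat_AE: "AE x in lborel. K2hat x = of_real (g x)"
proof -
  let ?C = "(LINT y|lborel. (cmod (K y))\<^sup>2) + 1"
  have bd: "norm (K2hat x - of_real (g x)) \<le> ?C" for x
    using norm_triangle_ineq4[of "K2hat x" "of_real (g x)"] norm_K2hat_le[of x] g_nonneg[of x] g_le1[of x] by simp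
  have i1: "integrable lborel (\<lambda>x. indicator (box a b) x * (K2hat x - of_real (g x)))"
    and i2: "(LINT x|lborel. indicator (box a b) x * (K2hat x - of_real (g x))) = 0" for a b
  proof -
    have iB: "integrable lborel (indicator (box a b) :: 'a \<Rightarrow> real)"
      by (rule integrable_real_indicator[OF _ emeasure_lborel_box_finite]) simp
    have j1: "integrable lborel (\<lambda>x. indicator (box a b) x * K2hat x)"
      by (rule Bochner_Integration.integrable_bound[OF integrable_mult_right[OF iB, of ?C]])
        (use norm_K2hat_le order_trans[OF norm_K2hat_le] in \<open>auto simp: indicator_def intro: order_trans[OF norm_K2hat_le]\<close>)
    have j2: "integrable lborel (\<lambda>x. indicator (box a b) x * complex_of_real (g x))"
      by (rule Bochner_Integration.integrable_bound[OF iB]) (auto simp: indicator_def g_nonneg g_le1)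
    show "integrable lborel (\<lambda>x. indicator (box a b) x * (K2hat x - of_real (g x)))"
      using Bochner_Integration.integrable_diff[OF j1 j2] by (simp add: right_diff_distrib)
    show "(LINT x|lborel. indicator (box a b) x * (K2hat x - of_real (g x))) = 0"
      using Bochner_Integration.integral_diff[OF j1 j2] box_integral_K2hat[of a b] by (simp add: right_diff_distrib)
  qed
  have "AE x in lborel. Re (K2hat x - of_real (g x)) = 0"
  proof (rule AE_zero_if_box_integrals_zero[where C="?C"])
    show "(LINT x|lborel. indicator (box a b) x * Re (K2hat x - of_real (g x))) = 0" for a b
    proof -
      have "(LINT x|lborel. indicator (box a b) x * Re (K2hat x - of_real (g x))) =
          (LINT x|lborel. Re (indicator (box a b) x * (K2hat x - of_real (g x))))"
        by (intro Bochner_Integration.integral_cong) (auto simp: indicator_def)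
      then show ?thesis unfolding integral_Re[OF i1] i2 by simp
    qed
  qed (auto intro: order_trans[OF abs_Re_le_cmod bd] simp del: minus_complex.simps)
  moreover have "AE x in lborel. Im (K2hat x - of_real (g x)) = 0"
  proof (rule AE_zero_if_box_integrals_zero[where C="?C"])
    show "(LINT x|lborel. indicator (box a b) x * Im (K2hat x - of_real (g x))) = 0" for a b
    proof -
      have "(LINT x|lborel. indicator (box a b) x * Im (K2hat x - of_real (g x))) =
          (LINT x|lborel. Im (indicator (box a b) x * (K2hat x - of_real (g x))))"
        by (intro Bochner_Integration.integral_cong) (auto simp: indicator_def)
      then show ?thesis unfolding integral_Im[OF i1] i2 by simp
    qed
  qed (auto intro: order_trans[OF abs_Im_le_cmod bd] simp del: minus_complex.simps)
  ultimately show ?thesis by eventually_elim (auto simp: complex_eq_iff)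
qed

end

section \<open>Schwartz functions and Fourier inversion at the origin\<close>

lemma schwartz_differentiable: "schwartz f \<Longrightarrow> f differentiable (at x)"
  unfolding schwartz_def by (auto dest: spec[of _ "[]"])

lemma schwartz_isCont: "schwartz f \<Longrightarrow> isCont f x"
  by (rule differentiable_imp_continuous_within[OF schwartz_differentiable])

lemma schwartz_measurable[simp]: "schwartz f \<Longrightarrow> f \<in> borel_measurable borel"
  by (intro borel_measurable_continuous_onI continuous_at_imp_continuous_on) (auto simp: schwartz_isCont)

lemma schwartz_partial:
  assumes "schwartz f" "b \<in> Basis"
  shows "schwartz (\<lambda>x. frechet_derivative f (at x) b)"
  unfolding schwartz_def
proof (intro allI impI)
  fix bs :: "'a list" assume "set bs \<subseteq> Basis"
  then have s: "set (b # bs) \<subseteq> Basis" using assms(2) by simp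
  have "\<And>cs. set cs \<subseteq> Basis \<Longrightarrow> (\<forall>x. iterated_partial cs f differentiable at x) \<and>
      (\<forall>n. bounded (range (\<lambda>x. norm x ^ n *\<^sub>R iterated_partial cs f x)))"
    using assms(1) unfolding schwartz_def by blast
  from this[OF s] show "(\<forall>x. iterated_partial bs (\<lambda>x. frechet_derivative f (at x) b) differentiable at x) \<and>
      (\<forall>n. bounded (range (\<lambda>x. norm x ^ n *\<^sub>R iterated_partial bs (\<lambda>x. frechet_derivative f (at x) b) x)))"
    by simp
qed

lemma schwartz_bound:
  assumes "schwartz f" shows "\<exists>C. \<forall>x. norm x ^ n * norm (f x) \<le> C"
proof -
  have "bounded (range (\<lambda>x. norm x ^ n *\<^sub>R f x))"
    using assms unfolding schwartz_def by (auto dest: spec[of _ "[]"])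
  then show ?thesis by (auto simp: bounded_iff)
qed

text \<open>A product, so that its integral factors into one-dimensional ones; it serves as common
  majorant for Schwartz functions, their transforms and their difference quotients.\<close>

definition decay :: "'a::euclidean_space \<Rightarrow> real" where
  "decay x = (\<Prod>b\<in>Basis. inverse (1 + (x \<bullet> b)\<^sup>2))"

lemma decay_pos: "0 < decay x"
  unfolding decay_def by (intro prod_pos) (auto intro: add_pos_nonneg)

lemma borel_measurable_decay[measurable]: "decay \<in> borel_measurable (borel :: 'a::euclidean_space measure)"
  unfolding decay_def[abs_def] by measurable

lemma integrable_decay: "integrable lborel (decay :: 'a::euclidean_space \<Rightarrow> real)"
proof (rule integrableI_nonneg)
  have "(\<integral>\<^sup>+x. ennreal (decay x) \<partial>(lborel :: 'a measure)) =
      (\<integral>\<^sup>+x. (\<Prod>b\<in>Basis. ennreal (inverse (1 + (x \<bullet> b)\<^sup>2))) \<partial>(lborel :: 'a measure))"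
    by (simp add: decay_def prod_ennreal)
  also have "\<dots> = (\<Prod>b\<in>(Basis :: 'a set). \<integral>\<^sup>+y. ennreal (inverse (1 + y\<^sup>2)) \<partial>lborel)"
    by (rule nn_integral_lborel_prod) auto
  also have "\<dots> < \<infinity>"
  proof -
    have "integrable lborel (\<lambda>y::real. inverse (1 + y\<^sup>2))"
      using integrable_inverse_1_plus_square by (simp add: set_integrable_def)
    then have "(\<integral>\<^sup>+y. ennreal (inverse (1 + y\<^sup>2)) \<partial>(lborel :: real measure)) = ennreal (LINT y|lborel. inverse (1 + y\<^sup>2))"
      by (rule nn_integral_eq_integral) simp
    then show ?thesis by (simp add: ennreal_power[symmetric] power_less_top_ennreal)
  qed
  finally show "(\<integral>\<^sup>+x. ennreal (decay x) \<partial>(lborel :: 'a measure)) < \<infinity>" .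
qed (auto simp: less_imp_le[OF decay_pos])

text \<open>Since 1 / \<open>decay x\<close> is at most (1 + |x|^2)^d \<le> 2^d (1 + |x|^(2d)), the
  Schwartz bounds with exponents 0 and 2d suffice.\<close>

lemma decay_bound:
  fixes f :: "'a::euclidean_space \<Rightarrow> complex"
  assumes "schwartz f" shows "\<exists>C\<ge>0. \<forall>x. norm (f x) \<le> C * decay x"
proof -
  let ?D = "DIM('a)"
  obtain C0 where C0: "\<And>x. norm x ^ 0 * norm (f x) \<le> C0" using schwartz_bound[OF assms, where n=0] by blast
  obtain C1 where C1: "\<And>x. norm x ^ (2 * ?D) * norm (f x) \<le> C1" using schwartz_bound[OF assms, where n="2 * ?D"] by blast
  have nn: "0 \<le> C0" "0 \<le> C1"
    using order_trans[OF _ C0[of 0]] order_trans[OF _ C1[of 0]] by auto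
  show ?thesis
  proof (intro exI conjI allI)
    show "0 \<le> 2 ^ ?D * (C0 + C1)" using nn by simp
    fix x :: 'a
    have "inverse (decay x) = (\<Prod>b\<in>Basis. 1 + (x \<bullet> b)\<^sup>2)"
      by (simp add: decay_def prod_inversef[symmetric] comp_def)
    also have "\<dots> \<le> (\<Prod>b\<in>(Basis :: 'a set). 1 + (norm x)\<^sup>2)"
      by (intro prod_mono) (auto simp: Basis_le_norm abs_le_square_iff[symmetric])
    also have "\<dots> = (1 + (norm x)\<^sup>2) ^ ?D" by simp
    also have "\<dots> \<le> (2 * max 1 ((norm x)\<^sup>2)) ^ ?D" by (intro power_mono) auto
    also have "\<dots> = 2 ^ ?D * (max 1 ((norm x)\<^sup>2)) ^ ?D" by (simp add: power_mult_distrib)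
    also have "(max 1 ((norm x)\<^sup>2)) ^ ?D \<le> 1 + norm x ^ (2 * ?D)" by (auto simp: max_def power_mult)
    finally have "inverse (decay x) * norm (f x) \<le> 2 ^ ?D * (1 + norm x ^ (2 * ?D)) * norm (f x)"
      by (intro mult_right_mono) auto
    also have "\<dots> = 2 ^ ?D * (norm x ^ 0 * norm (f x) + norm x ^ (2 * ?D) * norm (f x))"
      by (simp add: algebra_simps)
    also have "\<dots> \<le> 2 ^ ?D * (C0 + C1)" using C0[of x] C1[of x] by (intro mult_left_mono add_mono) auto
    finally show "norm (f x) \<le> 2 ^ ?D * (C0 + C1) * decay x"
      using decay_pos[of x] by (simp add: field_simps)
  qed
qed

lemma schwartz_integrable:
  fixes f :: "'a::euclidean_space \<Rightarrow> complex"
  assumes "schwartz f" shows "integrable lborel f"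
proof -
  obtain C where "C \<ge> 0" "\<And>x. norm (f x) \<le> C * decay x" using decay_bound[OF assms] by blast
  then show ?thesis
    using assms by (intro Bochner_Integration.integrable_bound[OF integrable_mult_right[OF integrable_decay, of C]])
      (auto intro: order_trans[OF _ abs_ge_self])
qed

text \<open>Only the factor of the coordinate \<open>b\<close> changes. From y^2 \<le> 2 (y + t)^2 +
  2 t^2 and |t| \<le> 1 follows 1 + y^2 \<le> 3 (1 + (y + t)^2), whence the 3.\<close>

lemma decay_shift:
  fixes x :: "'a::euclidean_space"
  assumes b: "b \<in> Basis" and t: "\<bar>t\<bar> \<le> 1"
  shows "decay (x + t *\<^sub>R b) \<le> 3 * decay x"
proof -
  have "decay (x + t *\<^sub>R b) = inverse (1 + ((x + t *\<^sub>R b) \<bullet> b)\<^sup>2) * (\<Prod>c\<in>Basis - {b}. inverse (1 + ((x + t *\<^sub>R b) \<bullet> c)\<^sup>2))"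
    unfolding decay_def by (rule prod.remove) (use b in auto)
  also have "(\<Prod>c\<in>Basis - {b}. inverse (1 + ((x + t *\<^sub>R b) \<bullet> c)\<^sup>2)) = (\<Prod>c\<in>Basis - {b}. inverse (1 + (x \<bullet> c)\<^sup>2))"
    by (intro prod.cong refl) (use b in \<open>auto simp: inner_add_left inner_Basis\<close>)
  also have "inverse (1 + ((x + t *\<^sub>R b) \<bullet> b)\<^sup>2) \<le> 3 * inverse (1 + (x \<bullet> b)\<^sup>2)"
  proof -
    define y where "y = x \<bullet> b"
    have t1: "t\<^sup>2 \<le> 1" using t by (simp add: abs_square_le_1)
    define z where "z = (y + t)\<^sup>2"
    have "y\<^sup>2 + (y + 2 * t)\<^sup>2 = 2 * z + 2 * t\<^sup>2" by (simp add: z_def power2_eq_square algebra_simps)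
    then have "y\<^sup>2 \<le> 2 * z + 2 * t\<^sup>2" using zero_le_power2[of "y + 2 * t"] by linarith
    moreover have "0 \<le> z" by (simp add: z_def)
    moreover have "1 + r \<le> 3 * (1 + z)" if "r \<le> 2 * z + 2 * s" "0 \<le> z" "s \<le> 1" for r s z :: real
      using that by (simp add: algebra_simps)
    ultimately have "1 + y\<^sup>2 \<le> 3 * (1 + z)" using t1 by blast
    then have "1 + y\<^sup>2 \<le> 3 * (1 + (y + t)\<^sup>2)" by (simp only: z_def)
    moreover have "(x + t *\<^sub>R b) \<bullet> b = y + t" using b by (simp add: inner_add_left y_def)
    moreover have "1 + y\<^sup>2 > 0" "1 + (y + t)\<^sup>2 > 0" by (auto intro: add_pos_nonneg)
    ultimately show ?thesis by (simp add: y_def[symmetric] field_simps)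
  qed
  then have "inverse (1 + ((x + t *\<^sub>R b) \<bullet> b)\<^sup>2) * (\<Prod>c\<in>Basis - {b}. inverse (1 + (x \<bullet> c)\<^sup>2)) \<le>
    3 * inverse (1 + (x \<bullet> b)\<^sup>2) * (\<Prod>c\<in>Basis - {b}. inverse (1 + (x \<bullet> c)\<^sup>2))"
    by (intro mult_right_mono prod_nonneg) auto
  also have "\<dots> = 3 * decay x"
    unfolding decay_def by (subst (2) prod.remove[of _ b]) (use b in auto)
  finally show ?thesis .
qed

text \<open>The derivative of the exponential at 0 along the steps 1/(n + 1); c = 0 is separate
  because the argument of the quotient must stay away from 0.\<close>

lemma cis_difference_quotient:
  "(\<lambda>n. (cis (c * (1 / real (Suc n))) - 1) / of_real (1 / real (Suc n))) \<longlonglongrightarrow> \<i> * of_real c"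
proof (cases "c = 0")
  case False
  define h where "h n = 1 / real (Suc n)" for n
  have h: "h \<longlonglongrightarrow> 0" unfolding h_def by (rule LIMSEQ_Suc[OF lim_1_over_n])
  have h0: "h n \<noteq> 0" for n by (simp add: h_def)
  have "(\<lambda>z::complex. (exp (0 + z) - exp 0) / z) \<midarrow>0\<rightarrow> 1"
    using DERIV_D[OF DERIV_exp, of "0 :: complex"] by simp
  moreover have "filterlim (\<lambda>n. \<i> * of_real (c * h n)) (at 0) sequentially"
    unfolding filterlim_at
  proof
    show "(\<lambda>n. \<i> * complex_of_real (c * h n)) \<longlonglongrightarrow> 0"
      using tendsto_mult[OF tendsto_const tendsto_of_real[OF tendsto_mult[OF tendsto_const h]], of \<i> c] by simp
  qed (use False h0 in auto)
  ultimately have "(\<lambda>n. (exp (0 + \<i> * of_real (c * h n)) - exp 0) / (\<i> * of_real (c * h n))) \<longlonglongrightarrow> 1"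
    by (rule filterlim_compose)
  then have "(\<lambda>n. \<i> * of_real c * ((exp (0 + \<i> * of_real (c * h n)) - exp 0) / (\<i> * of_real (c * h n)))) \<longlonglongrightarrow> \<i> * of_real c * 1"
    by (intro tendsto_intros)
  moreover have "\<i> * of_real c * ((exp (0 + \<i> * of_real (c * h n)) - exp 0) / (\<i> * of_real (c * h n))) =
      (cis (c * h n) - 1) / of_real (h n)" for n
    using False h0[of n] by (simp add: cis_conv_exp)
  ultimately show ?thesis by (simp add: h_def)
qed simp

text \<open>Instead of integrating by parts, the derivative is taken as the limit of difference
  quotients \<open>q n\<close>. Translation invariance gives their transforms as (e^(2 pi i y_b h) -
  1) / h times \<open>fourier f y\<close>, and a common majorant lets the limit pass under the
  integral.\<close>

lemma fourier_partial:
  fixes f :: "'a::euclidean_space \<Rightarrow> complex"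
  assumes f: "schwartz f" and b: "b \<in> Basis"
  shows "fourier (\<lambda>x. frechet_derivative f (at x) b) y = 2 * pi * \<i> * of_real (y \<bullet> b) * fourier f y"
proof -
  define d where "d x = frechet_derivative f (at x) b" for x
  define h where "h n = 1 / real (Suc n)" for n
  have h: "h \<longlonglongrightarrow> 0" unfolding h_def by (rule LIMSEQ_Suc[OF lim_1_over_n])
  have h0: "h n > 0" "h n \<le> 1" for n by (auto simp: h_def)
  have [measurable]: "f \<in> borel_measurable borel" using f by simp
  have sd: "schwartz d" unfolding d_def by (rule schwartz_partial[OF f b])
  have [measurable]: "d \<in> borel_measurable borel" using sd by simp
  obtain C where C: "C \<ge> 0" "\<And>x. norm (d x) \<le> C * decay x" using decay_bound[OF sd] by blast
  have deriv: "((\<lambda>s. f (x + s *\<^sub>R b)) has_derivative (\<lambda>u. u *\<^sub>R d (x + s *\<^sub>R b))) (at s)" for x s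
  proof -
    have F: "(f has_derivative frechet_derivative f (at (x + s *\<^sub>R b))) (at (x + s *\<^sub>R b))"
      using schwartz_differentiable[OF f] by (simp add: frechet_derivative_works)
    have "((\<lambda>s. x + s *\<^sub>R b) has_derivative (\<lambda>u. u *\<^sub>R b)) (at s)"
      by (auto intro!: derivative_eq_intros)
    from has_derivative_compose[OF this F]
    have "((\<lambda>s. f (x + s *\<^sub>R b)) has_derivative (\<lambda>u. frechet_derivative f (at (x + s *\<^sub>R b)) (u *\<^sub>R b))) (at s)" .
    moreover have "frechet_derivative f (at (x + s *\<^sub>R b)) (u *\<^sub>R b) = u *\<^sub>R d (x + s *\<^sub>R b)" for u
      unfolding d_def by (rule linear_cmul[OF has_derivative_linear[OF F]])
    ultimately show ?thesis by simp
  qed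
  define q where "q n x = (f (x + h n *\<^sub>R b) - f x) / of_real (h n)" for n x
  have [measurable]: "q n \<in> borel_measurable borel" for n unfolding q_def[abs_def] by measurable
  have q_lim: "(\<lambda>n. q n x) \<longlonglongrightarrow> d x" for x
  proof -
    have "((\<lambda>s. norm (f (x + (0 + s) *\<^sub>R b) - f (x + 0 *\<^sub>R b) - s *\<^sub>R d (x + 0 *\<^sub>R b)) / norm s) \<longlongrightarrow> 0) (at 0)"
      using deriv[of x 0] unfolding has_derivative_at by blast
    moreover have "eventually (\<lambda>s. norm (f (x + (0 + s) *\<^sub>R b) - f (x + 0 *\<^sub>R b) - s *\<^sub>R d (x + 0 *\<^sub>R b)) / norm s
        = norm ((f (x + s *\<^sub>R b) - f x) /\<^sub>R s - d x)) (at (0::real))"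
    proof (rule eventually_at_filter[THEN iffD2, OF always_eventually], intro allI impI)
      fix s :: real assume s: "s \<noteq> 0"
      have "(f (x + s *\<^sub>R b) - f x) /\<^sub>R s - d x = (f (x + s *\<^sub>R b) - f x - s *\<^sub>R d x) /\<^sub>R s"
        using s by (simp add: scaleR_diff_right)
      then show "norm (f (x + (0 + s) *\<^sub>R b) - f (x + 0 *\<^sub>R b) - s *\<^sub>R d (x + 0 *\<^sub>R b)) / norm s
        = norm ((f (x + s *\<^sub>R b) - f x) /\<^sub>R s - d x)" by (simp add: divide_inverse mult.commute)
    qed
    ultimately have "((\<lambda>s. norm ((f (x + s *\<^sub>R b) - f x) /\<^sub>R s - d x)) \<longlongrightarrow> 0) (at 0)"
      by (rule Lim_transform_eventually)
    then have "((\<lambda>s. (f (x + s *\<^sub>R b) - f x) /\<^sub>R s) \<longlongrightarrow> d x) (at 0)"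
      by (rule LIM_zero_cancel[OF tendsto_norm_zero_cancel])
    moreover have "filterlim h (at 0) sequentially"
      unfolding filterlim_at using h h0(1) by (auto simp: less_imp_neq[symmetric])
    ultimately have "(\<lambda>n. (f (x + h n *\<^sub>R b) - f x) /\<^sub>R h n) \<longlonglongrightarrow> d x"
      by (rule filterlim_compose)
    then show ?thesis by (simp add: q_def scaleR_conv_of_real divide_inverse mult.commute)
  qed
  \<comment> \<open>Mean value inequality on a segment of length \<open>h n \<le> 1\<close>, along
    which \<open>decay\<close> grows at most by the factor 3.\<close>
  have q_bd: "norm (q n x) \<le> 3 * C * decay x" for n x
  proof -
    have "norm (f (x + h n *\<^sub>R b) - f (x + 0 *\<^sub>R b)) \<le> (3 * C * decay x) * norm (h n - 0)"
    proof (rule differentiable_bound[of "{0..h n}"])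
      show "((\<lambda>s. f (x + s *\<^sub>R b)) has_derivative (\<lambda>u. u *\<^sub>R d (x + s *\<^sub>R b))) (at s within {0..h n})" for s
        using deriv by (rule has_derivative_at_withinI)
      fix s assume s: "s \<in> {0..h n}"
      have "norm (d (x + s *\<^sub>R b)) \<le> C * decay (x + s *\<^sub>R b)" by (rule C)
      also have "\<dots> \<le> C * (3 * decay x)"
        using C(1) s h0(2)[of n] by (intro mult_left_mono decay_shift b) auto
      finally have dB: "norm (d (x + s *\<^sub>R b)) \<le> 3 * C * decay x" by simp
      show "onorm (\<lambda>u. u *\<^sub>R d (x + s *\<^sub>R b)) \<le> 3 * C * decay x"
      proof (rule onorm_le)
        fix u :: real
        show "norm (u *\<^sub>R d (x + s *\<^sub>R b)) \<le> 3 * C * decay x * norm u"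
          using mult_left_mono[OF dB, of "\<bar>u\<bar>"] by (simp add: mult.commute)
      qed
    qed (use h0(1)[of n] in auto)
    then show ?thesis using h0(1)[of n] by (simp add: q_def norm_divide divide_le_eq)
  qed
  have Fq: "fourier (q n) y = (cis (2 * pi * (y \<bullet> b) * h n) - 1) / of_real (h n) * fourier f y" for n
  proof -
    let ?e = "\<lambda>x. cis (- 2 * pi * (x \<bullet> y))"
    have if1: "integrable lborel (\<lambda>x. f x * ?e x)"
      by (intro integrable_cis_mult schwartz_integrable f) measurable
    have if2: "integrable lborel (\<lambda>x. f (h n *\<^sub>R b + x) * ?e x)"
      using integrable_lborel_affine[OF schwartz_integrable[OF f], of 1 "h n *\<^sub>R b"]
      by (intro integrable_cis_mult) auto
    have "(LINT x|lborel. f (h n *\<^sub>R b + x) * ?e x) =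
        (LINT x|lborel. (\<lambda>z. cis (2 * pi * (y \<bullet> b) * h n) * (f z * ?e z)) (h n *\<^sub>R b + x))"
    proof (rule Bochner_Integration.integral_cong[OF refl])
      fix x
      have "?e x = cis (2 * pi * (y \<bullet> b) * h n) * ?e (h n *\<^sub>R b + x)"
        unfolding cis_mult by (rule arg_cong[where f=cis]) (simp add: inner_add_left inner_commute algebra_simps)
      then show "f (h n *\<^sub>R b + x) * ?e x = (\<lambda>z. cis (2 * pi * (y \<bullet> b) * h n) * (f z * ?e z)) (h n *\<^sub>R b + x)"
        by (simp only: mult_ac)
    qed
    also have "\<dots> = (LINT z|lborel. cis (2 * pi * (y \<bullet> b) * h n) * (f z * ?e z))"
      by (rule integral_lborel_translate) (unfold cis_conv_exp, measurable)
    also have "\<dots> = cis (2 * pi * (y \<bullet> b) * h n) * fourier f y" by (simp add: fourier_cis)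
    finally have s: "(LINT x|lborel. f (h n *\<^sub>R b + x) * ?e x) = cis (2 * pi * (y \<bullet> b) * h n) * fourier f y" .
    have "fourier (q n) y = (LINT x|lborel. (f (h n *\<^sub>R b + x) * ?e x - f x * ?e x) / of_real (h n))"
      unfolding fourier_cis q_def by (simp add: add.commute left_diff_distrib)
    also have "\<dots> = ((LINT x|lborel. f (h n *\<^sub>R b + x) * ?e x) - (LINT x|lborel. f x * ?e x)) / of_real (h n)"
      by (simp only: integral_divide_zero Bochner_Integration.integral_diff[OF if2 if1])
    also have "\<dots> = (cis (2 * pi * (y \<bullet> b) * h n) - 1) / of_real (h n) * fourier f y"
      unfolding s by (simp add: fourier_cis left_diff_distrib)
    finally show ?thesis .
  qed
  have "(\<lambda>n. fourier (q n) y) \<longlonglongrightarrow> fourier d y"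
    unfolding fourier_cis
  proof (rule integral_dominated_convergence[where w="\<lambda>x. 3 * C * decay x"])
    show "AE x in lborel. (\<lambda>n. q n x * cis (- 2 * pi * (x \<bullet> y))) \<longlonglongrightarrow> d x * cis (- 2 * pi * (x \<bullet> y))"
      by (intro AE_I2 tendsto_intros q_lim)
  qed (use sd in \<open>auto simp: norm_mult q_bd cis_conv_exp intro!: integrable_decay\<close>)
  moreover have "(\<lambda>n. fourier (q n) y) \<longlonglongrightarrow> \<i> * of_real (2 * pi * (y \<bullet> b)) * fourier f y"
    unfolding Fq h_def by (intro tendsto_mult cis_difference_quotient tendsto_const)
  ultimately have "fourier d y = \<i> * of_real (2 * pi * (y \<bullet> b)) * fourier f y"
    by (rule LIMSEQ_unique)
  then show ?thesis by (simp add: d_def[abs_def] mult_ac)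
qed

text \<open>Two derivatives in direction \<open>b\<close> multiply the transform by -(2 pi y_b)^2,
  and (2 pi)^2 \<ge> 1 may be dropped, so the bounds for \<open>f\<close> and for its second
  derivative add up to one with the factor 1 + y_b^2. The induction ranges over all Schwartz
  functions because it is applied to both.\<close>

lemma fourier_schwartz_decay_subset:
  fixes f :: "'a::euclidean_space \<Rightarrow> complex"
  assumes "finite B" "B \<subseteq> Basis" "schwartz f"
  shows "\<exists>C. \<forall>y. (\<Prod>b\<in>B. 1 + (y \<bullet> b)\<^sup>2) * norm (fourier f y) \<le> C"
  using assms
proof (induction B arbitrary: f rule: finite_induct)
  case empty
  then show ?case by (auto intro: norm_fourier_le)
next
  case (insert b B)
  let ?d = "\<lambda>f x. frechet_derivative f (at x) b"
  have b: "b \<in> Basis" and B: "B \<subseteq> Basis" using insert by auto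
  have sf: "schwartz f" using insert by simp
  have s1: "schwartz (?d f)" by (rule schwartz_partial[OF sf b])
  have s2: "schwartz (?d (?d f))" by (rule schwartz_partial[OF s1 b])
  obtain C1 where C1: "\<And>y. (\<Prod>b\<in>B. 1 + (y \<bullet> b)\<^sup>2) * norm (fourier f y) \<le> C1"
    using insert.IH[OF B sf] by auto
  obtain C2 where C2: "\<And>y. (\<Prod>b\<in>B. 1 + (y \<bullet> b)\<^sup>2) * norm (fourier (?d (?d f)) y) \<le> C2"
    using insert.IH[OF B s2] by auto
  show ?case
  proof (intro exI allI)
    fix y
    let ?P = "\<Prod>b\<in>B. 1 + (y \<bullet> b)\<^sup>2"
    have P: "?P \<ge> 0" by (intro prod_nonneg) auto
    have "norm (fourier (?d (?d f)) y) = (2 * pi)\<^sup>2 * ((y \<bullet> b)\<^sup>2 * norm (fourier f y))"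
      unfolding fourier_partial[OF s1 b] fourier_partial[OF sf b]
      by (simp add: norm_mult power2_eq_square)
    moreover have "1 \<le> (2 * pi)\<^sup>2" using pi_gt3 by (intro one_le_power) linarith
    then have "1 * ((y \<bullet> b)\<^sup>2 * norm (fourier f y)) \<le> (2 * pi)\<^sup>2 * ((y \<bullet> b)\<^sup>2 * norm (fourier f y))"
      by (intro mult_right_mono) auto
    ultimately have "(y \<bullet> b)\<^sup>2 * norm (fourier f y) \<le> norm (fourier (?d (?d f)) y)" by simp
    then have "?P * ((y \<bullet> b)\<^sup>2 * norm (fourier f y)) \<le> ?P * norm (fourier (?d (?d f)) y)"
      using P by (rule mult_left_mono)
    also have "\<dots> \<le> C2" by (rule C2)
    finally have "?P * ((y \<bullet> b)\<^sup>2 * norm (fourier f y)) \<le> C2" .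
    moreover have "(\<Prod>b\<in>insert b B. 1 + (y \<bullet> b)\<^sup>2) * norm (fourier f y) =
        ?P * norm (fourier f y) + ?P * ((y \<bullet> b)\<^sup>2 * norm (fourier f y))"
      using insert.hyps by (simp add: algebra_simps)
    ultimately show "(\<Prod>b\<in>insert b B. 1 + (y \<bullet> b)\<^sup>2) * norm (fourier f y) \<le> C1 + C2"
      using C1[of y] by linarith
  qed
qed

lemma integrable_fourier_schwartz:
  fixes f :: "'a::euclidean_space \<Rightarrow> complex"
  assumes f: "schwartz f" shows "integrable lborel (fourier f)"
proof -
  obtain C where C: "\<And>y. (\<Prod>b\<in>Basis. 1 + (y \<bullet> b)\<^sup>2) * norm (fourier f y) \<le> C"
    using fourier_schwartz_decay_subset[OF finite_Basis order_refl f] by auto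
  have le: "norm (fourier f y) \<le> C * decay y" for y
  proof -
    have "inverse (decay y) = (\<Prod>b\<in>Basis. 1 + (y \<bullet> b)\<^sup>2)"
      by (simp add: decay_def prod_inversef[symmetric] comp_def)
    then have P: "(\<Prod>b\<in>Basis. 1 + (y \<bullet> b)\<^sup>2) * decay y = 1"
      using decay_pos[of y] by (metis left_inverse less_irrefl)
    have "norm (fourier f y) = ((\<Prod>b\<in>Basis. 1 + (y \<bullet> b)\<^sup>2) * decay y) * norm (fourier f y)"
      unfolding P by simp
    also have "\<dots> = ((\<Prod>b\<in>Basis. 1 + (y \<bullet> b)\<^sup>2) * norm (fourier f y)) * decay y" by (simp only: mult_ac)
    also have "\<dots> \<le> C * decay y" using C decay_pos[of y] by (intro mult_right_mono) auto
    finally show ?thesis .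
  qed
  have [measurable]: "f \<in> borel_measurable borel" using f by simp
  show ?thesis
    by (rule Bochner_Integration.integrable_bound[OF integrable_mult_right[OF integrable_decay, of C]])
      (use le in \<open>auto intro: order_trans[OF _ abs_ge_self]\<close>)
qed

text \<open>Smoothed inversion at 0 as the damping disappears: the left side converges by
  integrability of \<open>fourier f\<close>, the right side by continuity and boundedness of
  \<open>f\<close>.\<close>

lemma integral_fourier_schwartz:
  fixes f :: "'a::euclidean_space \<Rightarrow> complex"
  assumes f: "schwartz f" shows "(LINT y|lborel. fourier f y) = f 0"
proof -
  define \<epsilon> where "\<epsilon> n = 1 / real (Suc n)" for n
  have \<epsilon>0: "\<epsilon> n > 0" for n by (simp add: \<epsilon>_def)
  have \<epsilon>_lim: "\<epsilon> \<longlonglongrightarrow> 0" unfolding \<epsilon>_def[abs_def] by (rule LIMSEQ_Suc[OF lim_1_over_n])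
  have [measurable]: "f \<in> borel_measurable borel" using f by simp
  obtain C where C: "\<And>x. norm x ^ 0 * norm (f x) \<le> C" using schwartz_bound[OF f, where n=0] by blast
  have "(\<lambda>n. LINT y|lborel. fourier f y * cis (2 * pi * (0 \<bullet> y)) * of_real (exp (- (norm (\<epsilon> n *\<^sub>R y))\<^sup>2 / 2)))
      \<longlonglongrightarrow> (LINT y|lborel. fourier f y)"
  proof (rule integral_dominated_convergence[where w="\<lambda>y. norm (fourier f y)"])
    show "AE y in lborel. (\<lambda>n. fourier f y * cis (2 * pi * (0 \<bullet> y)) * of_real (exp (- (norm (\<epsilon> n *\<^sub>R y))\<^sup>2 / 2)))
      \<longlonglongrightarrow> fourier f y"
    proof (rule AE_I2)
      fix y
      have "(\<lambda>n. fourier f y * cis (2 * pi * (0 \<bullet> y)) * of_real (exp (- (norm (\<epsilon> n *\<^sub>R y))\<^sup>2 / 2)))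
        \<longlonglongrightarrow> fourier f y * cis (2 * pi * (0 \<bullet> y)) * of_real (exp (- (norm ((0::real) *\<^sub>R y))\<^sup>2 / 2))"
        by (intro tendsto_intros \<epsilon>_lim) simp
      then show "(\<lambda>n. fourier f y * cis (2 * pi * (0 \<bullet> y)) * of_real (exp (- (norm (\<epsilon> n *\<^sub>R y))\<^sup>2 / 2)))
        \<longlonglongrightarrow> fourier f y" by simp
    qed
  qed (use f in \<open>auto simp: norm_mult mult_left_le intro!: integrable_norm integrable_fourier_schwartz\<close>)
  moreover have "(\<lambda>n. LINT u|lborel. f (0 + (\<epsilon> n / (2 * pi)) *\<^sub>R u) * of_real (gauss u))
      \<longlonglongrightarrow> (LINT u|lborel. f 0 * of_real (gauss (u :: 'a)))"
  proof (rule integral_dominated_convergence[where w="\<lambda>u. C * gauss u"])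
    have "(\<lambda>n. f (0 + (\<epsilon> n / (2 * pi)) *\<^sub>R u) * of_real (gauss u)) \<longlonglongrightarrow> f 0 * of_real (gauss u)" for u :: 'a
    proof (intro tendsto_intros isCont_tendsto_compose[OF schwartz_isCont[OF f]])
      have "(\<lambda>n. 0 + (\<epsilon> n / (2 * pi)) *\<^sub>R u) \<longlonglongrightarrow> 0 + (0 / (2 * pi)) *\<^sub>R u"
        by (intro tendsto_intros \<epsilon>_lim) simp
      then show "(\<lambda>n. 0 + (\<epsilon> n / (2 * pi)) *\<^sub>R u) \<longlonglongrightarrow> 0" by simp
    qed
    then show "AE u in lborel. (\<lambda>n. f (0 + (\<epsilon> n / (2 * pi)) *\<^sub>R u) * of_real (gauss u)) \<longlonglongrightarrow> f 0 * of_real (gauss u)"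
      by simp
  qed (use C in \<open>auto simp: norm_mult gauss_nonneg integrable_gauss intro!: mult_right_mono\<close>)
  ultimately show ?thesis
    unfolding fourier_inversion_smoothed[OF schwartz_integrable[OF f] \<epsilon>0]
    using LIMSEQ_unique by (fastforce simp: integral_gauss)
qed

section \<open>Determinants of small Hermitian matrices\<close>

lemma det_mat_eq_sum:
  "Determinant.det (Matrix.mat k k (\<lambda>(i, j). f i j)) =
    (\<Sum>p | p permutes {0..<k}. signof p * (\<Prod>i = 0..<k. f i (p i)))"
proof -
  have "Determinant.det (Matrix.mat k k (\<lambda>(i, j). f i j)) =
      (\<Sum>p | p permutes {0..<k}. signof p * (\<Prod>i = 0..<k. Matrix.mat k k (\<lambda>(i, j). f i j) $$ (i, p i)))"
    by (rule det_def') simp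
  also have "\<dots> = (\<Sum>p | p permutes {0..<k}. signof p * (\<Prod>i = 0..<k. f i (p i)))"
  proof (intro sum.cong prod.cong refl arg_cong2[where f="(*)"])
    fix p i assume "p \<in> {p. p permutes {0..<k}}" "i \<in> {0..<k}"
    then have "p i \<in> {0..<k}" "i < k" using permutes_in_image[of p "{0..<k}" i] by auto
    then show "Matrix.mat k k (\<lambda>(i, j). f i j) $$ (i, p i) = f i (p i)" by simp
  qed
  finally show ?thesis .
qed

lemma norm_signof: "norm (signof p :: complex) = 1"
  by (simp add: sign_def)

text \<open>There are k! Leibniz terms, each of modulus at most 1.\<close>

lemma norm_det_le_fact:
  fixes f :: "nat \<Rightarrow> nat \<Rightarrow> complex"
  assumes "\<And>i j. norm (f i j) \<le> 1"
  shows "norm (Determinant.det (Matrix.mat k k (\<lambda>(i, j). f i j))) \<le> fact k"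
proof -
  have "norm (Determinant.det (Matrix.mat k k (\<lambda>(i, j). f i j))) \<le> (\<Sum>p | p permutes {0..<k}. 1)"
    unfolding det_mat_eq_sum
    by (rule sum_norm_le) (simp only: norm_mult norm_signof mult_1 prod_norm[symmetric], rule prod_le_1, simp add: assms)
  also have "\<dots> = fact k" by (simp add: card_permutations[of _ k])
  finally show ?thesis .
qed

lemma det_2: "Determinant.det (Matrix.mat 2 2 (\<lambda>(i, j). f i j)) = f 0 0 * f 1 1 - f 0 1 * f 1 0"
proof -
  have e: "{0..<2} = insert 0 {1 :: nat}" by auto
  have "finite {1 :: nat}" "0 \<notin> {1 :: nat}" by auto
  then show ?thesis unfolding det_mat_eq_sum e
    by (subst sum_over_permutations_insert) (simp_all add: sign_compose permutation_swap_id sign_swap_id)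
qed

lemma prod_le_two_factors:
  fixes g :: "'b \<Rightarrow> real"
  assumes "finite I" "a \<in> I" "c \<in> I" "a \<noteq> c" "\<And>i. 0 \<le> g i" "\<And>i. g i \<le> 1"
  shows "(\<Prod>i\<in>I. g i) \<le> g a * g c"
proof -
  have "(\<Prod>i\<in>I. g i) = g a * (g c * (\<Prod>i\<in>I - {a} - {c}. g i))"
    using assms by (subst prod.remove[of I a], simp, simp, subst prod.remove[of "I - {a}" c]) auto
  also have "(\<Prod>i\<in>I - {a} - {c}. g i) \<le> 1" by (rule prod_le_1) (use assms in auto)
  then have "g a * (g c * (\<Prod>i\<in>I - {a} - {c}. g i)) \<le> g a * (g c * 1)"
    by (intro mult_left_mono) (use assms in auto)
  finally show ?thesis by simp
qed

text \<open>Compare with the block-diagonal matrix. A permutation that does not preserve the blocks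
  picks up a factor from both off-diagonal blocks.\<close>

lemma det_4_near_block_product:
  fixes f :: "nat \<Rightarrow> nat \<Rightarrow> complex"
  assumes le1: "\<And>i j. norm (f i j) \<le> 1" and herm: "\<And>i j. norm (f j i) = norm (f i j)"
  shows "norm (Determinant.det (Matrix.mat 4 4 (\<lambda>(i, j). f i j)) -
      (f 0 0 * f 1 1 - f 0 1 * f 1 0) * (f 2 2 * f 3 3 - f 2 3 * f 3 2))
    \<le> 24 * ((norm (f 0 2))\<^sup>2 + (norm (f 0 3))\<^sup>2 + (norm (f 1 2))\<^sup>2 + (norm (f 1 3))\<^sup>2)"
    (is "_ \<le> 24 * ?S")
proof -
  define f' where "f' i j = (if (i < 2) = (j < 2) then f i j else 0)" for i j :: nat
  have block: "Matrix.mat 4 4 (\<lambda>(i, j). f' i j) = four_block_mat (Matrix.mat 2 2 (\<lambda>(i, j). f i j)) (0\<^sub>m 2 2)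
      (0\<^sub>m 2 2) (Matrix.mat 2 2 (\<lambda>(i, j). f (i + 2) (j + 2)))"
    by (rule eq_matI) (auto simp: f'_def four_block_mat_def Let_def not_less simp del: add_2_eq_Suc add_2_eq_Suc')
  have lower: "Determinant.det (Matrix.mat 2 2 (\<lambda>(i, j). f (i + 2) (j + 2))) = f 2 2 * f 3 3 - f 2 3 * f 3 2"
    using det_2[of "\<lambda>i j. f (i + 2) (j + 2)"]
    by (simp del: One_nat_def add_2_eq_Suc add_2_eq_Suc')
  have "Determinant.det (Matrix.mat 4 4 (\<lambda>(i, j). f' i j)) =
      (f 0 0 * f 1 1 - f 0 1 * f 1 0) * (f 2 2 * f 3 3 - f 2 3 * f 3 2)"
    unfolding block
    by (subst det_four_block_mat_upper_right_zero[of _ 2 _ 2])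
      (simp_all only: lower det_2, simp_all)
  moreover have "norm (Determinant.det (Matrix.mat 4 4 (\<lambda>(i, j). f i j)) - Determinant.det (Matrix.mat 4 4 (\<lambda>(i, j). f' i j)))
      \<le> (\<Sum>p | p permutes {0..<4::nat}. ?S)"
    unfolding det_mat_eq_sum sum_subtractf[symmetric] right_diff_distrib[symmetric]
  proof (rule sum_norm_le)
    fix p assume "p \<in> {p. p permutes {0..<4::nat}}"
    then have p: "p permutes {0..<4}" by simp
    have inj: "inj p" using p by (rule permutes_inj)
    have p4: "p i < 4" if "i < 4" for i using permutes_in_image[OF p, of i] that by simp
    have S0: "0 \<le> ?S" by simp
    have "norm ((\<Prod>i = 0..<4. f i (p i)) - (\<Prod>i = 0..<4. f' i (p i))) \<le> ?S"
    proof (cases "\<forall>i<4. (i < 2) = (p i < 2)")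
      case True
      then have "(\<Prod>i = 0..<4. f i (p i)) = (\<Prod>i = 0..<4. f' i (p i))"
        by (intro prod.cong) (auto simp: f'_def)
      then show ?thesis using S0 by simp
    next
      case False
      \<comment> \<open>An injective \<open>p\<close> that mapped {0, 1} into itself would preserve
        both blocks, so some index of the first block leaves it; by counting, some index of the
        second block enters the first.\<close>
      have a: "\<exists>a<2. 2 \<le> p a"
      proof (rule ccontr)
        assume n: "\<not> ?thesis"
        then have "p ` {0..<2} \<subseteq> {0..<2}" by auto
        then have "p ` {0..<2} = {0..<2}" by (intro endo_inj_surj) (auto intro: inj_on_subset[OF inj])
        then have "i < 2" if "p i < 2" for i
          using that inj by (metis (mono_tags) atLeastLessThan_iff image_iff inj_eq zero_le)
        then show False using False n by force
      qed
      have c: "\<exists>c. 2 \<le> c \<and> c < 4 \<and> p c < 2"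
      proof (rule ccontr)
        assume n: "\<not> ?thesis"
        then have "p ` {2..<4} \<subseteq> {2..<4}" using p4 by auto
        then have im: "p ` {2..<4} = {2..<4}" by (intro endo_inj_surj) (auto intro: inj_on_subset[OF inj])
        have "2 \<le> i" if i: "2 \<le> p i" "i < 4" for i
        proof -
          have "p i \<in> p ` {2..<4}" unfolding im using i p4 by simp
          then obtain j where "j \<in> {2..<4}" "p i = p j" by blast
          then show ?thesis using injD[OF inj] by auto
        qed
        then show False using a by force
      qed
      obtain a where a: "a < 2" "2 \<le> p a" using a by blast
      obtain c where c: "2 \<le> c" "c < 4" "p c < 2" using c by blast
      have a4: "a < 4" using a by simp
      have "(\<Prod>i = 0..<4. f' i (p i)) = 0"
        by (rule prod_zero[OF finite_atLeastLessThan bexI[of _ a]]) (use a a4 in \<open>auto simp: f'_def\<close>)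
      then have "norm ((\<Prod>i = 0..<4. f i (p i)) - (\<Prod>i = 0..<4. f' i (p i))) = (\<Prod>i = 0..<4. norm (f i (p i)))"
        by (simp only: diff_0_right prod_norm)
      also have "\<dots> \<le> norm (f a (p a)) * norm (f c (p c))"
        by (rule prod_le_two_factors) (use a a4 c le1 in auto)
      \<comment> \<open>The inequality of arithmetic and geometric means trades the product of two
        links for squares, each of which involves only one link between the pairs.\<close>
      also have "\<dots> \<le> ((norm (f a (p a)))\<^sup>2 + (norm (f c (p c)))\<^sup>2) / 2"
        using sum_squares_bound[of "norm (f a (p a))" "norm (f c (p c))"] by simp
      also have "\<dots> \<le> (?S + ?S) / 2"
      proof (intro divide_right_mono add_mono)
        have "a = 0 \<or> a = 1" "p a = 2 \<or> p a = 3" using a p4[OF a4] by auto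
        then show "(norm (f a (p a)))\<^sup>2 \<le> ?S" by auto
        \<comment> \<open>The entry at \<open>c\<close>, \<open>p c\<close> lies in the lower left
          block; \<open>herm\<close> moves it to the upper right block, over which \<open>?S\<close>
          is formed.\<close>
        have "c = 2 \<or> c = 3" "p c = 0 \<or> p c = 1" using c by auto
        then have "(norm (f (p c) c))\<^sup>2 \<le> ?S" by auto
        then show "(norm (f c (p c)))\<^sup>2 \<le> ?S" by (simp only: herm[of "p c" c])
      qed simp
      finally show ?thesis by simp
    qed
    then show "norm (signof p * ((\<Prod>i = 0..<4. f i (p i)) - (\<Prod>i = 0..<4. f' i (p i)))) \<le> ?S"
      by (simp only: norm_mult norm_signof mult_1)
  qed
  moreover have "card {p. p permutes {0..<4::nat}} = 24"
    by (subst card_permutations[of _ 4]) (auto simp: eval_nat_numeral fact_Suc)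
  ultimately show ?thesis by simp
qed

section \<open>Counting pairs of points\<close>

lemma positions_in_space: "positions k t \<in> space (\<Pi>\<^sub>M l\<in>{..<k}. (borel :: 'a::euclidean_space measure))"
  by (simp add: positions_def space_PiM)

lemma positions_apply: "l < k \<Longrightarrow> positions k t l = fst (t l)"
  by (simp add: positions_def)

abbreviation pos_set :: "nat \<Rightarrow> ((nat \<Rightarrow> 'a::euclidean_space) \<Rightarrow> bool) \<Rightarrow> (nat \<Rightarrow> 'a) set" where
  "pos_set k P \<equiv> {x \<in> space (\<Pi>\<^sub>M l\<in>{..<k}. borel). P x}"

lemma lessThan_small: "{..<2} = {0, 1 :: nat}" "{..<3} = {0, 1, 2 :: nat}" "{..<4} = {0, 1, 2, 3 :: nat}"
  by auto

text \<open>Here and in the analogues for three and four points, index functions become tuples, the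
  form in which coincidences between pairs are analysed.\<close>

lemma card_injections_2:
  "card {t \<in> {..<2} \<rightarrow>\<^sub>E I. inj_on t {..<2} \<and> R (t 0) (t (1::nat))} =
    card {(a, b). {a, b} \<subseteq> I \<and> a \<noteq> b \<and> R a b}"
  by (rule bij_betw_same_card[OF bij_betw_byWitness[where f="\<lambda>t. (t 0, t 1)" and
        f'="\<lambda>(a, b). \<lambda>l\<in>{..<2}. if l = 0 then a else b"]])
    (auto simp: PiE_iff extensional_def fun_eq_iff lessThan_small)

lemma card_injections_3:
  "card {t \<in> {..<3} \<rightarrow>\<^sub>E I. inj_on t {..<3} \<and> R (t 0) (t 1) (t (2::nat))} =
    card {(a, b, c). {a, b, c} \<subseteq> I \<and> distinct [a, b, c] \<and> R a b c}"
  by (rule bij_betw_same_card[OF bij_betw_byWitness[where f="\<lambda>t. (t 0, t 1, t 2)" and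
        f'="\<lambda>(a, b, c). \<lambda>l\<in>{..<3}. if l = 0 then a else if l = 1 then b else c"]])
    (auto simp: PiE_iff extensional_def fun_eq_iff lessThan_small)

lemma card_injections_4:
  "card {t \<in> {..<4} \<rightarrow>\<^sub>E I. inj_on t {..<4} \<and> R (t 0) (t 1) (t 2) (t (3::nat))} =
    card {(a, b, c, d). {a, b, c, d} \<subseteq> I \<and> distinct [a, b, c, d] \<and> R a b c d}"
  by (rule bij_betw_same_card[OF bij_betw_byWitness[where f="\<lambda>t. (t 0, t 1, t 2, t 3)" and
        f'="\<lambda>(a, b, c, d). \<lambda>l\<in>{..<4}. if l = 0 then a else if l = 1 then b else if l = 2 then c else d"]])
    (auto simp: PiE_iff extensional_def fun_eq_iff lessThan_small)

lemma card_index_tuples_1: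
  fixes N :: "'a::euclidean_space measure"
  shows "card {t \<in> index_tuples 1 N. positions 1 t \<in> pos_set 1 (\<lambda>x. P (x 0))} =
    card {a \<in> point_indices N. P (fst a)}"
  by (rule bij_betw_same_card[OF bij_betw_byWitness[where f="\<lambda>t. t 0" and f'="\<lambda>a. \<lambda>l\<in>{..<1}. a"]])
    (auto simp: index_tuples_def positions_in_space positions_apply PiE_iff extensional_def fun_eq_iff inj_on_def)

lemma card_index_tuples_2:
  fixes N :: "'a::euclidean_space measure"
  shows "card {t \<in> index_tuples 2 N. positions 2 t \<in> pos_set 2 (\<lambda>x. P (x 0) (x 1))} =
    card {(a, b). {a, b} \<subseteq> point_indices N \<and> a \<noteq> b \<and> P (fst a) (fst b)}"
  unfolding card_injections_2[symmetric]
  by (simp add: positions_in_space positions_apply index_tuples_def conj_assoc)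

lemma card_index_tuples_3:
  fixes N :: "'a::euclidean_space measure"
  shows "card {t \<in> index_tuples 3 N. positions 3 t \<in> pos_set 3 (\<lambda>x. P (x 0) (x 1) (x 2))} =
    card {(a, b, c). {a, b, c} \<subseteq> point_indices N \<and> distinct [a, b, c] \<and> P (fst a) (fst b) (fst c)}"
  unfolding card_injections_3[symmetric]
  by (simp add: positions_in_space positions_apply index_tuples_def conj_assoc)

lemma card_index_tuples_4:
  fixes N :: "'a::euclidean_space measure"
  shows "card {t \<in> index_tuples 4 N. positions 4 t \<in> pos_set 4 (\<lambda>x. P (x 0) (x 1) (x 2) (x 3))} =
    card {(a, b, c, d). {a, b, c, d} \<subseteq> point_indices N \<and> distinct [a, b, c, d] \<and>
      P (fst a) (fst b) (fst c) (fst d)}"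
  unfolding card_injections_4[symmetric]
  by (simp add: positions_in_space positions_apply index_tuples_def conj_assoc)

text \<open>The summands are the possible coincidences between two ordered pairs of distinct elements.\<close>

lemma card_pairs_squared_le:
  fixes P :: "'b \<Rightarrow> 'b \<Rightarrow> bool"
  assumes "finite J"
  defines "S \<equiv> {(a, b). {a, b} \<subseteq> J \<and> a \<noteq> b \<and> P a b}"
    and "T Q \<equiv> {(a, b, c). {a, b, c} \<subseteq> J \<and> distinct [a, b, c] \<and> Q a b c}"
  shows "(card S)\<^sup>2 \<le> card {(a, b, c, d). {a, b, c, d} \<subseteq> J \<and> distinct [a, b, c, d] \<and> P a b \<and> P c d}
     + card (T (\<lambda>a b c. P a b \<and> P a c)) + card (T (\<lambda>a b c. P a b \<and> P b c))
     + card (T (\<lambda>a b c. P a b \<and> P c a)) + card (T (\<lambda>a b c. P a b \<and> P c b)) + 2 * card S"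
proof -
  let ?S4 = "{(a, b, c, d). {a, b, c, d} \<subseteq> J \<and> distinct [a, b, c, d] \<and> P a b \<and> P c d}"
  have fS: "finite S" by (rule finite_subset[of _ "J \<times> J"]) (use assms(1) in \<open>auto simp: S_def\<close>)
  have fT: "finite (T Q)" for Q
    by (rule finite_subset[of _ "J \<times> J \<times> J"]) (use assms(1) in \<open>auto simp: T_def\<close>)
  have fS4: "finite ?S4"
    by (rule finite_subset[of _ "J \<times> J \<times> J \<times> J"]) (use assms(1) in auto)
  let ?f = "\<lambda>(a, b, c, d). ((a, b), (c, d))"
  let ?f1 = "\<lambda>(a, b, c). ((a, b), (a, c))" let ?T1 = "T (\<lambda>a b c. P a b \<and> P a c)"
  let ?f2 = "\<lambda>(a, b, c). ((a, b), (b, c))" let ?T2 = "T (\<lambda>a b c. P a b \<and> P b c)"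
  let ?f3 = "\<lambda>(a, b, c). ((a, b), (c, a))" let ?T3 = "T (\<lambda>a b c. P a b \<and> P c a)"
  let ?f4 = "\<lambda>(a, b, c). ((a, b), (c, b))" let ?T4 = "T (\<lambda>a b c. P a b \<and> P c b)"
  \<comment> \<open>Two pairs may consist of the same elements in the same or in the reverse order;
    each case accounts for one \<open>card S\<close>.\<close>
  let ?g1 = "\<lambda>(a, b). ((a, b), (a, b))" let ?g2 = "\<lambda>(a, b). ((a, b), (b, a))"
  have "S \<times> S \<subseteq> ?f ` ?S4 \<union> ?f1 ` ?T1 \<union> ?f2 ` ?T2 \<union> ?f3 ` ?T3 \<union> ?f4 ` ?T4 \<union> ?g1 ` S \<union> ?g2 ` S"
  proof
    fix z assume "z \<in> S \<times> S"
    then obtain a b c d where z: "z = ((a, b), (c, d))" and ab: "{a, b, c, d} \<subseteq> J" "a \<noteq> b" "c \<noteq> d" "P a b" "P c d"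
      by (auto simp: S_def)
    consider "distinct [a, b, c, d]" | "c = a" "d \<noteq> b" | "c = b" "d \<noteq> a" | "d = a" "c \<noteq> b" | "d = b" "c \<noteq> a"
      | "c = a" "d = b" | "c = b" "d = a"
      using ab by fastforce
    then show "z \<in> ?f ` ?S4 \<union> ?f1 ` ?T1 \<union> ?f2 ` ?T2 \<union> ?f3 ` ?T3 \<union> ?f4 ` ?T4 \<union> ?g1 ` S \<union> ?g2 ` S"
    proof cases
      case 1
      then have "z \<in> ?f ` ?S4" using ab by (intro image_eqI[of _ _ "(a, b, c, d)"]) (auto simp: z)
      then show ?thesis by blast
    next
      case 2
      then have "z \<in> ?f1 ` ?T1" using ab by (intro image_eqI[of _ _ "(a, b, d)"]) (auto simp: z T_def)
      then show ?thesis by blast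
    next
      case 3
      then have "z \<in> ?f2 ` ?T2" using ab by (intro image_eqI[of _ _ "(a, b, d)"]) (auto simp: z T_def)
      then show ?thesis by blast
    next
      case 4
      then have "z \<in> ?f3 ` ?T3" using ab by (intro image_eqI[of _ _ "(a, b, c)"]) (auto simp: z T_def)
      then show ?thesis by blast
    next
      case 5
      then have "z \<in> ?f4 ` ?T4" using ab by (intro image_eqI[of _ _ "(a, b, c)"]) (auto simp: z T_def)
      then show ?thesis by blast
    next
      case 6
      then have "z \<in> ?g1 ` S" using ab by (intro image_eqI[of _ _ "(a, b)"]) (auto simp: z S_def)
      then show ?thesis by blast
    next
      case 7
      then have "z \<in> ?g2 ` S" using ab by (intro image_eqI[of _ _ "(a, b)"]) (auto simp: z S_def)
      then show ?thesis by blast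
    qed
  qed
  then have "card (S \<times> S) \<le> card (?f ` ?S4 \<union> ?f1 ` ?T1 \<union> ?f2 ` ?T2 \<union> ?f3 ` ?T3 \<union> ?f4 ` ?T4 \<union> ?g1 ` S \<union> ?g2 ` S)"
    by (intro card_mono finite_UnI finite_imageI fS fT fS4)
  also have "\<dots> \<le> card ?S4 + card ?T1 + card ?T2 + card ?T3 + card ?T4 + card S + card S"
    by (intro order_trans[OF card_Un_le] add_mono card_image_le fS fT fS4)
  finally show ?thesis by (simp add: card_cartesian_product power2_eq_square)
qed

lemma card_squared_le:
  assumes "finite J"
  shows "(card J)\<^sup>2 = card {(a, b). {a, b} \<subseteq> J \<and> a \<noteq> b} + card J"
proof -
  have fin: "finite {(a, b). {a, b} \<subseteq> J \<and> a \<noteq> b}"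
    by (rule finite_subset[of _ "J \<times> J"]) (use assms in auto)
  have "J \<times> J = {(a, b). {a, b} \<subseteq> J \<and> a \<noteq> b} \<union> (\<lambda>a. (a, a)) ` J" by auto
  then have "card (J \<times> J) = card {(a, b). {a, b} \<subseteq> J \<and> a \<noteq> b} + card ((\<lambda>a. (a, a)) ` J)"
    using fin assms by (simp only:) (subst card_Un_disjoint, auto)
  then show ?thesis by (simp add: card_cartesian_product power2_eq_square card_image inj_on_def)
qed

section \<open>Integrals over configurations of few points\<close>

abbreviation lborels :: "nat set \<Rightarrow> (nat \<Rightarrow> 'a::euclidean_space) measure" where
  "lborels I \<equiv> \<Pi>\<^sub>M l\<in>I. lborel"

lemma nn_integral_lborels_1:
  fixes f :: "'a::euclidean_space \<Rightarrow> ennreal"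
  assumes "f \<in> borel_measurable borel"
  shows "(\<integral>\<^sup>+x. f (x p) \<partial>lborels {p}) = (\<integral>\<^sup>+a. f a \<partial>lborel)"
proof -
  interpret product_sigma_finite "\<lambda>_::nat. lborel :: 'a measure" by standard
  show ?thesis by (rule product_nn_integral_singleton) (use assms in simp)
qed

lemma nn_integral_lborels_2:
  fixes F :: "'a::euclidean_space \<Rightarrow> 'a \<Rightarrow> ennreal"
  assumes [measurable]: "(\<lambda>(a, b). F a b) \<in> borel_measurable (borel \<Otimes>\<^sub>M borel)" and pq: "p \<noteq> q"
  shows "(\<integral>\<^sup>+x. F (x p) (x q) \<partial>lborels {p, q}) = (\<integral>\<^sup>+a. \<integral>\<^sup>+b. F a b \<partial>lborel \<partial>lborel)"
proof -
  interpret product_sigma_finite "\<lambda>_::nat. lborel :: 'a measure" by standard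
  have "(\<integral>\<^sup>+x. F (x p) (x q) \<partial>lborels {p, q}) =
      (\<integral>\<^sup>+y. \<integral>\<^sup>+x. F ((x(p := y)) p) ((x(p := y)) q) \<partial>lborels {q} \<partial>lborel)"
    by (rule product_nn_integral_insert_rev) (use pq in \<open>auto, measurable\<close>)
  also have "\<dots> = (\<integral>\<^sup>+y. \<integral>\<^sup>+x. F y (x q) \<partial>lborels {q} \<partial>lborel)" using pq by simp
  also have "\<dots> = (\<integral>\<^sup>+a. \<integral>\<^sup>+b. F a b \<partial>lborel \<partial>lborel)"
    by (intro nn_integral_cong nn_integral_lborels_1) measurable
  finally show ?thesis .
qed

lemma nn_integral_lborels_3:
  fixes F :: "'a::euclidean_space \<Rightarrow> 'a \<Rightarrow> 'a \<Rightarrow> ennreal"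
  assumes [measurable]: "(\<lambda>(a, b, c). F a b c) \<in> borel_measurable (borel \<Otimes>\<^sub>M borel \<Otimes>\<^sub>M borel)"
    and d: "distinct [p, q, r]"
  shows "(\<integral>\<^sup>+x. F (x p) (x q) (x r) \<partial>lborels {p, q, r}) = (\<integral>\<^sup>+a. \<integral>\<^sup>+b. \<integral>\<^sup>+c. F a b c \<partial>lborel \<partial>lborel \<partial>lborel)"
proof -
  interpret product_sigma_finite "\<lambda>_::nat. lborel :: 'a measure" by standard
  have "(\<lambda>x. (\<lambda>(a, b, c). F a b c) (x p, x q, x r)) \<in> borel_measurable (lborels {p, q, r})"
    by measurable
  then have m: "(\<lambda>x. F (x p) (x q) (x r)) \<in> borel_measurable (lborels {p, q, r})" by simp
  have "(\<integral>\<^sup>+x. F (x p) (x q) (x r) \<partial>lborels {p, q, r}) =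
      (\<integral>\<^sup>+y. \<integral>\<^sup>+x. F ((x(p := y)) p) ((x(p := y)) q) ((x(p := y)) r) \<partial>lborels {q, r} \<partial>lborel)"
    by (rule product_nn_integral_insert_rev[OF _ _ m]) (use d in auto)
  also have "\<dots> = (\<integral>\<^sup>+y. \<integral>\<^sup>+x. F y (x q) (x r) \<partial>lborels {q, r} \<partial>lborel)" using d by simp
  also have "\<dots> = (\<integral>\<^sup>+a. \<integral>\<^sup>+b. \<integral>\<^sup>+c. F a b c \<partial>lborel \<partial>lborel \<partial>lborel)"
    by (intro nn_integral_cong nn_integral_lborels_2) (use d in \<open>auto, measurable\<close>)
  finally show ?thesis .
qed

lemma nn_integral_lborels_4:
  fixes F :: "'a::euclidean_space \<Rightarrow> 'a \<Rightarrow> 'a \<Rightarrow> 'a \<Rightarrow> ennreal"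
  assumes [measurable]: "(\<lambda>(a, b, c, d). F a b c d) \<in> borel_measurable (borel \<Otimes>\<^sub>M borel \<Otimes>\<^sub>M borel \<Otimes>\<^sub>M borel)"
    and d: "distinct [p, q, r, s]"
  shows "(\<integral>\<^sup>+x. F (x p) (x q) (x r) (x s) \<partial>lborels {p, q, r, s}) =
    (\<integral>\<^sup>+a. \<integral>\<^sup>+b. \<integral>\<^sup>+c. \<integral>\<^sup>+d. F a b c d \<partial>lborel \<partial>lborel \<partial>lborel \<partial>lborel)"
proof -
  interpret product_sigma_finite "\<lambda>_::nat. lborel :: 'a measure" by standard
  have "(\<lambda>x. (\<lambda>(a, b, c, d). F a b c d) (x p, x q, x r, x s)) \<in> borel_measurable (lborels {p, q, r, s})"
    by measurable
  then have m: "(\<lambda>x. F (x p) (x q) (x r) (x s)) \<in> borel_measurable (lborels {p, q, r, s})" by simp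
  have "(\<integral>\<^sup>+x. F (x p) (x q) (x r) (x s) \<partial>lborels {p, q, r, s}) =
      (\<integral>\<^sup>+y. \<integral>\<^sup>+x. F ((x(p := y)) p) ((x(p := y)) q) ((x(p := y)) r) ((x(p := y)) s) \<partial>lborels {q, r, s} \<partial>lborel)"
    by (rule product_nn_integral_insert_rev[OF _ _ m]) (use d in auto)
  also have "\<dots> = (\<integral>\<^sup>+y. \<integral>\<^sup>+x. F y (x q) (x r) (x s) \<partial>lborels {q, r, s} \<partial>lborel)" using d by simp
  also have "\<dots> = (\<integral>\<^sup>+a. \<integral>\<^sup>+b. \<integral>\<^sup>+c. \<integral>\<^sup>+d. F a b c d \<partial>lborel \<partial>lborel \<partial>lborel \<partial>lborel)"
    by (intro nn_integral_cong nn_integral_lborels_3) (use d in \<open>auto, measurable\<close>)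
  finally show ?thesis .
qed

text \<open>A star with centre \<open>p\<close>: the leaves \<open>q\<close> and \<open>r\<close>
  are integrated out first, and reflection invariance leaves the full integrals of \<open>h1\<close>
  and \<open>h2\<close>. This evaluates two pairs that share a point.\<close>

lemma nn_integral_star_3:
  fixes u h1 h2 :: "'a::euclidean_space \<Rightarrow> ennreal"
  assumes [measurable]: "u \<in> borel_measurable borel" "h1 \<in> borel_measurable borel" "h2 \<in> borel_measurable borel"
    and d: "distinct [p, q, r]"
  shows "(\<integral>\<^sup>+x. u (x p) * h1 (x p - x q) * h2 (x p - x r) \<partial>lborels {p, q, r}) =
    integral\<^sup>N lborel u * integral\<^sup>N lborel h1 * integral\<^sup>N lborel h2"
  by (subst nn_integral_lborels_3[OF _ d, of "\<lambda>a b c. u a * h1 (a - b) * h2 (a - c)"])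
    (simp_all add: nn_integral_cmult nn_integral_multc nn_integral_lborel_reflect mult_ac)

text \<open>A chain q - p - r - s, whose other points are integrated out before \<open>p\<close>.
  The middle link \<open>h2\<close> will be |K|^2, joining two pairs.\<close>

lemma nn_integral_chain_4:
  fixes u h1 h2 h3 :: "'a::euclidean_space \<Rightarrow> ennreal"
  assumes [measurable]: "u \<in> borel_measurable borel" "h1 \<in> borel_measurable borel" "h2 \<in> borel_measurable borel"
      "h3 \<in> borel_measurable borel"
    and d: "distinct [p, q, r, s]"
  shows "(\<integral>\<^sup>+x. u (x p) * h1 (x p - x q) * h2 (x p - x r) * h3 (x r - x s) \<partial>lborels {p, q, r, s}) =
    integral\<^sup>N lborel u * integral\<^sup>N lborel h1 * integral\<^sup>N lborel h2 * integral\<^sup>N lborel h3"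
  by (subst nn_integral_lborels_4[OF _ d, of "\<lambda>a b c d. u a * h1 (a - b) * h2 (a - c) * h3 (c - d)"])
    (simp_all add: nn_integral_cmult nn_integral_multc nn_integral_lborel_reflect mult_ac)

text \<open>Without a link the two pairs separate under the product measure. For \<open>r\<close>
  restricted to \<open>near\<close> this gives the square of the mean.\<close>

lemma nn_integral_pair_product_4:
  fixes G :: "'a::euclidean_space \<Rightarrow> 'a \<Rightarrow> ennreal"
  assumes [measurable]: "(\<lambda>(a, b). G a b) \<in> borel_measurable (borel \<Otimes>\<^sub>M borel)"
  shows "(\<integral>\<^sup>+x. G (x 0) (x 1) * G (x 2) (x 3) \<partial>lborels {..<4}) = (\<integral>\<^sup>+x. G (x 0) (x 1) \<partial>lborels {..<2})\<^sup>2"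
  unfolding lessThan_small
  by (subst nn_integral_lborels_4[of "\<lambda>a b c d. G a b * G c d"])
    (simp_all add: nn_integral_lborels_2 nn_integral_cmult nn_integral_multc power2_eq_square)

section \<open>Moments of a translation-invariant determinantal process\<close>

locale determinantal_process = bounded_density \<phi> + prob_space M
  for \<phi> :: "'a::euclidean_space \<Rightarrow> real" and M :: "'w measure" +
  fixes \<omega> :: "'w \<Rightarrow> 'a measure" and vol :: "nat \<Rightarrow> ennreal"
  assumes vol_def: "\<And>n. vol n = emeasure lborel (ball (0::'a) (real n))"
    and det: "determinantal M \<omega> (\<lambda>x y. K (x - y))"
begin

lemma measurable_\<omega>: "\<omega> \<in> measurable M counting_measure_space"
  using det by (simp add: determinantal_def point_process_def)

lemma counting: "w \<in> space M \<Longrightarrow> \<omega> w \<in> counting_measures"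
  using measurable_space[OF measurable_\<omega>] by (simp add: space_counting_measure_space)

definition det_K :: "nat \<Rightarrow> (nat \<Rightarrow> 'a) \<Rightarrow> complex" where
  "det_K k x = Determinant.det (Matrix.mat k k (\<lambda>(i, j). K (x i - x j)))"

lemma norm_K_commute: "norm (K (x - y)) = norm (K (y - x))"
  using K_uminus[of "x - y"] by simp

lemma Re_det_K_1: "Re (det_K 1 x) = 1"
  unfolding det_K_def by (subst det_single) (auto simp: K_0)

text \<open>In the difference variable, both the two-point correlation function and the density of
  the autocorrelation.\<close>

definition r :: "'a \<Rightarrow> real" where "r x = 1 - (cmod (K x))\<^sup>2"

lemma measurable_r[measurable]: "r \<in> borel_measurable borel"
  unfolding r_def[abs_def] by measurable

lemma r_nonneg: "0 \<le> r x" and r_le1: "r x \<le> 1"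
  using norm_K_le1[of x] by (auto simp: r_def power_le_one)

lemma K_mult_K_uminus: "K (x - y) * K (y - x) = of_real ((cmod (K (x - y)))\<^sup>2)"
  using K_uminus[of "x - y"] by (simp only: minus_diff_eq complex_norm_square)

lemma Re_det_K_2: "Re (det_K 2 x) = r (x 0 - x 1)"
  unfolding det_K_def det_2[of "\<lambda>i j. K (x i - x j)"]
  by (simp only: K_mult_K_uminus) (simp add: K_0 r_def)

lemma Re_det_K_3: "Re (det_K 3 x) \<le> 6"
proof -
  have "norm (det_K 3 x) \<le> fact 3"
    unfolding det_K_def by (rule norm_det_le_fact) (rule norm_K_le1)
  also have "(fact 3 :: real) = 6" by (simp add: fact_numeral)
  finally show ?thesis using complex_Re_le_cmod order_trans by blast
qed

text \<open>\<open>K 0 = 1\<close> and Hermitian symmetry turn the two block determinants into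
  values of \<open>r\<close>.\<close>

lemma Re_det_K_4: "Re (det_K 4 x) \<le> r (x 0 - x 1) * r (x 2 - x 3) +
  24 * ((cmod (K (x 0 - x 2)))\<^sup>2 + (cmod (K (x 0 - x 3)))\<^sup>2 + (cmod (K (x 1 - x 2)))\<^sup>2 + (cmod (K (x 1 - x 3)))\<^sup>2)"
  (is "_ \<le> _ + ?S")
proof -
  have "norm (det_K 4 x - of_real (r (x 0 - x 1) * r (x 2 - x 3))) \<le> ?S"
    using det_4_near_block_product[of "\<lambda>i j. K (x i - x j)", OF norm_K_le1 norm_K_commute]
    unfolding det_K_def K_mult_K_uminus by (simp add: K_0 r_def)
  then have "Re (det_K 4 x - of_real (r (x 0 - x 1) * r (x 2 - x 3))) \<le> ?S"
    using complex_Re_le_cmod order_trans by blast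
  then show ?thesis by simp
qed

section \<open>Expected counts as integrals of determinants\<close>

lemma ball_in_borel[measurable]: "ball (0::'a) d \<in> sets borel"
  by simp

lemma measurable_lborels_component:
  "p \<in> I \<Longrightarrow> (\<lambda>x. x p) \<in> borel_measurable (lborels I :: (nat \<Rightarrow> 'a) measure)"
  using measurable_component_singleton[of p I "\<lambda>_. lborel :: 'a measure"] by simp

lemma sets_lborels: "sets (lborels I) = sets (\<Pi>\<^sub>M l\<in>I. (borel :: 'a measure))"
  by (intro sets_PiM_cong) auto

text \<open>The determinant agrees with the real density \<open>\<rho>\<close> almost everywhere, so
  its real part may stand for \<open>\<rho>\<close> under the integral. This removes the choice of
  \<open>\<rho>\<close> from all later estimates.\<close>

lemma expected_count:
  assumes k: "k \<ge> 1" and C: "C \<in> sets (\<Pi>\<^sub>M l\<in>{..<k}. (borel :: 'a measure))"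
  shows "(\<integral>\<^sup>+w. emeasure (factorial_power k (\<omega> w)) C \<partial>M) =
    (\<integral>\<^sup>+x. ennreal (Re (det_K k x)) * indicator C x \<partial>lborels {..<k})"
proof -
  obtain \<rho> where \<rho>: "correlation_function M \<omega> k \<rho>"
    and ae: "AE x in lborels {..<k}. complex_of_real (\<rho> x) = det_K k x"
    using det k unfolding determinantal_def det_K_def by blast
  have "(\<integral>\<^sup>+w. emeasure (factorial_power k (\<omega> w)) C \<partial>M) =
      emeasure (density (lborels {..<k}) (\<lambda>x. ennreal (\<rho> x))) C"
    using \<rho> C by (simp add: correlation_function_def factorial_moment_def)
  also have "\<dots> = (\<integral>\<^sup>+x. ennreal (\<rho> x) * indicator C x \<partial>lborels {..<k})"
    using \<rho> C by (intro emeasure_density) (auto simp: correlation_function_def sets_lborels)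
  also have "\<dots> = (\<integral>\<^sup>+x. ennreal (Re (det_K k x)) * indicator C x \<partial>lborels {..<k})"
    using ae by (intro nn_integral_cong_AE) (auto elim!: eventually_mono, metis Re_complex_of_real)
  finally show ?thesis .
qed

lemma expected_count_le:
  assumes "k \<ge> 1" "C \<in> sets (\<Pi>\<^sub>M l\<in>{..<k}. (borel :: 'a measure))"
    and "\<And>x. x \<in> C \<Longrightarrow> ennreal (Re (det_K k x)) \<le> F x"
  shows "(\<integral>\<^sup>+w. emeasure (factorial_power k (\<omega> w)) C \<partial>M) \<le> (\<integral>\<^sup>+x. F x * indicator C x \<partial>lborels {..<k})"
  unfolding expected_count[OF assms(1,2)]
  by (rule nn_integral_mono) (use assms(3) in \<open>auto simp: indicator_def\<close>)

section \<open>Moment bounds for pairs with difference in a fixed bounded set\<close>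

abbreviation volA :: "'a set \<Rightarrow> ennreal" where "volA A \<equiv> emeasure lborel A"

text \<open>Both points are confined to the ball, as in the autocorrelation of the restricted
  measure; this makes the counts increase with n.\<close>

definition near :: "'a set \<Rightarrow> nat \<Rightarrow> 'a \<Rightarrow> 'a \<Rightarrow> bool" where
  "near A n a b \<longleftrightarrow> a \<in> ball 0 (real n) \<and> b \<in> ball 0 (real n) \<and> a - b \<in> A"

text \<open>Pairs are ordered, and distinct as indices: copies of a multiple point are counted when
  \<open>0 \<in> A\<close>.\<close>

definition pair_count :: "'a set \<Rightarrow> nat \<Rightarrow> 'w \<Rightarrow> real" where
  "pair_count A n w = card {(i, j). {i, j} \<subseteq> point_indices (\<omega> w) \<and> i \<noteq> j \<and> near A n (fst i) (fst j)}"

definition point_count :: "nat \<Rightarrow> 'w \<Rightarrow> real" where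
  "point_count n w = card {i \<in> point_indices (\<omega> w). fst i \<in> ball 0 (real n)}"

context
  fixes A :: "'a set"
  assumes A[measurable]: "A \<in> sets borel" and A_bdd: "bounded A"
begin

lemma measurable_near_2 [measurable]:
  "pos_set 2 (\<lambda>x. near A n (x 0) (x 1)) \<in> sets (\<Pi>\<^sub>M l\<in>{..<2}. borel)"
  unfolding near_def mem_ball by measurable

lemma measurable_near_4 [measurable]:
  "pos_set 4 (\<lambda>x. near A n (x 0) (x 1) \<and> near A n (x 2) (x 3)) \<in> sets (\<Pi>\<^sub>M l\<in>{..<4}. borel)"
  unfolding near_def mem_ball by measurable

lemma pair_count_eq:
  assumes w: "w \<in> space M"
  shows "ennreal (pair_count A n w) = emeasure (factorial_power 2 (\<omega> w)) (pos_set 2 (\<lambda>x. near A n (x 0) (x 1)))"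
proof -
  have "emeasure (factorial_power 2 (\<omega> w)) (pos_set 2 (\<lambda>x. near A n (x 0) (x 1))) =
      card {t \<in> index_tuples 2 (\<omega> w). positions 2 t \<in> pos_set 2 (\<lambda>x. near A n (x 0) (x 1))}"
    by (rule emeasure_factorial_power_card(2)[OF counting[OF w] measurable_near_2 bounded_ball[of 0 "real n"]])
      (auto simp: near_def lessThan_small less_2_cases_iff)
  then show ?thesis
    unfolding pair_count_def card_index_tuples_2 by (simp add: ennreal_of_nat_eq_real_of_nat)
qed

lemma measurable_pair_count [measurable]: "pair_count A n \<in> borel_measurable M"
proof -
  have [measurable]: "(\<lambda>w. emeasure (factorial_power 2 (\<omega> w)) (pos_set 2 (\<lambda>x. near A n (x 0) (x 1)))) \<in> borel_measurable M"
    by (rule measurable_emeasure_factorial_power[OF measurable_\<omega> measurable_near_2])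
  have "(\<lambda>w. enn2real (emeasure (factorial_power 2 (\<omega> w)) (pos_set 2 (\<lambda>x. near A n (x 0) (x 1))))) \<in> borel_measurable M"
    by measurable
  moreover have "enn2real (emeasure (factorial_power 2 (\<omega> w)) (pos_set 2 (\<lambda>x. near A n (x 0) (x 1)))) = pair_count A n w"
    if "w \<in> space M" for w
    unfolding pair_count_eq[OF that, symmetric] by (simp add: pair_count_def)
  ultimately show ?thesis by (simp cong: measurable_cong)
qed

definition pair_mean :: "nat \<Rightarrow> ennreal" where
  "pair_mean n = (\<integral>\<^sup>+w. pair_count A n w \<partial>M)"

lemma pair_mean_eq:
  "pair_mean n = (\<integral>\<^sup>+x. ennreal (r (x 0 - x 1)) * indicator {(a, b). near A n a b} (x 0, x 1) \<partial>lborels {..<2})"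
proof -
  have "pair_mean n = (\<integral>\<^sup>+w. emeasure (factorial_power 2 (\<omega> w)) (pos_set 2 (\<lambda>x. near A n (x 0) (x 1))) \<partial>M)"
    unfolding pair_mean_def by (intro nn_integral_cong pair_count_eq)
  also have "\<dots> = (\<integral>\<^sup>+x. ennreal (Re (det_K 2 x)) * indicator (pos_set 2 (\<lambda>x. near A n (x 0) (x 1))) x \<partial>lborels {..<2})"
    by (rule expected_count[OF _ measurable_near_2]) simp
  also have "\<dots> = (\<integral>\<^sup>+x. ennreal (r (x 0 - x 1)) * indicator {(a, b). near A n a b} (x 0, x 1) \<partial>lborels {..<2})"
    by (rule nn_integral_cong) (auto simp: Re_det_K_2 indicator_def space_PiM)
  finally show ?thesis .
qed

lemma measurable_near_pair[measurable]: "{(a, b). near A n a b} \<in> sets (borel \<Otimes>\<^sub>M borel)"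
proof -
  have "{z \<in> space (borel \<Otimes>\<^sub>M borel). near A n (fst z) (snd z)} \<in> sets (borel \<Otimes>\<^sub>M borel)"
    unfolding near_def mem_ball by measurable
  then show ?thesis by (simp add: space_pair_measure split_beta')
qed

lemma pair_mean_iterated:
  "pair_mean n = (\<integral>\<^sup>+a. \<integral>\<^sup>+b. ennreal (r (a - b)) * indicator {(a, b). near A n a b} (a, b) \<partial>lborel \<partial>lborel)"
  unfolding pair_mean_eq lessThan_small by (rule nn_integral_lborels_2) auto

text \<open>Drop the ball for the second point and bound \<open>r\<close> by 1.\<close>

lemma pair_mean_le: "pair_mean n \<le> vol n * volA A"
proof -
  have "pair_mean n \<le> (\<integral>\<^sup>+a. \<integral>\<^sup>+b. indicator (ball 0 (real n)) a * indicator A (a - b) \<partial>lborel \<partial>lborel)"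
    unfolding pair_mean_iterated
    by (intro nn_integral_mono) (auto simp: indicator_def near_def r_le1 ennreal_le_1)
  also have "\<dots> = vol n * volA A"
    by (simp add: nn_integral_cmult nn_integral_lborel_reflect[of "indicator A"]) (simp add: vol_def nn_integral_multc)
  finally show ?thesis .
qed

lemma volA_reflect: "(\<integral>\<^sup>+x. indicator A (- x) \<partial>lborel) = volA A"
  using nn_integral_lborel_reflect[of "indicator A" 0] by simp

text \<open>\<open>p\<close> is the point shared by two pairs; \<open>h1\<close> or
  \<open>h2\<close> is the reflected indicator when \<open>p\<close> is the second entry of the
  corresponding pair. The 6 is the bound on the three-point determinant.\<close>

lemma triple_bound:
  fixes h1 h2 :: "'a \<Rightarrow> ennreal"
  assumes pqr: "distinct [p, q, s]" "{..<3} = {p, q, s}" and hh: "h1 \<in> {indicator A, \<lambda>x. indicator A (- x)}"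
    "h2 \<in> {indicator A, \<lambda>x. indicator A (- x)}"
    and C: "C \<in> sets (\<Pi>\<^sub>M l\<in>{..<3}. borel)"
    and CI: "\<And>x. x \<in> C \<Longrightarrow> x p \<in> ball 0 (real n) \<and> h1 (x p - x q) = 1 \<and> h2 (x p - x s) = 1"
  shows "(\<integral>\<^sup>+w. emeasure (factorial_power 3 (\<omega> w)) C \<partial>M) \<le> 6 * (vol n * volA A * volA A)"
proof -
  have [measurable]: "h1 \<in> borel_measurable borel" "h2 \<in> borel_measurable borel" using hh by auto
  have hi: "integral\<^sup>N lborel h1 = volA A" "integral\<^sup>N lborel h2 = volA A"
    using hh volA_reflect by auto
  have [measurable]: "(\<lambda>x. x p) \<in> borel_measurable (lborels {p, q, s})"
      "(\<lambda>x. x q) \<in> borel_measurable (lborels {p, q, s})" "(\<lambda>x. x s) \<in> borel_measurable (lborels {p, q, s})"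
    by (auto intro: measurable_lborels_component)
  have "(\<integral>\<^sup>+w. emeasure (factorial_power 3 (\<omega> w)) C \<partial>M) \<le> (\<integral>\<^sup>+x. 6 * indicator C x \<partial>lborels {..<3})"
    by (rule expected_count_le[OF _ C]) (simp, rule order_trans[OF ennreal_leI[OF Re_det_K_3]], simp)
  also have "\<dots> \<le> (\<integral>\<^sup>+x. 6 * (indicator (ball 0 (real n)) (x p) * h1 (x p - x q) * h2 (x p - x s)) \<partial>lborels {..<3})"
    by (rule nn_integral_mono) (use CI in \<open>auto simp: indicator_def\<close>)
  also have "\<dots> = 6 * (\<integral>\<^sup>+x. indicator (ball 0 (real n)) (x p) * h1 (x p - x q) * h2 (x p - x s) \<partial>lborels {..<3})"
    unfolding pqr(2) by (rule nn_integral_cmult) measurable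
  also have "(\<integral>\<^sup>+x. indicator (ball 0 (real n)) (x p) * h1 (x p - x q) * h2 (x p - x s) \<partial>lborels {..<3}) =
      vol n * volA A * volA A"
    unfolding pqr(2) by (subst nn_integral_star_3[OF _ _ _ pqr(1)]) (auto simp: hi vol_def)
  finally show ?thesis .
qed

abbreviation k2 :: "'a \<Rightarrow> ennreal" where "k2 x \<equiv> ennreal ((cmod (K x))\<^sup>2)"

abbreviation near4 :: "nat \<Rightarrow> (nat \<Rightarrow> 'a) \<Rightarrow> ennreal" where
  "near4 n x \<equiv> indicator {(a, b). near A n a b} (x 0, x 1) * indicator {(a, b). near A n a b} (x 2, x 3)"

text \<open>|K|^2 links \<open>p\<close> in one pair to \<open>s\<close> in the other, giving a
  chain of four points. The link integrates to at most 1, so only one position remains free in the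
  ball and the bound has the order of the volume instead of its square. This is where square
  integrability of \<open>K\<close> acts.\<close>

lemma cross_bound:
  fixes h1 h2 :: "'a \<Rightarrow> ennreal"
  assumes pqr: "distinct [p, q, s, t]" "{..<4} = {p, q, s, t}" and hh: "h1 \<in> {indicator A, \<lambda>x. indicator A (- x)}"
    "h2 \<in> {indicator A, \<lambda>x. indicator A (- x)}"
    and CI: "\<And>x. near4 n x \<noteq> 0 \<Longrightarrow> x p \<in> ball 0 (real n) \<and> h1 (x p - x q) = 1 \<and> h2 (x s - x t) = 1"
  shows "(\<integral>\<^sup>+x. k2 (x p - x s) * near4 n x \<partial>lborels {..<4}) \<le> vol n * volA A * volA A"
proof -
  have [measurable]: "h1 \<in> borel_measurable borel" "h2 \<in> borel_measurable borel" using hh by auto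
  have hi: "integral\<^sup>N lborel h1 = volA A" "integral\<^sup>N lborel h2 = volA A"
    using hh volA_reflect by auto
  have "(\<integral>\<^sup>+x. k2 (x p - x s) * near4 n x \<partial>lborels {..<4}) \<le>
      (\<integral>\<^sup>+x. indicator (ball 0 (real n)) (x p) * h1 (x p - x q) * k2 (x p - x s) * h2 (x s - x t) \<partial>lborels {..<4})"
  proof (rule nn_integral_mono)
    fix x :: "nat \<Rightarrow> 'a"
    have "near4 n x \<in> {0, 1}" by (auto simp: indicator_def)
    then show "k2 (x p - x s) * near4 n x \<le> indicator (ball 0 (real n)) (x p) * h1 (x p - x q) * k2 (x p - x s) * h2 (x s - x t)"
      using CI[of x] by (cases "near4 n x = 0") (auto simp del: mult_eq_0_iff mult_eq_1_iff)
  qed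
  also have "\<dots> = vol n * volA A * integral\<^sup>N lborel k2 * volA A"
    unfolding pqr(2) by (subst nn_integral_chain_4[OF _ _ _ _ pqr(1)]) (auto simp: hi vol_def)
  also have "\<dots> \<le> vol n * volA A * 1 * volA A"
    by (intro mult_mono nn_integral_K2_le1) auto
  finally show ?thesis by simp
qed

text \<open>The product part of the four-point bound integrates to exactly the square of the mean,
  which cancels in the variance. Each of the four cross links contributes 24, hence 96.\<close>

lemma quadruple_bound:
  "(\<integral>\<^sup>+w. emeasure (factorial_power 4 (\<omega> w)) (pos_set 4 (\<lambda>x. near A n (x 0) (x 1) \<and> near A n (x 2) (x 3))) \<partial>M)
    \<le> (pair_mean n)\<^sup>2 + 96 * (vol n * volA A * volA A)"
proof -
  let ?C = "pos_set 4 (\<lambda>x. near A n (x 0) (x 1) \<and> near A n (x 2) (x 3))"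
  let ?G = "\<lambda>a b. ennreal (r (a - b)) * indicator {(a, b). near A n a b} (a, b)"
  have ind: "(\<lambda>x. indicator {(a, b). near A n a b} (x p, x q) :: ennreal) \<in> borel_measurable (lborels {..<4})"
    if "p < 4" "q < 4" for p q
    by (rule measurable_compose[OF _ borel_measurable_indicator[OF measurable_near_pair]])
      (use that in \<open>auto intro!: measurable_Pair measurable_lborels_component\<close>)
  have k: "(\<lambda>x. k2 (x p - x q)) \<in> borel_measurable (lborels {..<4})" if "p < 4" "q < 4" for p q
  proof -
    have [measurable]: "(\<lambda>x. x p) \<in> borel_measurable (lborels {..<4})" "(\<lambda>x. x q) \<in> borel_measurable (lborels {..<4})"
      using that by (auto intro: measurable_lborels_component)
    show ?thesis by measurable
  qed
  have m: "(\<lambda>x. k2 (x p - x q) * near4 n x) \<in> borel_measurable (lborels {..<4})" if "p < 4" "q < 4" for p q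
    by (intro borel_measurable_times_ennreal k ind that) auto
  have "(\<integral>\<^sup>+w. emeasure (factorial_power 4 (\<omega> w)) ?C \<partial>M) \<le>
      (\<integral>\<^sup>+x. (ennreal (r (x 0 - x 1)) * ennreal (r (x 2 - x 3)) +
        24 * (k2 (x 0 - x 2) + k2 (x 0 - x 3) + k2 (x 1 - x 2) + k2 (x 1 - x 3))) * indicator ?C x \<partial>lborels {..<4})"
  proof (rule expected_count_le[OF _ measurable_near_4])
    fix x
    show "ennreal (Re (det_K 4 x)) \<le> ennreal (r (x 0 - x 1)) * ennreal (r (x 2 - x 3)) +
        24 * (k2 (x 0 - x 2) + k2 (x 0 - x 3) + k2 (x 1 - x 2) + k2 (x 1 - x 3))"
      using ennreal_leI[OF Re_det_K_4[of x]]
      by (simp add: ennreal_plus[symmetric] ennreal_mult[symmetric] r_nonneg ennreal_numeral[symmetric]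
          del: ennreal_plus ennreal_numeral)
  qed simp
  also have "\<dots> = (\<integral>\<^sup>+x. ?G (x 0) (x 1) * ?G (x 2) (x 3) +
        24 * (k2 (x 0 - x 2) * near4 n x + k2 (x 0 - x 3) * near4 n x + k2 (x 1 - x 2) * near4 n x + k2 (x 1 - x 3) * near4 n x) \<partial>lborels {..<4})"
    by (rule nn_integral_cong) (auto simp: indicator_def space_PiM)
  also have "\<dots> = (\<integral>\<^sup>+x. ?G (x 0) (x 1) * ?G (x 2) (x 3) \<partial>lborels {..<4}) +
      24 * ((\<integral>\<^sup>+x. k2 (x 0 - x 2) * near4 n x \<partial>lborels {..<4}) + (\<integral>\<^sup>+x. k2 (x 0 - x 3) * near4 n x \<partial>lborels {..<4})
        + (\<integral>\<^sup>+x. k2 (x 1 - x 2) * near4 n x \<partial>lborels {..<4}) + (\<integral>\<^sup>+x. k2 (x 1 - x 3) * near4 n x \<partial>lborels {..<4}))"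
    using m by (simp add: nn_integral_add nn_integral_cmult)
  also have "(\<integral>\<^sup>+x. ?G (x 0) (x 1) * ?G (x 2) (x 3) \<partial>lborels {..<4}) = (pair_mean n)\<^sup>2"
    unfolding pair_mean_eq by (rule nn_integral_pair_product_4) measurable
  also have "(pair_mean n)\<^sup>2 +
      24 * ((\<integral>\<^sup>+x. k2 (x 0 - x 2) * near4 n x \<partial>lborels {..<4}) + (\<integral>\<^sup>+x. k2 (x 0 - x 3) * near4 n x \<partial>lborels {..<4})
        + (\<integral>\<^sup>+x. k2 (x 1 - x 2) * near4 n x \<partial>lborels {..<4}) + (\<integral>\<^sup>+x. k2 (x 1 - x 3) * near4 n x \<partial>lborels {..<4})) \<le>
      (pair_mean n)\<^sup>2 + 24 * (vol n * volA A * volA A + vol n * volA A * volA A + vol n * volA A * volA A + vol n * volA A * volA A)"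
  proof (intro add_left_mono mult_left_mono add_mono)
    \<comment> \<open>Each chain starts at the linked points: an indicator is reflected when the
      linked point is the second entry of its pair.\<close>
    show "(\<integral>\<^sup>+x. k2 (x 0 - x 2) * near4 n x \<partial>lborels {..<4}) \<le> vol n * volA A * volA A"
      by (rule cross_bound[of 0 1 2 3 "indicator A" "indicator A"]) (auto simp: indicator_def near_def split: if_splits)
    show "(\<integral>\<^sup>+x. k2 (x 0 - x 3) * near4 n x \<partial>lborels {..<4}) \<le> vol n * volA A * volA A"
      by (rule cross_bound[of 0 1 3 2 "indicator A" "\<lambda>x. indicator A (- x)"]) (auto simp: indicator_def near_def split: if_splits)
    show "(\<integral>\<^sup>+x. k2 (x 1 - x 2) * near4 n x \<partial>lborels {..<4}) \<le> vol n * volA A * volA A"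
      by (rule cross_bound[of 1 0 2 3 "\<lambda>x. indicator A (- x)" "indicator A"]) (auto simp: indicator_def near_def split: if_splits)
    show "(\<integral>\<^sup>+x. k2 (x 1 - x 3) * near4 n x \<partial>lborels {..<4}) \<le> vol n * volA A * volA A"
      by (rule cross_bound[of 1 0 3 2 "\<lambda>x. indicator A (- x)" "\<lambda>x. indicator A (- x)"])
        (auto simp: indicator_def near_def split: if_splits)
  qed simp_all
  also have "\<dots> = (pair_mean n)\<^sup>2 + 96 * (vol n * volA A * volA A)"
    by (simp add: mult_2[symmetric] flip: mult.assoc add.assoc)
  finally show ?thesis .
qed

end

end

section \<open>Laws of large numbers for pairs and for points\<close>

context determinantal_process
begin

lemma vol_eq: "vol n = ennreal (unit_ball_vol DIM('a) * real n ^ DIM('a))"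
  unfolding vol_def by (rule emeasure_ball) simp

lemma volA_finite: "bounded A \<Longrightarrow> A \<in> sets borel \<Longrightarrow> volA A < \<infinity>"
  by (rule emeasure_bounded_finite)

lemma factorial_power_ball:
  assumes "w \<in> space M" "C \<in> sets (\<Pi>\<^sub>M l\<in>{..<k}. borel)"
    and "\<And>x l. x \<in> C \<Longrightarrow> l < k \<Longrightarrow> x l \<in> ball 0 (real n)"
  shows "emeasure (factorial_power k (\<omega> w)) C = card {t \<in> index_tuples k (\<omega> w). positions k t \<in> C}"
  by (rule emeasure_factorial_power_card(2)[OF counting[OF assms(1)] assms(2) bounded_ball[of 0 "real n"]]) (rule assms(3))

text \<open>The square of a pair count splits by coincidences: disjoint pairs, four ways to share
  one point, two ways to coincide. Hence 120 = 96 + 4 * 6, and the final 2.\<close>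

lemma pair_count_second_moment:
  assumes A[measurable]: "A \<in> sets borel" and A_bdd: "bounded A"
  shows "(\<integral>\<^sup>+w. ennreal ((pair_count A n w)\<^sup>2) \<partial>M) \<le> (pair_mean A n)\<^sup>2 + 120 * (vol n * volA A * volA A) + 2 * (vol n * volA A)"
proof -
  let ?C4 = "pos_set 4 (\<lambda>x. near A n (x 0) (x 1) \<and> near A n (x 2) (x 3))"
  let ?T = "\<lambda>Q. pos_set 3 (\<lambda>x. near A n (x 0) (x 1) \<and> Q (x 0) (x 1) (x 2))"
  let ?Q1 = "\<lambda>a b c. near A n a c" and ?Q2 = "\<lambda>a b c. near A n b c"
    and ?Q3 = "\<lambda>a b c. near A n c a" and ?Q4 = "\<lambda>a b c. near A n c b"
  let ?E3 = "\<lambda>Q w. emeasure (factorial_power 3 (\<omega> w)) (?T Q)"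
  let ?E4 = "\<lambda>w. emeasure (factorial_power 4 (\<omega> w)) ?C4"
  have T: "?T ?Q1 \<in> sets (\<Pi>\<^sub>M l\<in>{..<3}. borel)" "?T ?Q2 \<in> sets (\<Pi>\<^sub>M l\<in>{..<3}. borel)"
    "?T ?Q3 \<in> sets (\<Pi>\<^sub>M l\<in>{..<3}. borel)" "?T ?Q4 \<in> sets (\<Pi>\<^sub>M l\<in>{..<3}. borel)"
    unfolding near_def mem_ball by measurable
  note [measurable] = T[THEN measurable_emeasure_factorial_power[OF measurable_\<omega>]]
    measurable_emeasure_factorial_power[OF measurable_\<omega> measurable_near_4[OF A A_bdd]]
    measurable_pair_count[OF A A_bdd]
  have pointwise: "ennreal ((pair_count A n w)\<^sup>2) \<le> ?E4 w + ?E3 ?Q1 w + ?E3 ?Q2 w + ?E3 ?Q3 w + ?E3 ?Q4 w + 2 * ennreal (pair_count A n w)"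
    if w: "w \<in> space M" for w
  proof -
    define J where "J = {i \<in> point_indices (\<omega> w). fst i \<in> ball 0 (real n)}"
    have fJ: "finite J" unfolding J_def by (rule finite_point_indices_bounded[OF counting[OF w]]) simp
    let ?P = "\<lambda>i j. near A n (fst i) (fst j)"
    have S: "{(i, j). {i, j} \<subseteq> J \<and> i \<noteq> j \<and> ?P i j} = {(i, j). {i, j} \<subseteq> point_indices (\<omega> w) \<and> i \<noteq> j \<and> ?P i j}"
      by (auto simp: J_def near_def)
    have E4: "?E4 w = card {(a, b, c, d). {a, b, c, d} \<subseteq> J \<and> distinct [a, b, c, d] \<and> ?P a b \<and> ?P c d}"
    proof -
      have "?E4 w = card {t \<in> index_tuples 4 (\<omega> w). positions 4 t \<in> ?C4}"
      proof (rule factorial_power_ball[OF w measurable_near_4[OF A A_bdd]])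
        fix x :: "nat \<Rightarrow> 'a" and l :: nat assume x: "x \<in> ?C4" and "l < 4"
        then have "l = 0 \<or> l = 1 \<or> l = 2 \<or> l = 3" by auto
        then show "x l \<in> ball 0 (real n)" using x by (auto simp: near_def)
      qed
      also have "card {t \<in> index_tuples 4 (\<omega> w). positions 4 t \<in> ?C4} =
          card {(a, b, c, d). {a, b, c, d} \<subseteq> point_indices (\<omega> w) \<and> distinct [a, b, c, d] \<and> ?P a b \<and> ?P c d}"
        by (rule card_index_tuples_4)
      also have "{(a, b, c, d). {a, b, c, d} \<subseteq> point_indices (\<omega> w) \<and> distinct [a, b, c, d] \<and> ?P a b \<and> ?P c d} =
          {(a, b, c, d). {a, b, c, d} \<subseteq> J \<and> distinct [a, b, c, d] \<and> ?P a b \<and> ?P c d}"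
        by (rule Collect_cong) (auto simp: J_def near_def)
      finally show ?thesis .
    qed
    have E3: "?E3 Q w = card {(a, b, c). {a, b, c} \<subseteq> J \<and> distinct [a, b, c] \<and> ?P a b \<and> Q (fst a) (fst b) (fst c)}"
      if Q: "?T Q \<in> sets (\<Pi>\<^sub>M l\<in>{..<3}. borel)" "\<And>a b c. Q a b c \<Longrightarrow> c \<in> ball 0 (real n)" for Q
    proof -
      have "?E3 Q w = card {t \<in> index_tuples 3 (\<omega> w). positions 3 t \<in> ?T Q}"
      proof (rule factorial_power_ball[OF w Q(1)])
        fix x :: "nat \<Rightarrow> 'a" and l :: nat assume x: "x \<in> ?T Q" and "l < 3"
        then have "l = 0 \<or> l = 1 \<or> l = 2" by auto
        then show "x l \<in> ball 0 (real n)" using x Q(2) by (auto simp: near_def)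
      qed
      also have "card {t \<in> index_tuples 3 (\<omega> w). positions 3 t \<in> ?T Q} =
          card {(a, b, c). {a, b, c} \<subseteq> point_indices (\<omega> w) \<and> distinct [a, b, c] \<and> ?P a b \<and> Q (fst a) (fst b) (fst c)}"
        by (rule card_index_tuples_3)
      also have "{(a, b, c). {a, b, c} \<subseteq> point_indices (\<omega> w) \<and> distinct [a, b, c] \<and> ?P a b \<and> Q (fst a) (fst b) (fst c)} =
          {(a, b, c). {a, b, c} \<subseteq> J \<and> distinct [a, b, c] \<and> ?P a b \<and> Q (fst a) (fst b) (fst c)}"
        by (rule Collect_cong) (use Q(2) in \<open>auto simp: J_def near_def\<close>)
      finally show ?thesis .
    qed
    let ?n4 = "card {(a, b, c, d). {a, b, c, d} \<subseteq> J \<and> distinct [a, b, c, d] \<and> ?P a b \<and> ?P c d}"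
    let ?n3 = "\<lambda>Q. card {(a, b, c). {a, b, c} \<subseteq> J \<and> distinct [a, b, c] \<and> ?P a b \<and> Q (fst a) (fst b) (fst c)}"
    let ?s = "card {(i, j). {i, j} \<subseteq> J \<and> i \<noteq> j \<and> ?P i j}"
    have "?s\<^sup>2 \<le> ?n4 + ?n3 ?Q1 + ?n3 ?Q2 + ?n3 ?Q3 + ?n3 ?Q4 + 2 * ?s"
      using card_pairs_squared_le[OF fJ, of ?P] by simp
    then have "(of_nat (?s\<^sup>2) :: ennreal) \<le> of_nat (?n4 + ?n3 ?Q1 + ?n3 ?Q2 + ?n3 ?Q3 + ?n3 ?Q4 + 2 * ?s)"
      by (rule of_nat_mono)
    also have "\<dots> = ?E4 w + ?E3 ?Q1 w + ?E3 ?Q2 w + ?E3 ?Q3 w + ?E3 ?Q4 w + 2 * of_nat ?s"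
      by (subst E3[OF T(1)], simp add: near_def, subst E3[OF T(2)], simp add: near_def,
          subst E3[OF T(3)], simp add: near_def, subst E3[OF T(4)], simp add: near_def) (simp only: E4 of_nat_add of_nat_mult of_nat_numeral)
    finally show ?thesis
      unfolding pair_count_def S by (simp add: ennreal_of_nat_eq_real_of_nat ennreal_power)
  qed
  have b: "(\<integral>\<^sup>+w. ?E3 ?Q1 w \<partial>M) \<le> 6 * (vol n * volA A * volA A)" "(\<integral>\<^sup>+w. ?E3 ?Q2 w \<partial>M) \<le> 6 * (vol n * volA A * volA A)"
    "(\<integral>\<^sup>+w. ?E3 ?Q3 w \<partial>M) \<le> 6 * (vol n * volA A * volA A)" "(\<integral>\<^sup>+w. ?E3 ?Q4 w \<partial>M) \<le> 6 * (vol n * volA A * volA A)"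
  proof -
    \<comment> \<open>The shared point is the first entry of the leading pair for \<open>?Q1\<close>
      and \<open>?Q3\<close>, the second for \<open>?Q2\<close> and \<open>?Q4\<close>.\<close>
    let ?h = "indicator A :: 'a \<Rightarrow> ennreal" and ?h' = "(\<lambda>x. indicator A (- x)) :: 'a \<Rightarrow> ennreal"
    show "(\<integral>\<^sup>+w. ?E3 ?Q1 w \<partial>M) \<le> 6 * (vol n * volA A * volA A)"
      by (rule triple_bound[OF A A_bdd _ _ _ _ T(1), of 0 1 2 ?h ?h]) (auto simp: near_def)
    show "(\<integral>\<^sup>+w. ?E3 ?Q2 w \<partial>M) \<le> 6 * (vol n * volA A * volA A)"
      by (rule triple_bound[OF A A_bdd _ _ _ _ T(2), of 1 0 2 ?h' ?h]) (auto simp: near_def)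
    show "(\<integral>\<^sup>+w. ?E3 ?Q3 w \<partial>M) \<le> 6 * (vol n * volA A * volA A)"
      by (rule triple_bound[OF A A_bdd _ _ _ _ T(3), of 0 1 2 ?h ?h']) (auto simp: near_def)
    show "(\<integral>\<^sup>+w. ?E3 ?Q4 w \<partial>M) \<le> 6 * (vol n * volA A * volA A)"
      by (rule triple_bound[OF A A_bdd _ _ _ _ T(4), of 1 0 2 ?h' ?h']) (auto simp: near_def)
  qed
  have add6: "(\<integral>\<^sup>+w. f1 w + f2 w + f3 w + f4 w + f5 w + 2 * f6 w \<partial>M) =
      (\<integral>\<^sup>+w. f1 w \<partial>M) + (\<integral>\<^sup>+w. f2 w \<partial>M) + (\<integral>\<^sup>+w. f3 w \<partial>M) + (\<integral>\<^sup>+w. f4 w \<partial>M) + (\<integral>\<^sup>+w. f5 w \<partial>M) + 2 * (\<integral>\<^sup>+w. f6 w \<partial>M)"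
    if "f1 \<in> borel_measurable M" "f2 \<in> borel_measurable M" "f3 \<in> borel_measurable M"
      "f4 \<in> borel_measurable M" "f5 \<in> borel_measurable M" "f6 \<in> borel_measurable M" for f1 f2 f3 f4 f5 f6 :: "'w \<Rightarrow> ennreal"
    using that by (simp add: nn_integral_add nn_integral_cmult)
  have "(\<integral>\<^sup>+w. ennreal ((pair_count A n w)\<^sup>2) \<partial>M) \<le>
      (\<integral>\<^sup>+w. ?E4 w + ?E3 ?Q1 w + ?E3 ?Q2 w + ?E3 ?Q3 w + ?E3 ?Q4 w + 2 * ennreal (pair_count A n w) \<partial>M)"
    by (rule nn_integral_mono) (rule pointwise)
  also have "\<dots> = (\<integral>\<^sup>+w. ?E4 w \<partial>M) + (\<integral>\<^sup>+w. ?E3 ?Q1 w \<partial>M) + (\<integral>\<^sup>+w. ?E3 ?Q2 w \<partial>M)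
      + (\<integral>\<^sup>+w. ?E3 ?Q3 w \<partial>M) + (\<integral>\<^sup>+w. ?E3 ?Q4 w \<partial>M) + 2 * pair_mean A n"
    unfolding pair_mean_def[OF A A_bdd] by (rule add6) measurable
  also have "\<dots> \<le> ((pair_mean A n)\<^sup>2 + 96 * (vol n * volA A * volA A)) + 6 * (vol n * volA A * volA A)
      + 6 * (vol n * volA A * volA A) + 6 * (vol n * volA A * volA A) + 6 * (vol n * volA A * volA A) + 2 * (vol n * volA A)"
    by (intro add_mono mult_left_mono quadruple_bound[OF A A_bdd] b pair_mean_le[OF A A_bdd]) simp_all
  also have "\<dots> = (pair_mean A n)\<^sup>2 + (96 + 6 + 6 + 6 + 6) * (vol n * volA A * volA A) + 2 * (vol n * volA A)"
    by (simp only: distrib_right add.assoc)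
  finally show ?thesis by simp
qed

text \<open>Without the ball condition on the second point the mean would be exactly
  \<open>vol n * ennreal R\<close>. This bounds it from above, and from below once the radius grows
  by a constant \<open>\<rho>\<close>, since a partner at distance at most \<open>\<rho>\<close>
  stays in the larger ball. The ratio of the two volumes tends to 1.\<close>

lemma pair_mean_limit:
  assumes A[measurable]: "A \<in> sets borel" and A_bdd: "bounded A"
  shows "(\<lambda>n. enn2real (pair_mean A n) / (unit_ball_vol DIM('a) * real n ^ DIM('a))) \<longlonglongrightarrow> (LINT x:A|lborel. r x)"
proof -
  define d where "d = DIM('a)"
  define \<kappa> where "\<kappa> = unit_ball_vol (real d)"
  have \<kappa>: "\<kappa> > 0" by (simp add: \<kappa>_def)
  define R where "R = (LINT x:A|lborel. r x)"
  have vol: "vol n = ennreal (\<kappa> * real n ^ d)" for n by (simp add: vol_eq \<kappa>_def d_def)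
  have R: "(\<integral>\<^sup>+x. ennreal (r x) * indicator A x \<partial>lborel) = ennreal R" and R0: "0 \<le> R"
  proof -
    have iA: "integrable lborel (indicator A :: 'a \<Rightarrow> real)"
      using volA_finite[OF A_bdd A] by (intro integrable_real_indicator) auto
    have i: "integrable lborel (\<lambda>x. indicator A x * r x)"
      by (rule Bochner_Integration.integrable_bound[OF iA]) (auto simp: indicator_def r_nonneg r_le1)
    have "(\<integral>\<^sup>+x. ennreal (r x) * indicator A x \<partial>lborel) = (\<integral>\<^sup>+x. ennreal (indicator A x * r x) \<partial>lborel)"
      by (rule nn_integral_cong) (auto simp: indicator_def)
    also have "\<dots> = ennreal (LINT x|lborel. indicator A x * r x)"
      by (rule nn_integral_eq_integral[OF i]) (auto simp: r_nonneg)
    finally show "(\<integral>\<^sup>+x. ennreal (r x) * indicator A x \<partial>lborel) = ennreal R"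
      by (simp add: R_def set_lebesgue_integral_def)
    show "0 \<le> R" unfolding R_def set_lebesgue_integral_def
      by (rule Bochner_Integration.integral_nonneg) (simp add: r_nonneg)
  qed
  have inner: "(\<integral>\<^sup>+b. ennreal (r (a - b)) * indicator A (a - b) \<partial>lborel) = ennreal R" for a
    using nn_integral_lborel_reflect[of "\<lambda>x. ennreal (r x) * indicator A x" a] by (simp add: R)
  have up: "pair_mean A n \<le> vol n * ennreal R" for n
  proof -
    have "pair_mean A n \<le> (\<integral>\<^sup>+a. indicator (ball 0 (real n)) a * (\<integral>\<^sup>+b. ennreal (r (a - b)) * indicator A (a - b) \<partial>lborel) \<partial>lborel)"
      unfolding pair_mean_iterated[OF A A_bdd]
    proof (rule nn_integral_mono)
      fix a
      show "(\<integral>\<^sup>+b. ennreal (r (a - b)) * indicator {(a, b). near A n a b} (a, b) \<partial>lborel)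
          \<le> indicator (ball 0 (real n)) a * (\<integral>\<^sup>+b. ennreal (r (a - b)) * indicator A (a - b) \<partial>lborel)"
        by (subst nn_integral_cmult[symmetric], measurable) (auto intro!: nn_integral_mono simp: indicator_def near_def)
    qed
    also have "\<dots> = vol n * ennreal R" unfolding inner vol_def by (simp add: nn_integral_multc vol_def)
    finally show ?thesis .
  qed
  \<comment> \<open>A natural number, so that \<open>n + \<rho>\<close> is again an index of the
    sequence.\<close>
  obtain \<rho> where \<rho>: "\<And>x. x \<in> A \<Longrightarrow> norm x \<le> real \<rho>"
    using A_bdd by (auto simp: bounded_iff) (meson order_trans real_arch_simple)
  have low: "vol n * ennreal R \<le> pair_mean A (n + \<rho>)" for n
  proof -
    have "vol n * ennreal R = (\<integral>\<^sup>+a. indicator (ball 0 (real n)) a * (\<integral>\<^sup>+b. ennreal (r (a - b)) * indicator A (a - b) \<partial>lborel) \<partial>lborel)"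
      unfolding inner vol_def by (simp add: nn_integral_multc vol_def)
    also have "\<dots> \<le> pair_mean A (n + \<rho>)"
      unfolding pair_mean_iterated[OF A A_bdd]
    proof (rule nn_integral_mono)
      fix a
      have "indicator (ball 0 (real n)) a * (ennreal (r (a - b)) * indicator A (a - b))
          \<le> ennreal (r (a - b)) * indicator {(a, b). near A (n + \<rho>) a b} (a, b)" for b
      proof (cases "a \<in> ball 0 (real n) \<and> a - b \<in> A")
        case True
        then have "norm b < real (n + \<rho>)" using \<rho>[of "a - b"] norm_triangle_sub[of b a] by (auto simp: norm_minus_commute)
        then show ?thesis using True by (auto simp: near_def)
      qed (auto simp: indicator_def)
      then show "indicator (ball 0 (real n)) a * (\<integral>\<^sup>+b. ennreal (r (a - b)) * indicator A (a - b) \<partial>lborel)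
          \<le> (\<integral>\<^sup>+b. ennreal (r (a - b)) * indicator {(a, b). near A (n + \<rho>) a b} (a, b) \<partial>lborel)"
        by (subst nn_integral_cmult[symmetric], measurable) (intro nn_integral_mono)
    qed
    finally show ?thesis .
  qed
  have fin: "pair_mean A n < \<infinity>" for n
    using up[of n] by (rule le_less_trans) (simp add: vol ennreal_mult[symmetric] R0 \<kappa> less_imp_le)
  have up': "enn2real (pair_mean A n) \<le> \<kappa> * real n ^ d * R" for n
    using up[of n] R0 \<kappa> by (intro enn2real_leI) (auto simp: vol ennreal_mult)
  have low': "\<kappa> * real n ^ d * R \<le> enn2real (pair_mean A (n + \<rho>))" for n
  proof -
    have "ennreal (\<kappa> * real n ^ d * R) \<le> pair_mean A (n + \<rho>)"
      using low[of n] R0 \<kappa> by (simp add: vol ennreal_mult)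
    then have "enn2real (ennreal (\<kappa> * real n ^ d * R)) \<le> enn2real (pair_mean A (n + \<rho>))"
      using fin[unfolded infinity_ennreal_def] by (intro enn2real_mono)
    then show ?thesis using R0 \<kappa> by simp
  qed
  have "(\<lambda>n. enn2real (pair_mean A n) / (\<kappa> * real n ^ d)) \<longlonglongrightarrow> R"
  proof (rule tendsto_sandwich)
    \<comment> \<open>From \<open>Suc \<rho>\<close> on, the truncated difference
      \<open>n - \<rho>\<close> is the true one.\<close>
    show "eventually (\<lambda>n. (real (n - \<rho>) / real n) ^ d * R \<le> enn2real (pair_mean A n) / (\<kappa> * real n ^ d)) sequentially"
      using eventually_ge_at_top[of "Suc \<rho>"]
    proof eventually_elim
      case (elim n)
      then show ?case using low'[of "n - \<rho>"] \<kappa> by (simp add: field_simps power_divide)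
    qed
    show "eventually (\<lambda>n. enn2real (pair_mean A n) / (\<kappa> * real n ^ d) \<le> R) sequentially"
      using eventually_ge_at_top[of 1]
    proof eventually_elim
      case (elim n)
      then show ?case using up'[of n] \<kappa> by (simp add: field_simps)
    qed
    have "(\<lambda>n. real (n - \<rho>) / real n) \<longlonglongrightarrow> 1" by real_asymp
    from tendsto_mult[OF tendsto_power[OF this, of d] tendsto_const, of R]
    show "(\<lambda>n. (real (n - \<rho>) / real n) ^ d * R) \<longlonglongrightarrow> R" by simp
  qed simp
  then show ?thesis by (simp add: R_def \<kappa>_def d_def)
qed

text \<open>The constant \<open>120 * a\<^sup>2 + 2 * a\<close>, with a the volume of
  \<open>A\<close>, is what remains of the second moment bound after the squared mean is split off
  and the volume of the ball is factored out.\<close>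

lemma pair_count_LLN:
  assumes A[measurable]: "A \<in> sets borel" and A_bdd: "bounded A"
  shows "AE w in M. (\<lambda>n. pair_count A n w / (unit_ball_vol DIM('a) * real n ^ DIM('a))) \<longlonglongrightarrow> (LINT x:A|lborel. r x)"
proof -
  define a where "a = enn2real (volA A)"
  have a: "volA A = ennreal a" "0 \<le> a"
    using volA_finite[OF A_bdd A] by (auto simp: a_def less_top)
  have fin: "pair_mean A n < \<infinity>" for n
    using pair_mean_le[OF A A_bdd, of n] by (rule le_less_trans) (simp add: vol_eq a ennreal_mult[symmetric])
  have pm: "pair_mean A n = ennreal (enn2real (pair_mean A n))" for n using fin[of n] by simp
  show ?thesis
  proof (rule LLN_monotone[where \<mu>="\<lambda>n. enn2real (pair_mean A n)" and c="120 * a\<^sup>2 + 2 * a", OF _ _ _ _ _ _ _ refl])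
    show "pair_count A n \<in> borel_measurable M" for n by (rule measurable_pair_count[OF A A_bdd])
    show "0 \<le> pair_count A n w" for n w by (simp add: pair_count_def)
    show "pair_count A m w \<le> pair_count A n w" if w: "w \<in> space M" and mn: "m \<le> n" for m n w
    proof -
      have "finite {i \<in> point_indices (\<omega> w). fst i \<in> ball 0 (real n)}" (is "finite ?J")
        by (rule finite_point_indices_bounded[OF counting[OF w]]) simp
      then have "finite (?J \<times> ?J)" by simp
      then have "finite {(i, j). {i, j} \<subseteq> point_indices (\<omega> w) \<and> i \<noteq> j \<and> near A n (fst i) (fst j)}"
        by (rule rev_finite_subset) (auto simp: near_def)
      then show ?thesis unfolding pair_count_def
        by (intro of_nat_mono card_mono) (use mn in \<open>auto simp: near_def\<close>)
    qed
    show "(\<integral>\<^sup>+w. pair_count A n w \<partial>M) = ennreal (enn2real (pair_mean A n))" for n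
      using pm[of n] unfolding pair_mean_def[OF A A_bdd] .
    show "(\<integral>\<^sup>+w. (pair_count A n w)\<^sup>2 \<partial>M) \<le>
        ennreal ((enn2real (pair_mean A n))\<^sup>2 + (120 * a\<^sup>2 + 2 * a) * (unit_ball_vol DIM('a) * real n ^ DIM('a)))" for n
    proof -
      let ?v = "unit_ball_vol DIM('a) * real n ^ DIM('a)" and ?m = "enn2real (pair_mean A n)"
      have "(pair_mean A n)\<^sup>2 + 120 * (vol n * volA A * volA A) + 2 * (vol n * volA A) =
          ennreal (?m\<^sup>2) + ennreal 120 * (ennreal ?v * ennreal a * ennreal a) + ennreal 2 * (ennreal ?v * ennreal a)"
        by (subst pm) (simp add: a vol_eq ennreal_power)
      also have "\<dots> = ennreal (?m\<^sup>2 + 120 * (?v * a * a) + 2 * (?v * a))"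
        using a(2) by (simp only: ennreal_mult[symmetric] ennreal_plus[symmetric] mult_nonneg_nonneg add_nonneg_nonneg
          zero_le_power2 unit_ball_vol_nonneg zero_le_power of_nat_0_le_iff zero_le_numeral)
      also have "?m\<^sup>2 + 120 * (?v * a * a) + 2 * (?v * a) = ?m\<^sup>2 + (120 * a\<^sup>2 + 2 * a) * ?v"
        by (simp add: algebra_simps power2_eq_square)
      finally show ?thesis using pair_count_second_moment[OF A A_bdd, of n] by simp
    qed
    show "0 \<le> 120 * a\<^sup>2 + 2 * a" using a by simp
  qed (use pair_mean_limit[OF A A_bdd] in auto)
qed

lemma point_count_eq:
  assumes w: "w \<in> space M"
  shows "ennreal (point_count n w) = emeasure (factorial_power 1 (\<omega> w)) (pos_set 1 (\<lambda>x. x 0 \<in> ball 0 (real n)))"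
  by (subst factorial_power_ball[OF w, where n=n])
    (auto simp: point_count_def card_index_tuples_1[of "\<omega> w" "\<lambda>a. a \<in> ball 0 (real n)", simplified] ennreal_of_nat_eq_real_of_nat)

text \<open>The number of points governs the diagonal pairs. Its second moment is the mean number of
  ordered pairs plus the mean; as \<open>r \<le> 1\<close>, the former is at most the squared
  volume, so the variance is at most the volume.\<close>

lemma point_count_LLN:
  "AE w in M. (\<lambda>n. point_count n w / (unit_ball_vol DIM('a) * real n ^ DIM('a))) \<longlonglongrightarrow> 1"
proof (rule LLN_monotone[where \<mu>="\<lambda>n. unit_ball_vol DIM('a) * real n ^ DIM('a)" and c=1, OF _ _ _ _ _ _ _ refl])
  let ?v = "\<lambda>n. unit_ball_vol DIM('a) * real n ^ DIM('a)"
  let ?C = "\<lambda>n. pos_set 1 (\<lambda>x. x 0 \<in> ball (0::'a) (real n))"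
  let ?D = "\<lambda>n. pos_set 2 (\<lambda>x. x 0 \<in> ball (0::'a) (real n) \<and> x 1 \<in> ball 0 (real n))"
  have C: "?C n \<in> sets (\<Pi>\<^sub>M l\<in>{..<1}. borel)" for n unfolding mem_ball by measurable
  have D: "?D n \<in> sets (\<Pi>\<^sub>M l\<in>{..<2}. borel)" for n unfolding mem_ball by measurable
  have fin: "finite {i \<in> point_indices (\<omega> w). fst i \<in> ball 0 (real n)}" if w: "w \<in> space M" for n w
    by (rule finite_point_indices_bounded[OF counting[OF w]]) simp
  have eq: "point_count n w = measure (\<omega> w) (ball 0 (real n))" if w: "w \<in> space M" for n w
    unfolding point_count_def by (rule measure_counting_measure[OF counting[OF w], symmetric]) auto
  have [measurable]: "(\<lambda>w. emeasure (\<omega> w) (ball 0 (real n))) \<in> borel_measurable M" for n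
    by (rule measurable_emeasure_counting_measure_space[OF measurable_\<omega>]) simp
  show m[measurable]: "point_count n \<in> borel_measurable M" for n
    by (subst measurable_cong[OF eq]) (auto simp: measure_def)
  show "0 \<le> point_count n w" for n w by (simp add: point_count_def)
  show "point_count m w \<le> point_count n w" if w: "w \<in> space M" and mn: "m \<le> n" for m n w
    unfolding point_count_def by (intro of_nat_mono card_mono fin w) (use mn in auto)
  show mean: "(\<integral>\<^sup>+w. point_count n w \<partial>M) = ennreal (?v n)" for n
  proof -
    have "(\<integral>\<^sup>+w. point_count n w \<partial>M) = (\<integral>\<^sup>+w. emeasure (factorial_power 1 (\<omega> w)) (?C n) \<partial>M)"
      by (intro nn_integral_cong point_count_eq)
    also have "\<dots> = (\<integral>\<^sup>+x. ennreal (Re (det_K 1 x)) * indicator (?C n) x \<partial>lborels {..<1})"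
      by (rule expected_count[OF _ C]) simp
    also have "\<dots> = (\<integral>\<^sup>+x. indicator (ball (0::'a) (real n)) (x 0) \<partial>lborels {0::nat})"
    proof -
      have e: "{..<1} = {0::nat}" by auto
      show ?thesis unfolding e
        by (rule nn_integral_cong) (auto simp: Re_det_K_1[simplified] indicator_def space_PiM)
    qed
    also have "\<dots> = vol n" by (subst nn_integral_lborels_1) (auto simp: vol_def)
    finally show ?thesis by (simp add: vol_eq)
  qed
  show "(\<integral>\<^sup>+w. (point_count n w)\<^sup>2 \<partial>M) \<le> ennreal ((?v n)\<^sup>2 + 1 * ?v n)" for n
  proof -
    let ?B = "ball (0::'a) (real n)"
    have [measurable]: "(\<lambda>w. emeasure (factorial_power 2 (\<omega> w)) (?D n)) \<in> borel_measurable M"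
      by (rule measurable_emeasure_factorial_power[OF measurable_\<omega> D])
    have "ennreal ((point_count n w)\<^sup>2) = emeasure (factorial_power 2 (\<omega> w)) (?D n) + ennreal (point_count n w)"
      if w: "w \<in> space M" for w
    proof -
      let ?J = "{i \<in> point_indices (\<omega> w). fst i \<in> ?B}"
      have "emeasure (factorial_power 2 (\<omega> w)) (?D n) = card {t \<in> index_tuples 2 (\<omega> w). positions 2 t \<in> ?D n}"
        by (rule factorial_power_ball[OF w D, where n=n]) (auto simp: less_2_cases_iff)
      also have "card {t \<in> index_tuples 2 (\<omega> w). positions 2 t \<in> ?D n} =
          card {(a, b). {a, b} \<subseteq> point_indices (\<omega> w) \<and> a \<noteq> b \<and> fst a \<in> ?B \<and> fst b \<in> ?B}"
        by (rule card_index_tuples_2)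
      also have "{(a, b). {a, b} \<subseteq> point_indices (\<omega> w) \<and> a \<noteq> b \<and> fst a \<in> ?B \<and> fst b \<in> ?B} =
          {(a, b). {a, b} \<subseteq> ?J \<and> a \<noteq> b}" by auto
      finally have e: "emeasure (factorial_power 2 (\<omega> w)) (?D n) = card {(a, b). {a, b} \<subseteq> ?J \<and> a \<noteq> b}" .
      have "(of_nat ((card ?J)\<^sup>2) :: ennreal) = of_nat (card {(a, b). {a, b} \<subseteq> ?J \<and> a \<noteq> b} + card ?J)"
        by (subst card_squared_le[OF fin[OF w]]) (rule refl)
      then show ?thesis
        unfolding point_count_def e by (simp add: ennreal_of_nat_eq_real_of_nat ennreal_power)
    qed
    then have "(\<integral>\<^sup>+w. (point_count n w)\<^sup>2 \<partial>M) =
        (\<integral>\<^sup>+w. emeasure (factorial_power 2 (\<omega> w)) (?D n) + ennreal (point_count n w) \<partial>M)"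
      by (rule nn_integral_cong)
    also have "\<dots> = (\<integral>\<^sup>+w. emeasure (factorial_power 2 (\<omega> w)) (?D n) \<partial>M) + ennreal (?v n)"
      by (subst nn_integral_add) (measurable, simp only: mean)
    also have "(\<integral>\<^sup>+w. emeasure (factorial_power 2 (\<omega> w)) (?D n) \<partial>M) \<le> (\<integral>\<^sup>+x. 1 * indicator (?D n) x \<partial>lborels {..<2})"
      by (rule expected_count_le[OF _ D]) (auto simp: Re_det_K_2 r_le1 ennreal_le_1)
    also have "\<dots> = (\<integral>\<^sup>+x. indicator ?B (x 0) * indicator ?B (x 1) \<partial>lborels {0, 1::nat})"
      unfolding lessThan_small by (rule nn_integral_cong) (auto simp: indicator_def space_PiM)
    also have "\<dots> = vol n * vol n"
      by (subst nn_integral_lborels_2[of "\<lambda>a b. indicator ?B a * indicator ?B b"])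
        (simp_all add: nn_integral_cmult nn_integral_multc vol_def)
    also have "vol n * vol n + ennreal (?v n) = ennreal ((?v n)\<^sup>2 + 1 * ?v n)"
      by (simp add: vol_eq ennreal_mult[symmetric] power2_eq_square)
    finally show ?thesis by (simp add: add_right_mono)
  qed
  have "eventually (\<lambda>n. 1 = ?v n / ?v n) sequentially"
    using eventually_ge_at_top[of 1] by eventually_elim (simp add: unit_ball_vol_pos[THEN less_imp_neq, symmetric])
  then show "(\<lambda>n. ?v n / ?v n) \<longlonglongrightarrow> 1" by (rule Lim_transform_eventually[OF tendsto_const])
qed auto

end

section \<open>Dirac measure plus a density\<close>

text \<open>Both the autocorrelation and the diffraction have this shape. \<open>ennreal\<close>
  would truncate a negative \<open>F\<close>; the densities inserted later are \<open>r\<close> and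
  \<open>1 - g\<close>, both nonnegative.\<close>

definition dirac_plus :: "('a::euclidean_space \<Rightarrow> real) \<Rightarrow> 'a measure" where
  "dirac_plus F = measure_of UNIV (sets borel)
     (\<lambda>A. emeasure (return borel 0) A + emeasure (density lborel (\<lambda>x. ennreal (F x))) A)"

lemma sets_dirac_plus[simp, measurable_cong]: "sets (dirac_plus F) = sets borel"
  unfolding dirac_plus_def using sets.sigma_sets_eq[of borel] by (simp add: sets_measure_of_conv)

lemma space_dirac_plus[simp]: "space (dirac_plus F) = UNIV"
  unfolding dirac_plus_def by (simp add: space_measure_of_conv)

lemma emeasure_dirac_plus:
  fixes F :: "'a::euclidean_space \<Rightarrow> real"
  assumes A: "A \<in> sets borel"
  shows "emeasure (dirac_plus F) A = emeasure (return borel 0) A + emeasure (density lborel (\<lambda>x. ennreal (F x))) A"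
  unfolding dirac_plus_def
proof (rule emeasure_measure_of_sigma)
  show "sigma_algebra UNIV (sets (borel :: 'a measure))"
    using sets.sigma_algebra_axioms[of "borel :: 'a measure"] by simp
  let ?\<mu> = "\<lambda>A. emeasure (return borel (0::'a)) A + emeasure (density lborel (\<lambda>x. ennreal (F x))) A"
  show "positive (sets borel) ?\<mu>" by (simp add: positive_def)
  show "countably_additive (sets borel) ?\<mu>"
    unfolding countably_additive_def
  proof (intro allI impI)
    fix S :: "nat \<Rightarrow> 'a set"
    assume S: "range S \<subseteq> sets borel" "disjoint_family S"
    have "(\<Sum>i. ?\<mu> (S i)) = (\<Sum>i. emeasure (return borel 0) (S i)) + (\<Sum>i. emeasure (density lborel (\<lambda>x. ennreal (F x))) (S i))"
      by (rule suminf_add[symmetric]) auto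
    also have "(\<Sum>i. emeasure (return borel 0) (S i)) = emeasure (return borel 0) (\<Union> (range S))"
      by (rule suminf_emeasure) (use S in auto)
    also have "(\<Sum>i. emeasure (density lborel (\<lambda>x. ennreal (F x))) (S i)) = emeasure (density lborel (\<lambda>x. ennreal (F x))) (\<Union> (range S))"
      by (rule suminf_emeasure) (use S in auto)
    finally show "(\<Sum>i. ?\<mu> (S i)) = ?\<mu> (\<Union> (range S))" .
  qed
qed (rule A)

lemma nn_integral_dirac_plus:
  fixes f :: "'a::euclidean_space \<Rightarrow> ennreal"
  assumes "f \<in> borel_measurable borel"
  shows "(\<integral>\<^sup>+x. f x \<partial>dirac_plus F) = f 0 + (\<integral>\<^sup>+x. f x \<partial>density lborel (\<lambda>x. ennreal (F x)))"
  using assms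
proof (induction rule: borel_measurable_induct)
  case (cong f g)
  then show ?case by (simp cong: nn_integral_cong)
next
  case (set A)
  then show ?case by (simp add: emeasure_dirac_plus emeasure_return)
next
  case (mult u c)
  then show ?case by (simp add: nn_integral_cmult distrib_left)
next
  case (add u v)
  then show ?case by (simp add: nn_integral_add add_ac)
next
  case (seq U)
  have [measurable]: "U i \<in> borel_measurable borel" for i using seq by auto
  have inc: "incseq U" using seq by simp
  have inc': "incseq (\<lambda>i. \<integral>\<^sup>+x. U i x \<partial>density lborel (\<lambda>x. ennreal (F x)))"
    using inc by (auto simp: incseq_def le_fun_def intro!: nn_integral_mono)
  have inc0: "incseq (\<lambda>i. U i 0)" using inc by (auto simp: incseq_def le_fun_def)
  have "(\<integral>\<^sup>+x. (SUP i. U i) x \<partial>dirac_plus F) = (SUP i. \<integral>\<^sup>+x. U i x \<partial>dirac_plus F)"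
    unfolding SUP_apply by (rule nn_integral_monotone_convergence_SUP) (use inc in auto)
  also have "\<dots> = (SUP i. U i 0 + (\<integral>\<^sup>+x. U i x \<partial>density lborel (\<lambda>x. ennreal (F x))))"
    using seq by simp
  also have "\<dots> = (SUP i. U i 0) + (SUP i. \<integral>\<^sup>+x. U i x \<partial>density lborel (\<lambda>x. ennreal (F x)))"
    by (rule ennreal_SUP_add[OF inc0 inc'])
  also have "(SUP i. \<integral>\<^sup>+x. U i x \<partial>density lborel (\<lambda>x. ennreal (F x))) =
      (\<integral>\<^sup>+x. (SUP i. U i) x \<partial>density lborel (\<lambda>x. ennreal (F x)))"
    unfolding SUP_apply by (rule nn_integral_monotone_convergence_SUP[symmetric]) (use inc in auto)
  also have "(SUP i. U i 0) = (SUP i. U i) 0" by (rule SUP_apply[symmetric])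
  finally show ?case .
qed

lemma integrable_dirac_plus:
  fixes f :: "'a::euclidean_space \<Rightarrow> 'b::{banach, second_countable_topology}"
  assumes f[measurable]: "f \<in> borel_measurable borel" and i: "integrable (density lborel (\<lambda>x. ennreal (F x))) f"
  shows "integrable (dirac_plus F) f"
proof (rule integrableI_bounded)
  show "f \<in> borel_measurable (dirac_plus F)" by measurable
  have "(\<integral>\<^sup>+x. ennreal (norm (f x)) \<partial>dirac_plus F) =
      ennreal (norm (f 0)) + (\<integral>\<^sup>+x. ennreal (norm (f x)) \<partial>density lborel (\<lambda>x. ennreal (F x)))"
    by (rule nn_integral_dirac_plus) measurable
  also have "\<dots> < \<infinity>" using i by (simp add: integrable_iff_bounded)
  finally show "(\<integral>\<^sup>+x. ennreal (norm (f x)) \<partial>dirac_plus F) < \<infinity>" .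
qed

text \<open>Positive and negative parts are handled by \<open>nn_integral_dirac_plus\<close>; at the
  origin \<open>ennreal (f 0)\<close> and \<open>ennreal (- f 0)\<close> recombine to
  \<open>f 0\<close>.\<close>

lemma integral_dirac_plus_real:
  fixes f :: "'a::euclidean_space \<Rightarrow> real"
  assumes f[measurable]: "f \<in> borel_measurable borel" and i: "integrable (density lborel (\<lambda>x. ennreal (F x))) f"
  shows "(LINT x|dirac_plus F. f x) = f 0 + (LINT x|density lborel (\<lambda>x. ennreal (F x)). f x)"
proof -
  let ?D = "density lborel (\<lambda>x. ennreal (F x))"
  have fin: "(\<integral>\<^sup>+x. ennreal (f x) \<partial>?D) < \<infinity>" "(\<integral>\<^sup>+x. ennreal (- f x) \<partial>?D) < \<infinity>"
    using i unfolding real_integrable_def by (auto simp: less_top)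
  have "(LINT x|dirac_plus F. f x) =
      enn2real (ennreal (f 0) + (\<integral>\<^sup>+x. ennreal (f x) \<partial>?D)) - enn2real (ennreal (- f 0) + (\<integral>\<^sup>+x. ennreal (- f x) \<partial>?D))"
    by (subst real_lebesgue_integral_def[OF integrable_dirac_plus[OF f i]]) (simp add: nn_integral_dirac_plus)
  also have "\<dots> = (enn2real (ennreal (f 0)) - enn2real (ennreal (- f 0))) +
      (enn2real (\<integral>\<^sup>+x. ennreal (f x) \<partial>?D) - enn2real (\<integral>\<^sup>+x. ennreal (- f x) \<partial>?D))"
    using fin by (simp add: enn2real_plus)
  also have "enn2real (ennreal (f 0)) - enn2real (ennreal (- f 0)) = f 0"
    by (cases "f 0 \<ge> 0") (auto simp: ennreal_neg)
  also have "enn2real (\<integral>\<^sup>+x. ennreal (f x) \<partial>?D) - enn2real (\<integral>\<^sup>+x. ennreal (- f x) \<partial>?D) = (LINT x|?D. f x)"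
    by (rule real_lebesgue_integral_def[OF i, symmetric])
  finally show ?thesis .
qed

lemma integral_dirac_plus:
  fixes f :: "'a::euclidean_space \<Rightarrow> complex"
  assumes f[measurable]: "f \<in> borel_measurable borel" and F[measurable]: "F \<in> borel_measurable borel"
    and F0: "\<And>x. 0 \<le> F x" and i: "integrable lborel (\<lambda>x. F x *\<^sub>R f x)"
  shows "integrable (dirac_plus F) f" "(LINT x|dirac_plus F. f x) = f 0 + (LINT x|lborel. F x *\<^sub>R f x)"
proof -
  let ?D = "density lborel (\<lambda>x. ennreal (F x))"
  have iD: "integrable ?D f" by (subst integrable_density) (use i F0 in auto)
  show iP: "integrable (dirac_plus F) f" by (rule integrable_dirac_plus[OF f iD])
  have "(LINT x|dirac_plus F. f x) = f 0 + (LINT x|?D. f x)"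
  proof (rule complex_eqI)
    show "Re (LINT x|dirac_plus F. f x) = Re (f 0 + (LINT x|?D. f x))"
      unfolding integral_Re[OF iP, symmetric] plus_complex.simps integral_Re[OF iD, symmetric]
      by (rule integral_dirac_plus_real) (use iD in auto)
    show "Im (LINT x|dirac_plus F. f x) = Im (f 0 + (LINT x|?D. f x))"
      unfolding integral_Im[OF iP, symmetric] plus_complex.simps integral_Im[OF iD, symmetric]
      by (rule integral_dirac_plus_real) (use iD in auto)
  qed
  also have "(LINT x|?D. f x) = (LINT x|lborel. F x *\<^sub>R f x)"
    by (rule integral_density) (use F0 in auto)
  finally show "(LINT x|dirac_plus F. f x) = f 0 + (LINT x|lborel. F x *\<^sub>R f x)" .
qed

lemma emeasure_dirac_plus_le:
  assumes [measurable]: "A \<in> sets borel" and F: "\<And>x. F x \<le> 1"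
  shows "emeasure (dirac_plus F) A \<le> 1 + emeasure lborel A"
proof -
  have "emeasure (density lborel (\<lambda>x. ennreal (F x))) A \<le> emeasure lborel A"
  proof (cases "(\<lambda>x. ennreal (F x)) \<in> borel_measurable lborel")
    case True
    have "emeasure (density lborel (\<lambda>x. ennreal (F x))) A = (\<integral>\<^sup>+x. ennreal (F x) * indicator A x \<partial>lborel)"
      by (rule emeasure_density[OF True]) simp
    also have "\<dots> \<le> (\<integral>\<^sup>+x. indicator A x \<partial>lborel)"
      by (rule nn_integral_mono) (auto simp: indicator_def F ennreal_le_1)
    finally show ?thesis by simp
  next
    \<comment> \<open>For a non-measurable \<open>F\<close>, \<open>density\<close> takes either the
      value of the defining integral or the default value 0.\<close>
    case False
    have "emeasure (density lborel (\<lambda>x. ennreal (F x))) A \<le> (\<integral>\<^sup>+x. ennreal (F x) * indicator A x \<partial>lborel)"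
      unfolding density_def emeasure_measure_of_conv by auto
    also have "\<dots> \<le> (\<integral>\<^sup>+x. indicator A x \<partial>lborel)"
      by (rule nn_integral_mono) (auto simp: indicator_def F ennreal_le_1)
    finally show ?thesis by simp
  qed
  then show ?thesis
    by (simp add: emeasure_dirac_plus emeasure_return add_mono indicator_def)
qed

lemma locally_finite_dirac_plus:
  assumes "\<And>x. F x \<le> 1" shows "locally_finite_borel (dirac_plus F)"
  unfolding locally_finite_borel_def
proof (intro conjI ballI impI)
  fix A :: "'a set" assume A: "A \<in> sets borel" "bounded A"
  show "emeasure (dirac_plus F) A < \<infinity>"
    by (rule le_less_trans[OF emeasure_dirac_plus_le[OF A(1) assms]]) (use emeasure_bounded_finite[OF A(2)] in simp)
qed simp

text \<open>The Dirac part contributes at most 1 and Lebesgue measure is translation invariant, so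
  one bound serves all translates.\<close>

lemma translation_bounded_dirac_plus:
  fixes F :: "'a::euclidean_space \<Rightarrow> real"
  assumes "\<And>x. F x \<le> 1" shows "translation_bounded (dirac_plus F)"
  unfolding translation_bounded_def
proof (intro conjI ballI impI)
  fix B :: "'a set" assume B[measurable]: "B \<in> sets borel" and bB: "bounded B"
  have "emeasure (dirac_plus F) ((+) x ` B) \<le> 1 + emeasure lborel B" for x
  proof -
    have eq: "(+) x ` B = (\<lambda>y. y - x) -` B"
      by (auto simp: image_iff intro!: bexI[of _ "_ - x"])
    have m: "(+) x ` B \<in> sets borel" unfolding eq using measurable_sets[of "\<lambda>y. y - x" borel borel B] by simp
    have "emeasure lborel ((+) x ` B) = (\<integral>\<^sup>+y. indicator ((+) x ` B) y \<partial>lborel)"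
      using m by simp
    also have "\<dots> = (\<integral>\<^sup>+y. indicator B (- x + y) \<partial>lborel)"
      unfolding eq by (rule nn_integral_cong) (simp add: indicator_def)
    also have "\<dots> = emeasure lborel B" using nn_integral_lborel_translate[of "indicator B" "- x"] by simp
    finally show ?thesis using emeasure_dirac_plus_le[OF m assms] by simp
  qed
  then have "(SUP x. emeasure (dirac_plus F) ((+) x ` B)) \<le> 1 + emeasure lborel B" by (intro SUP_least)
  also have "\<dots> < \<infinity>" using emeasure_bounded_finite[OF bB] by simp
  finally show "(SUP x. emeasure (dirac_plus F) ((+) x ` B)) < \<infinity>" .
qed simp

lemma set_integrable_bounded_density:
  fixes F :: "'a::euclidean_space \<Rightarrow> real"
  assumes A: "A \<in> sets borel" "bounded A" and [measurable]: "F \<in> borel_measurable borel"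
    and F: "\<And>x. 0 \<le> F x" "\<And>x. F x \<le> 1"
  shows "set_integrable lborel A F"
proof -
  have "integrable lborel (indicator A :: 'a \<Rightarrow> real)"
    by (rule integrable_real_indicator) (use A emeasure_bounded_finite[OF A(2)] in auto)
  then show ?thesis unfolding set_integrable_def
    by (rule Bochner_Integration.integrable_bound) (use A F in \<open>auto simp: indicator_def\<close>)
qed

lemma measure_dirac_plus:
  fixes F :: "'a::euclidean_space \<Rightarrow> real"
  assumes A: "A \<in> sets borel" "bounded A" and F[measurable]: "F \<in> borel_measurable borel"
    and F01: "\<And>x. 0 \<le> F x" "\<And>x. F x \<le> 1"
  shows "measure (dirac_plus F) A = measure (return borel 0) A + (LINT x:A|lborel. F x)"
proof -
  note [measurable] = A(1)
  have i: "integrable lborel (\<lambda>x. indicator A x * F x)"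
    using set_integrable_bounded_density[OF assms] by (simp add: set_integrable_def)
  have "emeasure (density lborel (\<lambda>x. ennreal (F x))) A = (\<integral>\<^sup>+x. ennreal (indicator A x * F x) \<partial>lborel)"
    by (subst emeasure_density) (auto intro!: nn_integral_cong simp: indicator_def)
  also have "\<dots> = ennreal (LINT x:A|lborel. F x)"
    unfolding set_lebesgue_integral_def real_scaleR_def by (rule nn_integral_eq_integral[OF i]) (simp add: F01)
  finally have D: "emeasure (density lborel (\<lambda>x. ennreal (F x))) A = ennreal (LINT x:A|lborel. F x)" .
  have L0: "0 \<le> (LINT x:A|lborel. F x)"
    unfolding set_lebesgue_integral_def by (rule Bochner_Integration.integral_nonneg) (simp add: F01)
  have "emeasure (return borel 0) A = ennreal (measure (return borel 0) A)"
    by (cases "0 \<in> A") (auto simp: measure_def emeasure_return indicator_def)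
  then have "emeasure (dirac_plus F) A = ennreal (measure (return borel 0) A + (LINT x:A|lborel. F x))"
    unfolding emeasure_dirac_plus[OF A(1)] D using L0 by simp
  then have "measure (dirac_plus F) A = enn2real (ennreal (measure (return borel 0) A + (LINT x:A|lborel. F x)))"
    unfolding measure_def[of "dirac_plus F"] by (rule arg_cong)
  then show ?thesis using L0 by (simp only: enn2real_ennreal add_nonneg_nonneg measure_nonneg)
qed

text \<open>Integrals over \<open>A\<close> do not see null sets. This allows \<open>G\<close> to be
  built from \<open>K2hat\<close>, which is known to equal \<open>g\<close> almost
  everywhere.\<close>

lemma eq_dirac_plus_density_dirac_plus:
  fixes F :: "'a::euclidean_space \<Rightarrow> real" and G :: "'a \<Rightarrow> complex"
  assumes F[measurable]: "F \<in> borel_measurable borel" and F01: "\<And>x. 0 \<le> F x" "\<And>x. F x \<le> 1"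
    and G[measurable]: "G \<in> borel_measurable borel" and ae: "AE x in lborel. G x = of_real (F x)"
  shows "eq_dirac_plus_density (dirac_plus F) G"
  unfolding eq_dirac_plus_density_def
proof (intro conjI ballI impI locally_finite_dirac_plus F01)
  fix A :: "'a set" assume A: "A \<in> sets borel" "bounded A"
  note [measurable] = A(1)
  have i: "integrable lborel (\<lambda>x. indicator A x * F x)"
    using set_integrable_bounded_density[OF A F F01] by (simp add: set_integrable_def)
  have ae': "AE x in lborel. indicator A x *\<^sub>R G x = of_real (indicator A x * F x)"
    using ae by eventually_elim (auto simp: indicator_def)
  show "set_integrable lborel A G"
    unfolding set_integrable_def using integrable_of_real[OF i, where 'a=complex]
    by (rule integrable_cong_AE[THEN iffD1, rotated 3]) (use ae' in \<open>auto elim: eventually_mono\<close>)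
  have "(LINT x:A|lborel. G x) = (LINT x|lborel. complex_of_real (indicator A x * F x))"
    unfolding set_lebesgue_integral_def by (rule integral_cong_AE) (use ae' in auto)
  also have "\<dots> = of_real (LINT x:A|lborel. F x)"
    unfolding set_lebesgue_integral_def real_scaleR_def by (rule integral_complex_of_real)
  finally show "complex_of_real (measure (dirac_plus F) A) =
      complex_of_real (measure (return borel 0) A) + (LINT x:A|lborel. G x)"
    by (simp add: measure_dirac_plus[OF A F F01])
qed

section \<open>The autocorrelation of a counting measure\<close>

text \<open>On \<open>B\<close> the measure \<open>N\<close> is a finite sum of Dirac measures, so
  its convolution with the reflected copy is the sum of Dirac measures at all differences, those
  with i = j included.\<close>

lemma emeasure_autocorrelation_ball:
  fixes N :: "'a::euclidean_space measure"
  assumes N: "N \<in> counting_measures" and A[measurable]: "A \<in> sets borel"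
    and B[measurable]: "B \<in> sets borel" and bB: "bounded B"
  defines "J \<equiv> {i \<in> point_indices N. fst i \<in> B}"
  shows "emeasure (measure_convolution (restrict_to N B) (reflect (restrict_to N B))) A =
    card {(i, j). {i, j} \<subseteq> J \<and> fst i - fst j \<in> A}"
proof -
  let ?M1 = "restrict_to N B" and ?M2 = "reflect (restrict_to N B)"
  have sN[measurable_cong, simp]: "sets N = sets borel" by (rule sets_counting_measure[OF N])
  have s1[measurable_cong]: "sets ?M1 = sets borel" by (simp add: restrict_to_def)
  have s2[measurable_cong]: "sets ?M2 = sets borel" by (simp add: reflect_def)
  have sp[simp]: "space N = UNIV" "space ?M1 = UNIV" "space ?M2 = UNIV"
    using sets_eq_imp_space_eq[OF sN] sets_eq_imp_space_eq[OF s1] sets_eq_imp_space_eq[OF s2] by simp_all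
  have fJ: "finite J" unfolding J_def by (rule finite_point_indices[OF N B bB])
  have int1: "(\<integral>\<^sup>+x. f x \<partial>?M1) = (\<Sum>i\<in>J. f (fst i))" if [measurable]: "f \<in> borel_measurable borel" for f
  proof -
    have "(\<integral>\<^sup>+x. f x \<partial>?M1) = (\<integral>\<^sup>+x. indicator B x * f x \<partial>N)"
      unfolding restrict_to_def by (rule nn_integral_density) measurable
    also have "\<dots> = (\<integral>\<^sup>+i. indicator B (fst i) * f (fst i) \<partial>count_space (point_indices N))"
      by (rule nn_integral_counting_measure[OF N]) measurable
    also have "\<dots> = (\<Sum>i\<in>J. indicator B (fst i) * f (fst i))"
      by (rule nn_integral_count_space'[OF fJ]) (auto simp: J_def)
    also have "\<dots> = (\<Sum>i\<in>J. f (fst i))" by (rule sum.cong) (auto simp: J_def)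
    finally show ?thesis .
  qed
  have int2: "(\<integral>\<^sup>+y. f y \<partial>?M2) = (\<Sum>j\<in>J. f (- fst j))" if [measurable]: "f \<in> borel_measurable borel" for f
    unfolding reflect_def by (subst nn_integral_distr) (auto simp: int1)
  \<comment> \<open>The total mass is \<open>card J\<close>, hence finite, as iterated integration
    over the product measure requires.\<close>
  have "emeasure ?M2 (space ?M2) = (\<Sum>j\<in>J. 1)"
    using int2[of "\<lambda>_. 1"] by simp
  then have "emeasure ?M2 (space ?M2) \<noteq> \<infinity>" by simp
  then interpret M2: finite_measure ?M2 by (rule finite_measureI)
  have "emeasure (measure_convolution ?M1 ?M2) A = (\<integral>\<^sup>+z. indicator A z \<partial>measure_convolution ?M1 ?M2)"
    by (simp add: measure_convolution_def)
  also have "\<dots> = (\<integral>\<^sup>+z. indicator A (case z of (x, y) \<Rightarrow> x + y) \<partial>(?M1 \<Otimes>\<^sub>M ?M2))"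
    unfolding measure_convolution_def by (rule nn_integral_distr) measurable
  also have "\<dots> = (\<integral>\<^sup>+z. indicator A (fst z + snd z) \<partial>(?M1 \<Otimes>\<^sub>M ?M2))"
    by (simp add: split_beta)
  also have "\<dots> = (\<integral>\<^sup>+x. \<integral>\<^sup>+y. indicator A (fst (x, y) + snd (x, y)) \<partial>?M2 \<partial>?M1)"
  proof (rule M2.nn_integral_fst[symmetric])
    have "(\<lambda>z. indicator A (fst z + snd z) :: ennreal) \<in> borel_measurable (borel \<Otimes>\<^sub>M borel)" by measurable
    then show "(\<lambda>z. indicator A (fst z + snd z) :: ennreal) \<in> borel_measurable (?M1 \<Otimes>\<^sub>M ?M2)"
      using measurable_cong_sets[OF sets_pair_measure_cong[OF s1 s2] refl] by blast
  qed
  also have "\<dots> = (\<integral>\<^sup>+x. \<integral>\<^sup>+y. indicator A (x + y) \<partial>?M2 \<partial>?M1)" by simp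
  also have "\<dots> = (\<integral>\<^sup>+x. (\<Sum>j\<in>J. indicator A (x - fst j)) \<partial>?M1)"
    by (intro nn_integral_cong) (subst int2, auto)
  also have "\<dots> = (\<Sum>i\<in>J. \<Sum>j\<in>J. indicator A (fst i - fst j))"
    by (rule int1) measurable
  also have "\<dots> = (\<Sum>z\<in>J \<times> J. indicator A (fst (fst z) - fst (snd z)))"
    by (simp add: sum.cartesian_product split_beta)
  also have "\<dots> = of_nat (card {z \<in> J \<times> J. fst (fst z) - fst (snd z) \<in> A})"
    using fJ by (simp add: indicator_def sum.If_cases Int_def conj_commute)
  also have "{z \<in> J \<times> J. fst (fst z) - fst (snd z) \<in> A} = {(i, j). {i, j} \<subseteq> J \<and> fst i - fst j \<in> A}"
    by auto
  finally show ?thesis .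
qed

section \<open>Autocorrelation and diffraction\<close>

context determinantal_process
begin

text \<open>The integral of \<open>fourier f\<close> is \<open>f 0\<close> and
  \<open>fourier f 0\<close> is the integral of \<open>f\<close>, so \<delta>_0 and Lebesgue measure
  swap. In the remaining term \<open>fourier_multiplication\<close> moves the transform from
  \<open>f\<close> to |K|^2, and \<open>K2hat\<close> becomes \<open>g\<close> under the
  integral.\<close>

lemma fourier_transform_dirac_plus_r:
  "is_fourier_transform (dirac_plus r) (dirac_plus (\<lambda>x. 1 - g x))"
  unfolding is_fourier_transform_def
proof (intro conjI allI impI)
  show "translation_bounded (dirac_plus (\<lambda>x. 1 - g x))"
    by (rule translation_bounded_dirac_plus) (use g_nonneg in simp)
  fix f :: "'a \<Rightarrow> complex" assume f: "schwartz f"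
  have fm[measurable]: "f \<in> borel_measurable borel" using f by simp
  have fi: "integrable lborel f" by (rule schwartz_integrable[OF f])
  have gf: "integrable lborel (\<lambda>x. g x *\<^sub>R f x)"
    by (rule Bochner_Integration.integrable_bound[OF fi]) (auto simp: g_nonneg g_le1 mult_left_le_one_le)
  have Fi: "integrable lborel (fourier f)" by (rule integrable_fourier_schwartz[OF f])
  have KF: "integrable lborel (\<lambda>x. (cmod (K x))\<^sup>2 *\<^sub>R fourier f x)"
    by (rule Bochner_Integration.integrable_bound[OF Fi])
      (auto simp: norm_K_le1 power_le_one mult_left_le_one_le)
  have gf1: "integrable lborel (\<lambda>x. (1 - g x) *\<^sub>R f x)"
    using Bochner_Integration.integrable_diff[OF fi gf] by (simp add: scaleR_diff_left)
  have KF1: "integrable lborel (\<lambda>x. r x *\<^sub>R fourier f x)"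
    using Bochner_Integration.integrable_diff[OF Fi KF] by (simp add: r_def scaleR_diff_left)
  have g1: "0 \<le> 1 - g x" for x using g_le1 by simp
  have gm: "(\<lambda>x. 1 - g x) \<in> borel_measurable borel" by measurable
  note \<mu> = integral_dirac_plus[OF fm gm g1 gf1]
  note \<gamma> = integral_dirac_plus[OF borel_measurable_fourier[OF fm] measurable_r r_nonneg KF1]
  show "integrable (dirac_plus (\<lambda>x. 1 - g x)) f" by (rule \<mu>(1))
  show "integrable (dirac_plus r) (fourier f)" by (rule \<gamma>(1))
  have "(LINT x|lborel. (cmod (K x))\<^sup>2 *\<^sub>R fourier f x) = (LINT x|lborel. fourier f x * of_real ((cmod (K x))\<^sup>2))"
    by (simp add: scaleR_conv_of_real mult.commute)
  also have "\<dots> = (LINT x|lborel. f x * K2hat x)"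
    unfolding K2hat_def by (rule fourier_multiplication[OF fi integrable_of_real[OF integrable_K2]])
  also have "\<dots> = (LINT x|lborel. g x *\<^sub>R f x)"
    by (rule integral_cong_AE) (use K2hat_AE in \<open>auto simp: scaleR_conv_of_real mult.commute elim: eventually_mono\<close>)
  finally have swap: "(LINT x|lborel. (cmod (K x))\<^sup>2 *\<^sub>R fourier f x) = (LINT x|lborel. g x *\<^sub>R f x)" .
  have "(LINT x|dirac_plus (\<lambda>x. 1 - g x). f x) = f 0 + ((LINT x|lborel. f x) - (LINT x|lborel. g x *\<^sub>R f x))"
    unfolding \<mu>(2) scaleR_diff_left scaleR_one by (simp only: Bochner_Integration.integral_diff[OF fi gf])
  also have "\<dots> = fourier f 0 + ((LINT x|lborel. fourier f x) - (LINT x|lborel. (cmod (K x))\<^sup>2 *\<^sub>R fourier f x))"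
    unfolding swap integral_fourier_schwartz[OF f] by (simp add: fourier_cis)
  also have "\<dots> = (LINT x|dirac_plus r. fourier f x)"
    unfolding \<gamma>(2) r_def scaleR_diff_left scaleR_one by (simp only: Bochner_Integration.integral_diff[OF Fi KF])
  finally show "(LINT x|dirac_plus (\<lambda>x. 1 - g x). f x) = (LINT x|dirac_plus r. fourier f x)" .
qed

section \<open>Convergence of the normalised autocorrelations\<close>

abbreviation autocorrelation_ball :: "nat \<Rightarrow> 'w \<Rightarrow> 'a measure" where
  "autocorrelation_ball n w \<equiv> scale_measure (inverse (emeasure lborel (ball (0::'a) (real n))))
    (measure_convolution (restrict_to (\<omega> w) (ball 0 (real n))) (reflect (restrict_to (\<omega> w) (ball 0 (real n)))))"

text \<open>Index pairs split into the diagonal, which counts all points of the ball if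
  \<open>0 \<in> A\<close> and none otherwise, and the off-diagonal pairs of
  \<open>pair_count\<close>.\<close>

lemma emeasure_autocorrelation_ball_eq:
  assumes w: "w \<in> space M" and A: "A \<in> sets borel" and n: "n > 0"
  shows "emeasure (autocorrelation_ball n w) A =
    ennreal ((indicator A 0 * point_count n w + pair_count A n w) / (unit_ball_vol DIM('a) * real n ^ DIM('a)))"
proof -
  let ?B = "ball (0::'a) (real n)" and ?I = "point_indices (\<omega> w)"
  let ?J = "{i \<in> ?I. fst i \<in> ?B}"
  have fJ: "finite ?J" by (rule finite_point_indices_bounded[OF counting[OF w]]) simp
  define D where "D = (if 0 \<in> A then (\<lambda>i. (i, i)) ` ?J else {})"
  define S where "S = {(i, j). {i, j} \<subseteq> ?I \<and> i \<noteq> j \<and> near A n (fst i) (fst j)}"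
  have "{(i, j). {i, j} \<subseteq> ?J \<and> fst i - fst j \<in> A} = D \<union> S"
    by (auto simp: D_def S_def near_def)
  moreover have "D \<inter> S = {}" by (auto simp: D_def S_def)
  moreover have "finite D" using fJ by (simp add: D_def)
  moreover have "finite S"
    by (rule finite_subset[of _ "?J \<times> ?J"]) (use fJ in \<open>auto simp: S_def near_def\<close>)
  ultimately have "card {(i, j). {i, j} \<subseteq> ?J \<and> fst i - fst j \<in> A} = card D + card S"
    by (simp add: card_Un_disjoint)
  moreover have "real (card D) = indicator A 0 * point_count n w"
    by (auto simp: D_def point_count_def card_image inj_on_def)
  moreover have "real (card S) = pair_count A n w" by (simp add: S_def pair_count_def)
  ultimately have c: "real (card {(i, j). {i, j} \<subseteq> ?J \<and> fst i - fst j \<in> A}) = indicator A 0 * point_count n w + pair_count A n w"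
    by simp
  have v: "0 < unit_ball_vol DIM('a) * real n ^ DIM('a)" using n by simp
  have nn: "0 \<le> indicator A 0 * point_count n w + pair_count A n w" by (simp add: point_count_def pair_count_def)
  have e: "emeasure (measure_convolution (restrict_to (\<omega> w) ?B) (reflect (restrict_to (\<omega> w) ?B))) A =
      ennreal (indicator A 0 * point_count n w + pair_count A n w)"
    by (subst emeasure_autocorrelation_ball[OF counting[OF w] A])
      (simp_all only: ennreal_of_nat_eq_real_of_nat c, simp_all)
  have "inverse (emeasure lborel ?B) = ennreal (1 / (unit_ball_vol DIM('a) * real n ^ DIM('a)))"
    using v by (simp only: vol_def[symmetric] vol_eq inverse_ennreal inverse_eq_divide)
  then show ?thesis
    unfolding emeasure_scale_measure e using v nn
    by (simp only: ennreal_mult[symmetric] zero_le_divide_iff) (simp add: ennreal_mult[symmetric])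
qed

lemma measure_autocorrelation_ball_eq:
  assumes w: "w \<in> space M" and A: "A \<in> sets borel" and n: "n > 0"
  shows "measure (autocorrelation_ball n w) A =
    (indicator A 0 * point_count n w + pair_count A n w) / (unit_ball_vol DIM('a) * real n ^ DIM('a))"
proof -
  have "0 \<le> (indicator A 0 * point_count n w + pair_count A n w) / (unit_ball_vol DIM('a) * real n ^ DIM('a))"
    by (simp add: point_count_def pair_count_def)
  then show ?thesis unfolding measure_def emeasure_autocorrelation_ball_eq[OF assms] by (rule enn2real_ennreal)
qed

text \<open>Each cell has its own exceptional null set; all grids together have countably many
  cells, so one null set serves them all, and off it \<open>vague_limit_gridI\<close>
  applies.\<close>

lemma AE_autocorrelation: "AE w in M. is_autocorrelation (\<omega> w) (dirac_plus r)"
proof -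
  let ?v = "\<lambda>n. unit_ball_vol DIM('a) * real n ^ DIM('a)"
  have countable: "countable (range (grid m :: 'a \<Rightarrow> 'a))" for m
  proof -
    have "range (grid m :: 'a \<Rightarrow> 'a) \<subseteq> (\<Union>n. grid m ` ball 0 (real n))"
    proof
      fix z assume "z \<in> range (grid m :: 'a \<Rightarrow> 'a)"
      then obtain x where x: "z = grid m x" by auto
      obtain n where "norm x < real n" using reals_Archimedean2 by blast
      then show "z \<in> (\<Union>n. grid m ` ball 0 (real n))" unfolding x
        by (intro UN_I[of n] imageI) auto
    qed
    then show ?thesis
      by (rule countable_subset) (rule countable_UN, simp, rule countable_finite, rule finite_grid_image, simp)
  qed
  have cell: "bounded (grid m -` {z :: 'a})" for m z by (rule bounded_grid_vimage) simp
  have "AE w in M. \<forall>m. \<forall>z\<in>range (grid m). (\<lambda>n. pair_count (grid m -` {z}) n w / ?v n) \<longlonglongrightarrow> (LINT x:grid m -` {z}|lborel. r x)"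
    by (simp only: AE_all_countable AE_ball_countable[OF countable]) (intro allI ballI pair_count_LLN borel_grid_cell cell)
  then show ?thesis
    using point_count_LLN AE_space
  proof eventually_elim
    fix w assume pairs: "\<forall>m. \<forall>z\<in>range (grid m). (\<lambda>n. pair_count (grid m -` {z}) n w / ?v n) \<longlonglongrightarrow> (LINT x:grid m -` {z}|lborel. r x)"
      and points: "(\<lambda>n. point_count n w / ?v n) \<longlonglongrightarrow> 1" and w: "w \<in> space M"
    show "is_autocorrelation (\<omega> w) (dirac_plus r)"
      unfolding is_autocorrelation_def
    proof (rule vague_limit_gridI)
      show "locally_finite_borel (dirac_plus r)" by (rule locally_finite_dirac_plus[OF r_le1])
      show "eventually (\<lambda>n. locally_finite_borel (autocorrelation_ball n w)) sequentially"
        using eventually_gt_at_top[of 0]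
      proof eventually_elim
        case (elim n)
        have "sets (autocorrelation_ball n w) = sets borel" by (simp add: measure_convolution_def)
        then show ?case unfolding locally_finite_borel_def
          using emeasure_autocorrelation_ball_eq[OF w _ elim] by (simp del: emeasure_scale_measure)
      qed
      fix m and z :: 'a assume z: "z \<in> range (grid m)"
      let ?A = "grid m -` {z}"
      have "(\<lambda>n. indicator ?A 0 * (point_count n w / ?v n) + pair_count ?A n w / ?v n) \<longlonglongrightarrow>
          indicator ?A 0 * 1 + (LINT x:?A|lborel. r x)"
        using pairs z by (intro tendsto_intros points) auto
      moreover have "eventually (\<lambda>n. indicator ?A 0 * (point_count n w / ?v n) + pair_count ?A n w / ?v n =
          measure (autocorrelation_ball n w) ?A) sequentially"
        using eventually_gt_at_top[of 0]
        by eventually_elim (simp add: measure_autocorrelation_ball_eq[OF w borel_grid_cell] add_divide_distrib)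
      ultimately have "(\<lambda>n. measure (autocorrelation_ball n w) ?A) \<longlonglongrightarrow> indicator ?A 0 * 1 + (LINT x:?A|lborel. r x)"
        by (rule Lim_transform_eventually)
      moreover have "measure (dirac_plus r) ?A = indicator ?A 0 * 1 + (LINT x:?A|lborel. r x)"
        by (simp only: measure_dirac_plus[OF borel_grid_cell cell measurable_r r_nonneg r_le1])
          (auto simp: measure_def emeasure_return borel_grid_cell indicator_def)
      ultimately show "(\<lambda>n. measure (autocorrelation_ball n w) ?A) \<longlonglongrightarrow> measure (dirac_plus r) ?A" by simp
    qed
  qed
qed

end

theorem corollary3p7:
  fixes \<phi> :: "'a::euclidean_space \<Rightarrow> real"
    and K :: "'a \<Rightarrow> complex"
    and M :: "'w measure"
    and \<omega> :: "'w \<Rightarrow> 'a measure"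
  assumes density: "has_bochner_integral lborel \<phi> 1"
    and range: "\<And>x. \<phi> x \<in> {0..1}"
    and K: "K = fourier (\<lambda>x. complex_of_real (\<phi> x))"
    and det: "determinantal M \<omega> (\<lambda>x y. K (x - y))"
  shows "AE w in M. \<exists>\<gamma> \<mu>.
           is_autocorrelation (\<omega> w) \<gamma> \<and> is_diffraction (\<omega> w) \<mu> \<and>
           is_fourier_transform \<gamma> \<mu> \<and>
           eq_dirac_plus_density \<gamma> (\<lambda>x. 1 - (cmod (K x))\<^sup>2) \<and>
           eq_dirac_plus_density \<mu> (\<lambda>y. 1 - fourier (\<lambda>x. (cmod (K x))\<^sup>2) y) \<and>
           eq_dirac_plus_density \<gamma>
             (\<lambda>x. 1 - (cmod (fourier (\<lambda>t. complex_of_real (\<phi> t)) x))\<^sup>2) \<and>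
           eq_dirac_plus_density \<mu>
             (\<lambda>y. 1 - complex_of_real (fun_convolution \<phi> (\<lambda>x. \<phi> (- x)) y))"
proof -
  interpret \<phi>: bounded_density \<phi>
    by standard (use density range in \<open>auto simp: has_bochner_integral_iff\<close>)
  have K': "\<phi>.K = K" by (simp add: \<phi>.K_def K)
  have "prob_space M" using det by (simp add: determinantal_def point_process_def)
  then interpret P: determinantal_process \<phi> M \<omega> "\<lambda>n. emeasure lborel (ball (0::'a) (real n))"
    by (intro determinantal_process.intro determinantal_process_axioms.intro \<phi>.bounded_density_axioms)
      (simp_all add: K' det)
  \<comment> \<open>Both measures are the same for every realisation; only the convergence to
    \<open>?\<gamma>\<close> is an almost sure statement.\<close>
  let ?\<gamma> = "dirac_plus P.r" and ?\<mu> = "dirac_plus (\<lambda>x. 1 - \<phi>.g x)"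
  have Km: "K \<in> borel_measurable borel" using \<phi>.measurable_K by (simp add: K')
  have \<gamma>: "eq_dirac_plus_density ?\<gamma> (\<lambda>x. 1 - (cmod (K x))\<^sup>2)"
    using Km by (intro eq_dirac_plus_density_dirac_plus P.measurable_r P.r_nonneg P.r_le1) (auto simp: P.r_def K')
  have gm: "(\<lambda>x. 1 - \<phi>.g x) \<in> borel_measurable borel" "0 \<le> 1 - \<phi>.g x" "1 - \<phi>.g x \<le> 1" for x
    using \<phi>.g_nonneg \<phi>.g_le1 by auto
  have hat: "(\<lambda>y. fourier (\<lambda>x. (cmod (K x))\<^sup>2) y) = \<phi>.K2hat"
    by (simp add: \<phi>.K2hat_def K' fun_eq_iff)
  have \<mu>1: "eq_dirac_plus_density ?\<mu> (\<lambda>y. 1 - fourier (\<lambda>x. (cmod (K x))\<^sup>2) y)"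
    unfolding hat using \<phi>.K2hat_AE
    by (intro eq_dirac_plus_density_dirac_plus gm) (auto elim: eventually_mono)
  have \<mu>2: "eq_dirac_plus_density ?\<mu> (\<lambda>y. 1 - complex_of_real (fun_convolution \<phi> (\<lambda>x. \<phi> (- x)) y))"
    unfolding \<phi>.g_def[symmetric] by (intro eq_dirac_plus_density_dirac_plus gm) auto
  have ft: "is_fourier_transform ?\<gamma> ?\<mu>" by (rule P.fourier_transform_dirac_plus_r)
  show ?thesis
    using P.AE_autocorrelation
  proof eventually_elim
    case (elim w)
    then have "is_diffraction (\<omega> w) ?\<mu>" using ft unfolding is_diffraction_def by blast
    then show ?case using elim ft \<gamma> \<mu>1 \<mu>2 unfolding K[symmetric] by blast
  qed
qed

end
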